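(* Let $E$ be an elliptic curve over the finite field $\mathbb F_q$, let $a_q=q+1-\#E(\mathbb F_q)$, and let $\pi:E\to\mathbb P^1$ be the degree $2$ map given by the $x$-coordinate of a Weierstrass equation of $E$. Let $s_q(E)$ and $i_q(E)$ be the numbers of split and inert points of $\mathbb P^1(\mathbb F_q)$, respectively. Then $$a_q=i_q(E)-s_q(E),$$ and for every $n\ge 0$, $$\#\operatorname{Sym}^nE(\mathbb F_q)=\sum_{i+j=n}\Big[(q^i+\cdots+q+1)\sum_{\alpha\in\operatorname{Sym}^j\mathbb P^1(\mathbb F_q)}\chi(\alpha)\Big],$$ where $i,j\ge0$.
   Context: For a closed point $x\in|\mathbb P^1|$ and $y\in\pi^{-1}(x)$, let $e(y\mid x)$ be the ramification index and $f(y\mid x)=[k(y):k(x)]$. The point $x$ is ramified if $e(y\mid x)>1$ for some $y\in\pi^{-1}(x)$; split if $e(y\mid x)=f(y\mid x)=1$ for all $y\in\pi^{-1}(x)$; inert if $\pi^{-1}(x)$ is a single closed point $y$ with $e(y\mid x)=1$. Set $\chi(x)=0,1,-1$ if $x$ is ramified, split, inert respectively. The set $\operatorname{Sym}^n X(\mathbb F_q)$, for a smooth projective curve $X/\mathbb F_q$, is identified with the set of effective $0$-cycles $\alpha=\sum_{x\in|X|}a_xx$ ($a_x\ge0$, finitely many nonzero) of degree $\sum_x a_x[k(x):\mathbb F_q]=n$. The function $\chi$ is extended to effective $0$-cycles on $\mathbb P^1$ multiplicatively: $\chi(\sum a_xx)=\prod_x\chi(x)^{a_x}$ (with $\chi(x)^0=1$).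 *)

theory Defs
  imports
    "HOL-Algebra.Algebra"
    "HOL-Algebra.Algebraic_Closure_Type"
    "HOL-Computational_Algebra.Computational_Algebra"
    "HOL-Library.Multiset"
begin

section \<open>Integral projective curves\<close>

text \<open>
  An integral closed subscheme \<open>C\<close> of projective space over a field \<open>k\<close> is given by its function
  field, the copy of \<open>k\<close> in it (\<open>scalars\<close>), and the homogeneous coordinates of its generic point
  (\<open>coords\<close>). The coordinate ring of the standard affine chart where the coordinate \<open>c\<close> does not
  vanish is the subring of the function field generated by \<open>k\<close> and all quotients \<open>d/c\<close>.
\<close>

record 'f curve = "'f ring" +
  scalars :: "'f set"
  coords :: "'f set"

definition chart_ring :: "('f, 'm) curve_scheme \<Rightarrow> 'f \<Rightarrow> 'f set" where
  "chart_ring C c =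
     generate_ring C (scalars C \<union> {d \<otimes>\<^bsub>C\<^esub> inv\<^bsub>C\<^esub> c | d. d \<in> coords C})"

definition localization :: "('f, 'm) ring_scheme \<Rightarrow> 'f set \<Rightarrow> 'f set \<Rightarrow> 'f set" where
  "localization F A M = {a \<otimes>\<^bsub>F\<^esub> inv\<^bsub>F\<^esub> b | a b. a \<in> A \<and> b \<in> A - M}"

text \<open>
  Closed points of a curve are the maximal ideals of the rings of the standard charts, where
  maximal ideals of different charts are the same point iff they have the same local ring.
  A closed point is therefore represented by its local ring inside the function field.
\<close>

definition closed_points :: "('f, 'm) curve_scheme \<Rightarrow> 'f set set" where
  "closed_points C =
     {localization C (chart_ring C c) M | c M.
        c \<in> coords C \<and> c \<noteq> \<zero>\<^bsub>C\<^esub> \<and> maximalideal M (C\<lparr>carrier := chart_ring C c\<rparr>)}"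

definition local_ring :: "('f, 'm) curve_scheme \<Rightarrow> 'f set \<Rightarrow> ('f, 'm) curve_scheme" where
  "local_ring C x = C\<lparr>carrier := x\<rparr>"

definition max_ideal :: "('f, 'm) curve_scheme \<Rightarrow> 'f set \<Rightarrow> 'f set" where
  "max_ideal C x = x - Units (local_ring C x)"

definition residue_field :: "('f, 'm) curve_scheme \<Rightarrow> 'f set \<Rightarrow> 'f set ring" where
  "residue_field C x = local_ring C x Quot max_ideal C x"

definition residue_class :: "('f, 'm) curve_scheme \<Rightarrow> 'f set \<Rightarrow> 'f \<Rightarrow> 'f set" where
  "residue_class C x f = max_ideal C x +>\<^bsub>local_ring C x\<^esub> f"

text \<open>The degree \<open>[k(x) : k]\<close>.\<close>

definition point_degree :: "('f, 'm) curve_scheme \<Rightarrow> 'f set \<Rightarrow> nat" where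
  "point_degree C x =
     (ring.dim (residue_field C x) over (residue_class C x ` scalars C))
       (carrier (residue_field C x))"

text \<open>
  Effective 0-cycles of degree \<open>n\<close>, which are the rational points of the \<open>n\<close>-th symmetric power;
  \<open>count \<alpha> x\<close> is the coefficient of \<open>x\<close>.
\<close>

definition Sym :: "nat \<Rightarrow> ('f, 'm) curve_scheme \<Rightarrow> 'f set multiset set" where
  "Sym n C =
     {\<alpha>. set_mset \<alpha> \<subseteq> closed_points C \<and>
         (\<Sum>x\<in>set_mset \<alpha>. count \<alpha> x * point_degree C x) = n}"


section \<open>Ramification and inertia\<close>

text \<open>
  A dominant morphism \<open>D \<rightarrow> C\<close> of curves is given by its pullback \<open>\<phi>\<close> from the function field
  of \<open>C\<close> to that of \<open>D\<close>. A point \<open>y\<close> is mapped to \<open>x\<close> iff \<open>\<phi>\<close> restricts to a local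
  homomorphism between the local rings at \<open>x\<close> and \<open>y\<close>.
\<close>

definition fiber ::
    "('g, 'm) curve_scheme \<Rightarrow> ('f, 'l) curve_scheme \<Rightarrow> ('f \<Rightarrow> 'g) \<Rightarrow> 'f set \<Rightarrow> 'g set set" where
  "fiber D C \<phi> x =
     {y \<in> closed_points D. \<phi> ` x \<subseteq> y \<and> \<phi> ` max_ideal C x \<subseteq> max_ideal D y}"

primrec ideal_power :: "('f, 'm) ring_scheme \<Rightarrow> 'f set \<Rightarrow> nat \<Rightarrow> 'f set" where
  "ideal_power R I 0 = carrier R"
| "ideal_power R I (Suc n) = ideal_prod R I (ideal_power R I n)"

definition ramification_index ::
    "('g, 'm) curve_scheme \<Rightarrow> ('f, 'l) curve_scheme \<Rightarrow> ('f \<Rightarrow> 'g) \<Rightarrow> 'g set \<Rightarrow> 'f set \<Rightarrow> nat" where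
  "ramification_index D C \<phi> y x =
     (THE e. genideal (local_ring D y) (\<phi> ` max_ideal C x) =
             ideal_power (local_ring D y) (max_ideal D y) e)"

text \<open>The degree \<open>[k(y) : k(x)]\<close>; the image of \<open>k(x)\<close> in \<open>k(y)\<close> consists of the residue classes
  of the pullbacks of functions that are regular at \<open>x\<close>.\<close>

definition inertia_degree ::
    "('g, 'm) curve_scheme \<Rightarrow> ('f \<Rightarrow> 'g) \<Rightarrow> 'g set \<Rightarrow> 'f set \<Rightarrow> nat" where
  "inertia_degree D \<phi> y x =
     (ring.dim (residue_field D y) over ((\<lambda>f. residue_class D y (\<phi> f)) ` x))
       (carrier (residue_field D y))"

definition is_ramified ::
    "('g, 'm) curve_scheme \<Rightarrow> ('f, 'l) curve_scheme \<Rightarrow> ('f \<Rightarrow> 'g) \<Rightarrow> 'f set \<Rightarrow> bool" where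
  "is_ramified D C \<phi> x \<longleftrightarrow> (\<exists>y\<in>fiber D C \<phi> x. ramification_index D C \<phi> y x > 1)"

definition is_split ::
    "('g, 'm) curve_scheme \<Rightarrow> ('f, 'l) curve_scheme \<Rightarrow> ('f \<Rightarrow> 'g) \<Rightarrow> 'f set \<Rightarrow> bool" where
  "is_split D C \<phi> x \<longleftrightarrow>
     (\<forall>y\<in>fiber D C \<phi> x. ramification_index D C \<phi> y x = 1 \<and> inertia_degree D \<phi> y x = 1)"

definition is_inert ::
    "('g, 'm) curve_scheme \<Rightarrow> ('f, 'l) curve_scheme \<Rightarrow> ('f \<Rightarrow> 'g) \<Rightarrow> 'f set \<Rightarrow> bool" where
  "is_inert D C \<phi> x \<longleftrightarrow> (\<exists>y. fiber D C \<phi> x = {y} \<and> ramification_index D C \<phi> y x = 1)"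

text \<open>For a map of degree 2 between smooth curves the last case of \<open>point_char\<close> does not occur.\<close>

definition point_char ::
    "('g, 'm) curve_scheme \<Rightarrow> ('f, 'l) curve_scheme \<Rightarrow> ('f \<Rightarrow> 'g) \<Rightarrow> 'f set \<Rightarrow> int" where
  "point_char D C \<phi> x =
     (if is_ramified D C \<phi> x then 0
      else if is_split D C \<phi> x then 1
      else if is_inert D C \<phi> x then -1
      else undefined)"

definition cycle_char ::
    "('g, 'm) curve_scheme \<Rightarrow> ('f, 'l) curve_scheme \<Rightarrow> ('f \<Rightarrow> 'g) \<Rightarrow> 'f set multiset \<Rightarrow> int" where
  "cycle_char D C \<phi> \<alpha> = (\<Prod>x\<in>set_mset \<alpha>. point_char D C \<phi> x ^ count \<alpha> x)"


section \<open>The projective line and Weierstrass curves\<close>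

definition const_fract :: "'a::field \<Rightarrow> 'a poly fract" where
  "const_fract c = to_fract [:c:]"

definition var_fract :: "'a::field poly fract" where
  "var_fract = to_fract [:0, 1:]"

text \<open>The generic point of the projective line is \<open>[t : 1]\<close>.\<close>

definition proj_line :: "'a::field poly fract curve" where
  "proj_line =
     ring.extend ring_of_type_algebra
       \<lparr>scalars = range const_fract, coords = {var_fract, 1}\<rparr>"

text \<open>
  The Weierstrass equation
  \<open>y\<^sup>2 + a\<^sub>1 x y + a\<^sub>3 y = x\<^sup>3 + a\<^sub>2 x\<^sup>2 + a\<^sub>4 x + a\<^sub>6\<close>.
\<close>

record 'a weierstrass =
  a\<^sub>1 :: 'a
  a\<^sub>2 :: 'a
  a\<^sub>3 :: 'a
  a\<^sub>4 :: 'a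
  a\<^sub>6 :: 'a

definition discriminant :: "'a::field weierstrass \<Rightarrow> 'a" where
  "discriminant W =
     (let b2 = a\<^sub>1 W ^ 2 + 4 * a\<^sub>2 W;
          b4 = 2 * a\<^sub>4 W + a\<^sub>1 W * a\<^sub>3 W;
          b6 = a\<^sub>3 W ^ 2 + 4 * a\<^sub>6 W;
          b8 = a\<^sub>1 W ^ 2 * a\<^sub>6 W + 4 * a\<^sub>2 W * a\<^sub>6 W - a\<^sub>1 W * a\<^sub>3 W * a\<^sub>4 W
               + a\<^sub>2 W * a\<^sub>3 W ^ 2 - a\<^sub>4 W ^ 2
      in - (b2 ^ 2 * b8) - 8 * b4 ^ 3 - 27 * b6 ^ 2 + 9 * b2 * b4 * b6)"

text \<open>In every characteristic the curve is smooth iff its discriminant is nonzero.\<close>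

definition elliptic :: "'a::field weierstrass \<Rightarrow> bool" where
  "elliptic W \<longleftrightarrow> discriminant W \<noteq> 0"

text \<open>The Weierstrass equation as a polynomial in \<open>y\<close> with coefficients in \<open>k(x)\<close>.\<close>

definition weierstrass_poly :: "'a::field weierstrass \<Rightarrow> 'a poly fract poly" where
  "weierstrass_poly W =
     [: - to_fract [:a\<^sub>6 W, a\<^sub>4 W, a\<^sub>2 W, 1:], to_fract [:a\<^sub>3 W, a\<^sub>1 W:], 1 :]"

text \<open>
  The function field of a Weierstrass curve is \<open>k(x)[y]\<close> modulo the Weierstrass equation,
  with elements represented by their remainders; its generic point is \<open>[x : y : 1]\<close>.
\<close>

definition weierstrass_curve :: "'a::field weierstrass \<Rightarrow> 'a poly fract poly curve" where
  "weierstrass_curve W =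
     \<lparr>carrier = {f. degree f < degree (weierstrass_poly W)},
      monoid.mult = (\<lambda>f g. (f * g) mod weierstrass_poly W),
      one = 1,
      ring.zero = 0,
      add = (+),
      scalars = range (\<lambda>c. [:const_fract c:]),
      coords = {[:var_fract:], [:0, 1:], 1}\<rparr>"

text \<open>The pullback along the \<open>x\<close>-coordinate map from a Weierstrass curve to the projective line.\<close>

definition x_pullback :: "'a::field poly fract \<Rightarrow> 'a poly fract poly" where
  "x_pullback f = [:f:]"

text \<open>The solutions of the equation in the base field, and the point at infinity \<open>None\<close>.\<close>

definition rational_points :: "'a::field weierstrass \<Rightarrow> ('a \<times> 'a) option set" where
  "rational_points W =
     insert None (Some ` {(x, y).
       y ^ 2 + a\<^sub>1 W * x * y + a\<^sub>3 W * y = x ^ 3 + a\<^sub>2 W * x ^ 2 + a\<^sub>4 W * x + a\<^sub>6 W})"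

definition frobenius_trace :: "'a::{field, finite} weierstrass \<Rightarrow> int" where
  "frobenius_trace W = int (card (UNIV :: 'a set)) + 1 - int (card (rational_points W))"

text \<open>Rational points of the projective line are its closed points of degree 1.\<close>

definition split_count :: "'a::{field, finite} weierstrass \<Rightarrow> nat" where
  "split_count W =
     card {x \<in> closed_points proj_line.
             point_degree proj_line x = 1 \<and> is_split (weierstrass_curve W) proj_line x_pullback x}"

definition inert_count :: "'a::{field, finite} weierstrass \<Rightarrow> nat" where
  "inert_count W =
     card {x \<in> closed_points proj_line.
             point_degree proj_line x = 1 \<and> is_inert (weierstrass_curve W) proj_line x_pullback x}"

definition weierstrass_char :: "'a::{field, finite} weierstrass \<Rightarrow> 'a poly fract set multiset \<Rightarrow> int" where
  "weierstrass_char W \<alpha> = cycle_char (weierstrass_curve W) proj_line x_pullback \<alpha>"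

end

theory Submission
  imports Defs
begin

text \<open>
  A closed point is a subring of the function field, so both curves are studied through the set of
  these local rings. The function field of \<open>E\<close> is embedded into the algebraic closure of \<open>k(x)\<close>,
  where local rings are sets of elements of a field type. If every local ring of a chart contains
  a member of a family of maximal proper subrings, then this family consists of all closed points.

  Let \<open>A\<close> be the local ring of a point of the projective line, with uniformizer \<open>p\<close>. Over \<open>A\<close> the
  curve is given by a monic quadratic equation \<open>w(y) = 0\<close>, with \<open>y/x\<^sup>2\<close> in place of \<open>y\<close> at infinity.
  If \<open>w\<close> has no root modulo \<open>p\<close>, then \<open>A[y]\<close> is the only local ring above \<open>A\<close>, and \<open>p\<close> generates its
  maximal ideal. Otherwise smoothness provides a \<open>g\<close> such that \<open>w(g)\<close> has valuation 1; then \<open>y - g\<close>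
  generates a maximal ideal of \<open>A[y]\<close>, and so does \<open>y - g'\<close> for the other root \<open>g'\<close> modulo \<open>p\<close>. The
  localizations at these ideals are the local rings above \<open>A\<close>; they coincide iff \<open>2g + h1\<close> is
  divisible by \<open>p\<close>, where \<open>h1\<close> is the linear coefficient of \<open>w\<close>, and then \<open>p\<close> is a unit times
  \<open>(y - g)\<^sup>2\<close>.

  Hence the points above a point \<open>x\<close> of degree \<open>d\<close> contribute \<open>1 / ((1 - T\<^sup>d) (1 - \<chi>(x) T\<^sup>d))\<close> to the
  zeta function of \<open>E\<close>. Taking the product over \<open>x\<close>, the first factors give the zeta function
  \<open>1 / ((1 - T) (1 - q T))\<close> of the projective line. For the trace, a rational point \<open>x\<close> of the
  projective line has \<open>1 + \<chi>(x)\<close> rational points of \<open>E\<close> above it.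
\<close>

section \<open>Local subrings of a field\<close>

text \<open>The maximal ideals of the coordinate ring of \<open>E\<close> need not be principal.
  Working over one local ring \<open>A\<close> of the line at a time removes this obstacle: the
  maximal ideals of \<open>A[y]\<close> are principal, so each local ring in the proof is the
  localization of some ring \<open>S\<close> at \<open>\<pi> S\<close>, where every nonzero element
  of \<open>S\<close> is a power of \<open>\<pi>\<close> times an element outside
  \<open>\<pi> S\<close>. This factorization alone gives a discrete valuation ring and its
  maximality among proper subrings. On the line it comes from degrees; above the line no valuation
  is given beforehand, and it comes from induction on the valuation of the norm to \<open>A\<close>.
  Finiteness of the base field enters the geometry as well as the counting: a unit of a local ring
  with finite residue field has a power congruent to 1, so the maximal ideal contracts to a maximal
  ideal of any chart ring inside it, and no dimension theory is required. Euler products are only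
  taken over points of bounded degree, because a coefficient of degree \<open>n\<close> sees no
  points of degree above \<open>n\<close>.\<close>

definition is_subring :: "'k::field set \<Rightarrow> bool" where
  "is_subring R \<longleftrightarrow> 1 \<in> R \<and> (\<forall>a\<in>R. \<forall>b\<in>R. a - b \<in> R \<and> a * b \<in> R)"

text \<open>The maximal ideal when \<open>R\<close> is local. Zero is listed separately because
  \<open>inverse 0 = 0\<close> lies in every subring.\<close>

definition nonunits :: "'k::field set \<Rightarrow> 'k set" where
  "nonunits R = {a \<in> R. a = 0 \<or> inverse a \<notin> R}"

definition is_local :: "'k::field set \<Rightarrow> bool" where
  "is_local R \<longleftrightarrow> is_subring R \<and> (\<forall>a\<in>nonunits R. \<forall>b\<in>nonunits R. a + b \<in> nonunits R)"

definition residue_classes :: "'k::field set \<Rightarrow> 'k set set" where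
  "residue_classes R = (\<lambda>a. (\<lambda>m. m + a) ` nonunits R) ` R"

lemma is_subringI:
  assumes "1 \<in> R" "\<And>a b. a \<in> R \<Longrightarrow> b \<in> R \<Longrightarrow> a - b \<in> R" "\<And>a b. a \<in> R \<Longrightarrow> b \<in> R \<Longrightarrow> a * b \<in> R"
  shows "is_subring R"
  using assms by (auto simp: is_subring_def)

lemma is_subringD:
  assumes "is_subring R"
  shows "1 \<in> R" "0 \<in> R" "\<And>a b. a \<in> R \<Longrightarrow> b \<in> R \<Longrightarrow> a - b \<in> R"
    "\<And>a b. a \<in> R \<Longrightarrow> b \<in> R \<Longrightarrow> a * b \<in> R" "\<And>a. a \<in> R \<Longrightarrow> - a \<in> R"
    "\<And>a b. a \<in> R \<Longrightarrow> b \<in> R \<Longrightarrow> a + b \<in> R" "\<And>a n. a \<in> R \<Longrightarrow> a ^ n \<in> R"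
proof -
  show 1: "1 \<in> R" and d: "\<And>a b. a \<in> R \<Longrightarrow> b \<in> R \<Longrightarrow> a - b \<in> R"
    and m: "\<And>a b. a \<in> R \<Longrightarrow> b \<in> R \<Longrightarrow> a * b \<in> R"
    using assms by (auto simp: is_subring_def)
  show 0: "0 \<in> R" using d[OF 1 1] by simp
  show u: "\<And>a. a \<in> R \<Longrightarrow> - a \<in> R" using d[OF 0] by fastforce
  show "\<And>a b. a \<in> R \<Longrightarrow> b \<in> R \<Longrightarrow> a + b \<in> R" using d u by fastforce
  show "a ^ n \<in> R" if "a \<in> R" for a n
    by (induction n) (use 1 m that in auto)
qed

lemma is_localD: "is_local R \<Longrightarrow> is_subring R"
  "is_local R \<Longrightarrow> a \<in> nonunits R \<Longrightarrow> b \<in> nonunits R \<Longrightarrow> a + b \<in> nonunits R"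
  by (auto simp: is_local_def)

lemma nonunits_subset: "nonunits R \<subseteq> R"
  by (auto simp: nonunits_def)

lemma nonunits_mult:
  assumes "is_subring R" "a \<in> nonunits R" "b \<in> R"
  shows "a * b \<in> nonunits R"
proof (cases "a * b = 0")
  case False
  have "inverse a \<in> R" if "inverse (a * b) \<in> R"
  proof -
    have "inverse a = b * inverse (a * b)" using False by (simp add: field_simps)
    then show ?thesis using is_subringD(4)[OF assms(1,3) that] by metis
  qed
  then show ?thesis using assms False is_subringD(4)[OF assms(1)] by (auto simp: nonunits_def)
qed (use assms is_subringD(2) in \<open>auto simp: nonunits_def\<close>)

lemma nonunits_uminus: "is_subring R \<Longrightarrow> a \<in> nonunits R \<Longrightarrow> - a \<in> nonunits R"
  using nonunits_mult[of R a "- 1"] is_subringD(1,5)[of R] by auto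

lemma nonunits_diff: "is_local R \<Longrightarrow> a \<in> nonunits R \<Longrightarrow> b \<in> nonunits R \<Longrightarrow> a - b \<in> nonunits R"
  using is_localD(2)[of R a "- b"] nonunits_uminus[of R b] is_localD(1)[of R] by simp

lemma zero_nonunit: "is_subring R \<Longrightarrow> 0 \<in> nonunits R"
  using is_subringD(2) by (auto simp: nonunits_def)

lemma one_not_nonunit: "is_subring R \<Longrightarrow> 1 \<notin> nonunits R"
  using is_subringD(1) by (auto simp: nonunits_def)

lemma nonunits_mult_iff:
  assumes "is_subring R" "a \<in> R" "b \<in> R"
  shows "a * b \<in> nonunits R \<longleftrightarrow> a \<in> nonunits R \<or> b \<in> nonunits R"
proof
  assume ab: "a * b \<in> nonunits R"
  show "a \<in> nonunits R \<or> b \<in> nonunits R"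
  proof (rule ccontr)
    assume "\<not> ?thesis"
    then have "a \<noteq> 0" "b \<noteq> 0" "inverse a \<in> R" "inverse b \<in> R" using assms by (auto simp: nonunits_def)
    then show False using ab is_subringD(4)[OF assms(1), of "inverse a" "inverse b"]
      by (auto simp: nonunits_def)
  qed
qed (use nonunits_mult[of R a b] nonunits_mult[of R b a] assms in \<open>auto simp: mult.commute\<close>)

lemma nonunits_power: "is_subring R \<Longrightarrow> a \<in> R \<Longrightarrow> a ^ n \<in> nonunits R \<Longrightarrow> a \<in> nonunits R"
  by (induction n) (auto simp: one_not_nonunit nonunits_mult_iff is_subringD(7))

lemma unit_plus_nonunit:
  assumes "is_local R" "a \<in> R" "a \<notin> nonunits R" "b \<in> nonunits R"
  shows "a + b \<in> R" "a + b \<notin> nonunits R"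
  using assms is_subringD(6)[OF is_localD(1)[OF assms(1)]] nonunits_subset
    nonunits_diff[of R "a + b" b] by auto

lemma add_image_eq_iff:
  assumes "is_local R" "a \<in> R" "b \<in> R"
  shows "(\<lambda>m. m + a) ` nonunits R = (\<lambda>m. m + b) ` nonunits R \<longleftrightarrow> a - b \<in> nonunits R"
proof
  assume "(\<lambda>m. m + a) ` nonunits R = (\<lambda>m. m + b) ` nonunits R"
  then have "0 + a \<in> (\<lambda>m. m + b) ` nonunits R"
    using zero_nonunit[OF is_localD(1)[OF assms(1)]] by blast
  then show "a - b \<in> nonunits R" by auto
next
  assume ab: "a - b \<in> nonunits R"
  have "m + c \<in> (\<lambda>m. m + d) ` nonunits R" if "m \<in> nonunits R" "c - d \<in> nonunits R" for m c d
    using is_localD(2)[OF assms(1) that] by (intro image_eqI[of _ _ "m + (c - d)"]) auto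
  moreover have "b - a \<in> nonunits R" using nonunits_uminus[OF is_localD(1)[OF assms(1)] ab] by simp
  ultimately show "(\<lambda>m. m + a) ` nonunits R = (\<lambda>m. m + b) ` nonunits R"
    using ab by blast
qed

lemma card_residue_classes:
  assumes "is_local R" "T \<subseteq> R" "\<And>a. a \<in> R \<Longrightarrow> \<exists>t\<in>T. a - t \<in> nonunits R"
    "\<And>s t. s \<in> T \<Longrightarrow> t \<in> T \<Longrightarrow> s - t \<in> nonunits R \<Longrightarrow> s = t"
  shows "card (residue_classes R) = card T"
proof -
  have "inj_on (\<lambda>a. (\<lambda>m. m + a) ` nonunits R) T"
    using assms add_image_eq_iff[OF assms(1)] by (intro inj_onI) blast
  moreover have "residue_classes R = (\<lambda>a. (\<lambda>m. m + a) ` nonunits R) ` T"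
  proof -
    have "\<exists>t\<in>T. (\<lambda>m. m + a) ` nonunits R = (\<lambda>m. m + t) ` nonunits R" if "a \<in> R" for a
      using assms(3)[OF that] add_image_eq_iff[OF assms(1) that] assms(2) by blast
    then show ?thesis using assms(2) unfolding residue_classes_def by (auto simp: image_iff)
  qed
  ultimately show ?thesis by (simp add: card_image)
qed

text \<open>Two powers of \<open>a\<close> share a residue class by the pigeonhole principle, and
  the smaller power, being a unit, can be cancelled. The gain is an inverse modulo the nonunits that
  is itself a power of \<open>a\<close>, hence lies in every subring containing
  \<open>a\<close>.\<close>

lemma unit_power_cong_1:
  assumes "is_local R" "finite (residue_classes R)" "a \<in> R" "a \<notin> nonunits R"
  shows "\<exists>n>0. a ^ n - 1 \<in> nonunits R"
proof -
  note sub = is_localD(1)[OF assms(1)]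
  let ?c = "\<lambda>n::nat. (\<lambda>m. m + a ^ n) ` nonunits R"
  have "range ?c \<subseteq> residue_classes R"
    using is_subringD(7)[OF sub assms(3)] by (auto simp: residue_classes_def)
  then have "finite (range ?c)" using assms(2) finite_subset by blast
  then have "\<not> inj ?c" using finite_imageD by fastforce
  then obtain i j where "i < j" "?c j = ?c i" unfolding inj_def by (metis nat_neq_iff)
  then have d: "a ^ j - a ^ i \<in> nonunits R"
    using add_image_eq_iff[OF assms(1)] is_subringD(7)[OF sub assms(3)] by blast
  have e: "a ^ j - a ^ i = a ^ i * (a ^ (j - i) - 1)"
    using \<open>i < j\<close> by (simp add: algebra_simps flip: power_add)
  have "a ^ i \<notin> nonunits R" using nonunits_power[OF sub assms(3)] assms(4) by blast
  then have "a ^ (j - i) - 1 \<in> nonunits R"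
    using d nonunits_mult_iff[OF sub is_subringD(7)[OF sub assms(3)], of "a ^ (j-i) - 1" i]
     is_subringD(1,3,7)[OF sub] assms(3) unfolding e by auto
  then show ?thesis using \<open>i < j\<close> by (intro exI[of _ "j - i"]) auto
qed

section \<open>Localization at a maximal ideal\<close>

definition loc :: "'k::field set \<Rightarrow> 'k set \<Rightarrow> 'k set" where
  "loc S N = {s / t | s t. s \<in> S \<and> t \<in> S \<and> t \<notin> N}"

definition fractions :: "'k::field set \<Rightarrow> 'k set" where
  "fractions S = {s / t | s t. s \<in> S \<and> t \<in> S \<and> t \<noteq> 0}"

text \<open>Maximality is stated as invertibility modulo \<open>N\<close>, the form in which
  localization and domination arguments use it.\<close>

locale maximal_ideal_set =
  fixes S N :: "'k::field set"
  assumes subring_S: "is_subring S" and N_subset: "N \<subseteq> S" and one_notin: "1 \<notin> N"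
    and zero_in_N: "0 \<in> N" and N_diff: "\<And>a b. a \<in> N \<Longrightarrow> b \<in> N \<Longrightarrow> a - b \<in> N"
    and N_mult: "\<And>a b. a \<in> N \<Longrightarrow> b \<in> S \<Longrightarrow> a * b \<in> N"
    and maximal: "\<And>s. s \<in> S \<Longrightarrow> s \<notin> N \<Longrightarrow> \<exists>t\<in>S. s * t - 1 \<in> N"
begin

abbreviation V where "V \<equiv> loc S N"

lemmas S_closed = is_subringD[OF subring_S]

lemma N_prime:
  assumes "a \<in> S" "b \<in> S" "a \<notin> N" "b \<notin> N"
  shows "a * b \<notin> N"
proof
  assume ab: "a * b \<in> N"
  obtain t where t: "t \<in> S" "a * t - 1 \<in> N" using maximal assms by blast
  have "b * (a * t - 1) \<in> N" using N_mult[OF t(2) assms(2)] by (simp add: mult.commute)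
  moreover have "a * b * t \<in> N" using N_mult ab t by blast
  ultimately have "a * b * t - b * (a * t - 1) \<in> N" by (rule N_diff[rotated])
  then show False using assms(4) by (simp add: algebra_simps)
qed

lemma locI: "s \<in> S \<Longrightarrow> t \<in> S \<Longrightarrow> t \<notin> N \<Longrightarrow> s / t \<in> V"
  by (auto simp: loc_def)

lemma S_subset: "S \<subseteq> V"
  using locI[of _ 1] S_closed(1) one_notin by auto

lemma subring_V: "is_subring V"
proof (rule is_subringI)
  show "1 \<in> V" using S_subset S_closed(1) by blast
  fix a b assume "a \<in> V" "b \<in> V"
  then obtain s t s' t' where st: "a = s / t" "b = s' / t'" "s \<in> S" "t \<in> S" "s' \<in> S" "t' \<in> S" "t \<notin> N" "t' \<notin> N"
    by (auto simp: loc_def)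
  then have nz: "t \<noteq> 0" "t' \<noteq> 0" using zero_in_N by auto
  have "a - b = (s * t' - s' * t) / (t * t')" "a * b = (s * s') / (t * t')"
    using nz by (auto simp: st field_simps)
  moreover have "t * t' \<notin> N" using N_prime st by blast
  ultimately show "a - b \<in> V" "a * b \<in> V"
    using locI S_closed(3,4) st by metis+
qed

lemmas V_closed = is_subringD[OF subring_V]

lemma inverse_in_V: "t \<in> S \<Longrightarrow> t \<notin> N \<Longrightarrow> inverse t \<in> V"
  using locI[of 1 t] S_closed(1) by (simp add: inverse_eq_divide)

lemma S_unit: "t \<in> S \<Longrightarrow> t \<notin> N \<Longrightarrow> t \<notin> nonunits V"
  using inverse_in_V zero_in_N by (auto simp: nonunits_def)

lemma N_nonunits: "N \<subseteq> nonunits V"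
proof
  fix n assume n: "n \<in> N"
  have "inverse n \<notin> V" if "n \<noteq> 0"
  proof
    assume "inverse n \<in> V"
    then obtain s t where "inverse n = s / t" "s \<in> S" "t \<in> S" "t \<notin> N" by (auto simp: loc_def)
    moreover from this have "t \<noteq> 0" using zero_in_N by auto
    ultimately have "t = n * s" using that by (simp add: field_simps)
    then show False using \<open>t \<notin> N\<close> \<open>s \<in> S\<close> N_mult n by blast
  qed
  then show "n \<in> nonunits V" using n N_subset S_subset by (auto simp: nonunits_def)
qed

lemma nonunits_Int_S: "s \<in> S \<Longrightarrow> s \<in> nonunits V \<longleftrightarrow> s \<in> N"
  using S_unit N_nonunits by blast

lemma nonunitsE:
  assumes "a \<in> nonunits V"
  obtains s t where "a = s / t" "s \<in> N" "t \<in> S" "t \<notin> N"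
proof -
  obtain s t where st: "a = s / t" "s \<in> S" "t \<in> S" "t \<notin> N" using assms by (auto simp: loc_def nonunits_def)
  have "s \<in> N"
  proof (rule ccontr)
    assume "s \<notin> N"
    then have "inverse a \<in> V" "a \<noteq> 0" using locI[of t s] st zero_in_N by auto
    then show False using assms by (auto simp: nonunits_def)
  qed
  then show ?thesis using that st by blast
qed

lemma local_V: "is_local V"
  unfolding is_local_def
proof (intro conjI subring_V ballI)
  fix a b assume "a \<in> nonunits V" "b \<in> nonunits V"
  then obtain s t s' t' where st: "a = s / t" "b = s' / t'" "s \<in> N" "t \<in> S" "s' \<in> N" "t' \<in> S" "t \<notin> N" "t' \<notin> N"
    by (meson nonunitsE)
  then have nz: "t \<noteq> 0" "t' \<noteq> 0" using zero_in_N by auto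
  have "a + b = (s * t' - s' * (- t)) * inverse (t * t')" using nz by (simp add: st field_simps)
  moreover have "s * t' - s' * (- t) \<in> N" using N_diff N_mult st S_closed(5) by blast
  moreover have "inverse (t * t') \<in> V" using inverse_in_V N_prime S_closed(4) st by blast
  ultimately show "a + b \<in> nonunits V" using nonunits_mult[OF subring_V] N_nonunits by auto
qed

lemma V_subset_fractions: "V \<subseteq> fractions S"
  using zero_in_N unfolding loc_def fractions_def by blast

text \<open>If \<open>t\<close> is outside \<open>N\<close>, then \<open>t * t'\<close> is 1 plus an
  element of \<open>N\<close> for some \<open>t'\<close> in \<open>S\<close>. In \<open>R\<close>
  this is 1 plus a nonunit, so \<open>t\<close> is invertible there and every fraction
  \<open>s / t\<close> belongs to \<open>R\<close>.\<close>

lemma V_least: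
  assumes "is_local R" "S \<subseteq> R" "N \<subseteq> nonunits R"
  shows "V \<subseteq> R"
proof
  note sub = is_localD(1)[OF assms(1)]
  fix f assume "f \<in> V"
  then obtain s t where st: "f = s / t" "s \<in> S" "t \<in> S" "t \<notin> N" by (auto simp: loc_def)
  obtain t' where t': "t' \<in> S" "t * t' - 1 \<in> N" using maximal st by blast
  then have "t * t' - 1 \<in> nonunits R" using assms by auto
  then have "t * t' \<notin> nonunits R"
    using unit_plus_nonunit(2)[OF assms(1) is_subringD(1)[OF sub] one_not_nonunit[OF sub]] by force
  then have "t \<notin> nonunits R" using nonunits_mult[OF sub] t' assms(2) by blast
  then have "inverse t \<in> R" using st assms(2) by (auto simp: nonunits_def)
  then show "f \<in> R" using st is_subringD(4)[OF sub] assms(2) by (auto simp: divide_inverse)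
qed

text \<open>Replacing the denominator \<open>t\<close> by multiplication with its inverse modulo
  \<open>N\<close> changes \<open>s / t\<close> only by a nonunit; thus localizing does not enlarge
  the residue field.\<close>

lemma residue_in_S:
  assumes "a \<in> V"
  shows "\<exists>r\<in>S. a - r \<in> nonunits V"
proof -
  obtain s t where st: "a = s / t" "s \<in> S" "t \<in> S" "t \<notin> N" using assms by (auto simp: loc_def)
  obtain t' where t': "t' \<in> S" "t * t' - 1 \<in> N" using maximal st by blast
  have "t \<noteq> 0" using st zero_in_N by auto
  then have "a - s * t' = (t * t' - 1) * (- a)" by (simp add: st field_simps)
  moreover have "(t * t' - 1) * (- a) \<in> nonunits V"
    using nonunits_mult[OF subring_V] N_nonunits t'(2) V_closed(5)[OF assms] by blast
  ultimately have "a - s * t' \<in> nonunits V" by simp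
  then show ?thesis using S_closed(4)[OF st(2) t'(1)] by blast
qed

lemma card_residue_classes_V:
  assumes "T \<subseteq> S" "\<And>s. s \<in> S \<Longrightarrow> \<exists>t\<in>T. s - t \<in> N"
    "\<And>s t. s \<in> T \<Longrightarrow> t \<in> T \<Longrightarrow> s - t \<in> N \<Longrightarrow> s = t"
  shows "card (residue_classes V) = card T"
proof (rule card_residue_classes[OF local_V])
  show "T \<subseteq> V" using assms S_subset by blast
  show "s = t" if "s \<in> T" "t \<in> T" "s - t \<in> nonunits V" for s t
    using that assms(3)[OF that(1,2)] nonunits_Int_S[OF S_closed(3), of s t] assms(1) by auto
  fix a assume "a \<in> V"
  then obtain s where s: "s \<in> S" "a - s \<in> nonunits V" using residue_in_S by blast
  obtain r where r: "r \<in> T" "s - r \<in> N" using assms(2) s(1) by blast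
  have "(a - s) + (s - r) \<in> nonunits V"
    using is_localD(2)[OF local_V s(2)] r(2) N_nonunits by blast
  then show "\<exists>t\<in>T. a - t \<in> nonunits V" using r(1) by auto
qed

end

section \<open>Localization at a principal prime: discrete valuation rings\<close>

lemma principal_closed:
  assumes "is_subring T"
  shows "0 \<in> (*) c ` T" "\<And>a b. a \<in> (*) c ` T \<Longrightarrow> b \<in> (*) c ` T \<Longrightarrow> a + b \<in> (*) c ` T"
    "\<And>a. a \<in> (*) c ` T \<Longrightarrow> - a \<in> (*) c ` T" "\<And>a b. a \<in> (*) c ` T \<Longrightarrow> b \<in> T \<Longrightarrow> a * b \<in> (*) c ` T"
proof -
  note D = is_subringD[OF assms]
  show "0 \<in> (*) c ` T" using D(2) by (intro image_eqI[of _ _ 0]) auto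
  show "a + b \<in> (*) c ` T" if "a \<in> (*) c ` T" "b \<in> (*) c ` T" for a b
    using that D(6) by (auto simp: image_iff simp flip: distrib_left)
  show "- a \<in> (*) c ` T" if "a \<in> (*) c ` T" for a
    using that D(5) by (auto simp: image_iff simp flip: mult_minus_right)
  show "a * b \<in> (*) c ` T" if "a \<in> (*) c ` T" "b \<in> T" for a b
    using that D(4) by (auto simp: image_iff mult.assoc)
qed

text \<open>The condition \<open>factor\<close> stands in for Noetherianity: it provides the
  valuation directly. \<open>S\<close> itself need be neither local nor a principal ideal
  domain.\<close>

locale principal_prime =
  fixes S :: "'k::field set" and \<pi> :: 'k
  assumes subring_S: "is_subring S" and pi_in: "\<pi> \<in> S" and pi_nz: "\<pi> \<noteq> 0"
    and one_notin: "1 \<notin> (*) \<pi> ` S"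
    and maximal: "\<And>s. s \<in> S \<Longrightarrow> s \<notin> (*) \<pi> ` S \<Longrightarrow> \<exists>t\<in>S. s * t - 1 \<in> (*) \<pi> ` S"
    and factor: "\<And>s. s \<in> S \<Longrightarrow> s \<noteq> 0 \<Longrightarrow> \<exists>n. \<exists>u\<in>S. s = \<pi> ^ n * u \<and> u \<notin> (*) \<pi> ` S"

sublocale principal_prime \<subseteq> maximal_ideal_set S "(*) \<pi> ` S"
proof
  show "(*) \<pi> ` S \<subseteq> S" using pi_in is_subringD(4)[OF subring_S] by auto
  show "0 \<in> (*) \<pi> ` S" by (rule principal_closed(1)[OF subring_S])
  show "a - b \<in> (*) \<pi> ` S" if "a \<in> (*) \<pi> ` S" "b \<in> (*) \<pi> ` S" for a b
    using principal_closed(2)[OF subring_S that(1) principal_closed(3)[OF subring_S that(2)]] by simp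
  show "a * b \<in> (*) \<pi> ` S" if "a \<in> (*) \<pi> ` S" "b \<in> S" for a b
    by (rule principal_closed(4)[OF subring_S that])
qed (use subring_S one_notin maximal in auto)

context principal_prime
begin

abbreviation I where "I \<equiv> (*) \<pi> ` S"

lemma inverse_pi_notin: "inverse \<pi> \<notin> V"
proof -
  have "\<pi> \<in> nonunits V" using N_nonunits S_closed(1) by force
  then show ?thesis using pi_nz by (auto simp: nonunits_def)
qed

lemma nonunits_V: "nonunits V = (*) \<pi> ` V"
proof
  have "\<pi> \<in> nonunits V" using pi_in S_subset inverse_pi_notin by (auto simp: nonunits_def)
  then show "(*) \<pi> ` V \<subseteq> nonunits V" using nonunits_mult[OF subring_V] by auto
  show "nonunits V \<subseteq> (*) \<pi> ` V"
  proof
    fix a assume "a \<in> nonunits V"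
    then obtain s t where st: "a = s / t" "s \<in> I" "t \<in> S" "t \<notin> I" by (rule nonunitsE)
    then obtain s' where "s = \<pi> * s'" "s' \<in> S" by blast
    then show "a \<in> (*) \<pi> ` V" using locI[of s' t] st by (intro image_eqI[of _ _ "s' / t"]) auto
  qed
qed

text \<open>The two alternatives are valuation \<open>n\<close> and valuation \<open>-n\<close>;
  this avoids integer exponents.\<close>

lemma fractions_power:
  assumes "f \<in> fractions S" "f \<noteq> 0"
  shows "\<exists>n u. u \<in> V \<and> inverse u \<in> V \<and> (f = \<pi> ^ n * u \<or> \<pi> ^ n * f = u)"
proof -
  obtain s t where st: "f = s / t" "s \<in> S" "t \<in> S" "t \<noteq> 0" "s \<noteq> 0"
    using assms by (auto simp: fractions_def)
  obtain m u where u: "s = \<pi> ^ m * u" "u \<in> S" "u \<notin> I" using factor st by blast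
  obtain n v where v: "t = \<pi> ^ n * v" "v \<in> S" "v \<notin> I" using factor st by blast
  have nz: "u \<noteq> 0" "v \<noteq> 0" using u v zero_in_N by auto
  have "u / v \<in> V" "inverse (u / v) \<in> V" using locI[of u v] locI[of v u] u v by auto
  moreover have "f = \<pi> ^ (m - n) * (u / v)" if "n \<le> m"
    using that pi_nz nz by (simp add: st(1) u(1) v(1) power_diff)
  moreover have "\<pi> ^ (n - m) * f = u / v" if "m \<le> n"
    using that pi_nz nz by (simp add: st(1) u(1) v(1) power_diff)
  ultimately show ?thesis by (meson nle_le)
qed

lemma fractions_subset_of_inverse:
  assumes "is_subring R" "V \<subseteq> R" "inverse \<pi> \<in> R"
  shows "fractions S \<subseteq> R"
proof
  fix f assume f: "f \<in> fractions S"
  show "f \<in> R"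
  proof (cases "f = 0")
    case False
    then obtain n u where u: "u \<in> V" "f = \<pi> ^ n * u \<or> \<pi> ^ n * f = u"
      using fractions_power f by blast
    have "f = \<pi> ^ n * u \<or> f = inverse \<pi> ^ n * u" using u(2) pi_nz by (auto simp: field_simps)
    moreover have "\<pi> \<in> R" "u \<in> R" using u pi_in S_subset assms(2) by auto
    ultimately show ?thesis using is_subringD(4,7)[OF assms(1)] assms(3) by auto
  qed (use is_subringD(2) assms in auto)
qed

text \<open>A discrete valuation ring is a maximal proper subring of its fraction field: any element
  of negative valuation produces \<open>inverse \<pi>\<close>, and with it all fractions.\<close>

lemma V_maximal:
  assumes "is_subring R" "V \<subseteq> R" "R \<subseteq> fractions S"
  shows "R = V \<or> R = fractions S"
proof (rule disjCI)
  assume "R \<noteq> fractions S"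
  then have inv: "inverse \<pi> \<notin> R" using fractions_subset_of_inverse assms by blast
  have "f \<in> V" if f: "f \<in> R" for f
  proof (cases "f = 0")
    case False
    then obtain n u where u: "u \<in> V" "inverse u \<in> V" "f = \<pi> ^ n * u \<or> \<pi> ^ n * f = u"
      using fractions_power f assms(3) by blast
    show ?thesis
    proof (cases n)
      case 0
      then show ?thesis using u by auto
    next
      case (Suc k)
      \<comment> \<open>An element of valuation \<open>-(k + 1)\<close> times
        \<open>\<pi> ^ k\<close> is \<open>inverse \<pi>\<close> up to a unit of
        \<open>V\<close>.\<close>
      have "inverse \<pi> = \<pi> ^ k * f * inverse u" if "\<pi> ^ n * f = u"
        using that pi_nz False Suc by (auto simp: field_simps)
      then have "\<pi> ^ n * f \<noteq> u"
        using inv u(2) f is_subringD(4,7)[OF assms(1)] pi_in S_subset assms(2) by (metis subsetD)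
      then show ?thesis using u V_closed(4,7) pi_in S_subset by auto
    qed
  qed (use V_closed in auto)
  then show "R = V" using assms by blast
qed

lemma V_neq_fractions: "V \<noteq> fractions S"
proof -
  have "1 / \<pi> \<in> fractions S" using pi_in pi_nz S_closed(1) unfolding fractions_def by blast
  then show ?thesis using inverse_pi_notin by (metis inverse_eq_divide)
qed

end

section \<open>Curves with a function field inside a type-level field\<close>

text \<open>The map \<open>h\<close> carries the record-based function field into a type that is a
  field, so that local rings can be treated as plain sets there. It will be \<open>id\<close> for
  the projective line and \<open>embed W\<close> for the Weierstrass curve.\<close>

locale curve_model = C?: field C for C :: "('f, 'm) curve_scheme" (structure) +
  fixes h :: "'f \<Rightarrow> 'k::field"
  assumes inj_h: "inj_on h (carrier C)"
    and h_mult: "\<And>a b. a \<in> carrier C \<Longrightarrow> b \<in> carrier C \<Longrightarrow> h (a \<otimes> b) = h a * h b"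
    and h_add: "\<And>a b. a \<in> carrier C \<Longrightarrow> b \<in> carrier C \<Longrightarrow> h (a \<oplus> b) = h a + h b"
    and h_one: "h \<one> = 1"
    and scalars_subfield: "subfield (scalars C) C"
    and coords_in: "coords C \<subseteq> carrier C"
begin

lemma h_zero: "h \<zero> = 0"
proof -
  have "h \<zero> + h \<zero> = h \<zero> + 0" using h_add[of \<zero> \<zero>] by simp
  then show ?thesis by (rule add_left_imp_eq)
qed

lemma h_eq_iff: "a \<in> carrier C \<Longrightarrow> b \<in> carrier C \<Longrightarrow> h a = h b \<longleftrightarrow> a = b"
  using inj_h by (auto simp: inj_on_def)

lemma h_uminus: "a \<in> carrier C \<Longrightarrow> h (\<ominus> a) = - h a"
  using h_add[of a "\<ominus> a"] h_zero by (simp add: C.r_neg eq_neg_iff_add_eq_0 add.commute)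

lemma h_minus: "a \<in> carrier C \<Longrightarrow> b \<in> carrier C \<Longrightarrow> h (a \<ominus> b) = h a - h b"
  by (simp add: a_minus_def h_add h_uminus)

lemma inv_closed: "a \<in> carrier C \<Longrightarrow> a \<noteq> \<zero> \<Longrightarrow> inv a \<in> carrier C"
  by (simp add: C.field_Units)

lemma h_inv: "a \<in> carrier C \<Longrightarrow> a \<noteq> \<zero> \<Longrightarrow> h (inv a) = inverse (h a)"
  using h_mult[of a "inv a"] h_one by (simp add: C.field_Units inverse_unique)

abbreviation L where "L \<equiv> h ` carrier C"

lemma h_mem_iff: "a \<in> carrier C \<Longrightarrow> R \<subseteq> carrier C \<Longrightarrow> h a \<in> h ` R \<longleftrightarrow> a \<in> R"
  by (meson inj_h inj_on_image_mem_iff)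

lemma subring_iff_is_subring:
  assumes "R \<subseteq> carrier C"
  shows "subring R C \<longleftrightarrow> is_subring (h ` R)"
proof
  assume R: "subring R C"
  show "is_subring (h ` R)"
  proof (rule is_subringI)
    show "1 \<in> h ` R" using subringE(3)[OF R] h_one by force
    fix a b assume "a \<in> h ` R" "b \<in> h ` R"
    then obtain x y where xy: "a = h x" "b = h y" "x \<in> R" "y \<in> R" by blast
    have "a - b = h (x \<ominus> y)" "a * b = h (x \<otimes> y)"
      using xy assms by (auto simp: h_minus h_mult subset_eq)
    then show "a - b \<in> h ` R" "a * b \<in> h ` R"
      using xy subringE(5-7)[OF R] by (auto simp: a_minus_def)
  qed
next
  assume R: "is_subring (h ` R)"
  note D = is_subringD[OF R]
  show "subring R C"
  proof (rule C.subringI[OF assms])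
    show "\<one> \<in> R" using D(1) h_one h_mem_iff[OF C.one_closed assms] by simp
    show "\<ominus> a \<in> R" if "a \<in> R" for a
      using D(5)[of "h a"] that assms h_mem_iff[of "\<ominus> a", OF _ assms] by (auto simp: h_uminus subset_eq)
    show "a \<otimes> b \<in> R" if "a \<in> R" "b \<in> R" for a b
      using D(4)[of "h a" "h b"] that assms h_mem_iff[of "a \<otimes> b", OF _ assms]
      by (auto simp: h_mult subset_eq)
    show "a \<oplus> b \<in> R" if "a \<in> R" "b \<in> R" for a b
      using D(6)[of "h a" "h b"] that assms h_mem_iff[of "a \<oplus> b", OF _ assms]
      by (auto simp: h_add subset_eq)
  qed
qed

lemma max_ideal_iff:
  assumes "R \<subseteq> carrier C" "a \<in> R"
  shows "a \<in> max_ideal C R \<longleftrightarrow> h a \<in> nonunits (h ` R)"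
proof -
  have a: "a \<in> carrier C" using assms by auto
  have "a \<in> Units (local_ring C R) \<longleftrightarrow> (\<exists>b\<in>R. a \<otimes> b = \<one>)"
    using assms C.m_comm by (auto simp: Units_def local_ring_def subset_eq)
  also have "\<dots> \<longleftrightarrow> (\<exists>b\<in>R. h a * h b = 1)"
    using assms a h_one h_mult C.m_closed C.one_closed h_eq_iff by (metis subsetD)
  also have "\<dots> \<longleftrightarrow> h a \<noteq> 0 \<and> inverse (h a) \<in> h ` R"
  proof
    assume "\<exists>b\<in>R. h a * h b = 1"
    then obtain b where "b \<in> R" "h a * h b = 1" by blast
    then show "h a \<noteq> 0 \<and> inverse (h a) \<in> h ` R" using inverse_unique[of "h a" "h b"] by auto
  next
    assume "h a \<noteq> 0 \<and> inverse (h a) \<in> h ` R"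
    then show "\<exists>b\<in>R. h a * h b = 1" by (metis imageE right_inverse)
  qed
  finally show ?thesis using assms by (auto simp: max_ideal_def nonunits_def)
qed

lemma max_ideal_subset: "max_ideal C R \<subseteq> R"
  by (auto simp: max_ideal_def)

lemma h_max_ideal: "R \<subseteq> carrier C \<Longrightarrow> h ` max_ideal C R = nonunits (h ` R)"
  using max_ideal_iff[of R] max_ideal_subset[of R] nonunits_subset[of "h ` R"] by blast

lemma scalars_in: "scalars C \<subseteq> carrier C"
  using scalars_subfield subfieldE(3) by blast

lemma chart_gens_in: "c \<in> coords C \<Longrightarrow> c \<noteq> \<zero> \<Longrightarrow> scalars C \<union> {d \<otimes> inv c | d. d \<in> coords C} \<subseteq> carrier C"
  using scalars_in coords_in inv_closed by auto

lemma chart_subring: "c \<in> coords C \<Longrightarrow> c \<noteq> \<zero> \<Longrightarrow> subring (chart_ring C c) C"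
  unfolding chart_ring_def by (rule C.generate_ring_is_subring[OF chart_gens_in])

text \<open>A chart ring is generated by constants and coordinate quotients, so once
  \<open>R\<close> contains the constants only the quotients remain to be tested. This is how it is
  decided which charts contain a point.\<close>

lemma chart_subset_iff:
  assumes "c \<in> coords C" "c \<noteq> \<zero>" "is_subring R" "R \<subseteq> L" "h ` scalars C \<subseteq> R"
  shows "h ` chart_ring C c \<subseteq> R \<longleftrightarrow> (\<forall>d\<in>coords C. h d / h c \<in> R)"
proof -
  obtain R' where R': "R' \<subseteq> carrier C" "R = h ` R'" using assms(4) by (meson subset_imageE)
  have "h ` chart_ring C c \<subseteq> R \<longleftrightarrow> chart_ring C c \<subseteq> R'"
    unfolding R'(2) using h_mem_iff[OF _ R'(1)] subringE(1)[OF chart_subring[OF assms(1,2)]] by blast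
  also have "\<dots> \<longleftrightarrow> scalars C \<union> {d \<otimes> inv c | d. d \<in> coords C} \<subseteq> R'"
  proof
    show "chart_ring C c \<subseteq> R' \<Longrightarrow> scalars C \<union> {d \<otimes> inv c | d. d \<in> coords C} \<subseteq> R'"
      unfolding chart_ring_def by (meson generate_ring.incl subset_iff)
    have "subring R' C" using subring_iff_is_subring[OF R'(1)] assms(3) R'(2) by simp
    then show "scalars C \<union> {d \<otimes> inv c | d. d \<in> coords C} \<subseteq> R' \<Longrightarrow> chart_ring C c \<subseteq> R'"
      unfolding chart_ring_def by (rule C.generate_ring_min_subring1[OF chart_gens_in[OF assms(1,2)]])
  qed
  also have "\<dots> \<longleftrightarrow> h ` scalars C \<subseteq> R \<and> (\<forall>d\<in>coords C. h (d \<otimes> inv c) \<in> R)"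
  proof -
    have "h x \<in> R \<longleftrightarrow> x \<in> R'" if "x \<in> carrier C" for x
      using h_mem_iff[OF that R'(1)] R'(2) by simp
    then have "(\<forall>x\<in>G. h x \<in> R) \<longleftrightarrow> G \<subseteq> R'" if "G \<subseteq> carrier C" for G
      using that by blast
    from this[OF chart_gens_in[OF assms(1,2)]] show ?thesis by blast
  qed
  also have "\<dots> \<longleftrightarrow> (\<forall>d\<in>coords C. h d / h c \<in> R)"
    using assms coords_in inv_closed by (auto simp: h_mult h_inv divide_inverse subset_eq)
  finally show ?thesis .
qed

lemma subring_cring: "subring A C \<Longrightarrow> cring (C\<lparr>carrier := A\<rparr>)"
  using C.subcring_iff[OF subringE(1)] C.subcringI' by blast

lemma subring_uminus:
  assumes "subring A C" "b \<in> A"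
  shows "\<ominus>\<^bsub>C\<lparr>carrier := A\<rparr>\<^esub> b = \<ominus> b"
proof -
  interpret A: cring "C\<lparr>carrier := A\<rparr>" by (rule subring_cring[OF assms(1)])
  have "\<ominus>\<^bsub>C\<lparr>carrier := A\<rparr>\<^esub> b \<oplus> b = \<zero>" "\<ominus>\<^bsub>C\<lparr>carrier := A\<rparr>\<^esub> b \<in> A"
    using A.l_neg[of b] A.a_inv_closed[of b] assms by auto
  then show ?thesis using C.minus_equality assms subringE(1)[OF assms(1)] by (metis subsetD)
qed

lemma maximal_ideal_set_image:
  assumes "subring A C" "maximalideal M (C\<lparr>carrier := A\<rparr>)"
  shows "maximal_ideal_set (h ` A) (h ` M)"
proof -
  have Ac: "A \<subseteq> carrier C" using subringE(1)[OF assms(1)] .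
  interpret A: cring "C\<lparr>carrier := A\<rparr>" by (rule subring_cring[OF assms(1)])
  interpret M: maximalideal M "C\<lparr>carrier := A\<rparr>" by fact
  have M: "M \<subseteq> A" using M.Icarr by auto
  have MC: "M \<subseteq> carrier C" using M Ac by auto
  have sub: "is_subring (h ` A)" using subring_iff_is_subring[OF Ac] assms(1) by simp
  note uminus = subring_uminus[OF assms(1)]
  show ?thesis
  proof
    show "is_subring (h ` A)" by fact
    show "h ` M \<subseteq> h ` A" using M by auto
    show "1 \<notin> h ` M"
    proof
      assume "1 \<in> h ` M"
      then have "\<one> \<in> M" using h_mem_iff[OF C.one_closed MC] h_one by simp
      then show False using M.one_imp_carrier M.I_notcarr by simp
    qed
    show "0 \<in> h ` M" using M.zero_closed h_zero by force
    show "a - b \<in> h ` M" if ab: "a \<in> h ` M" "b \<in> h ` M" for a b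
    proof -
      obtain x y where xy: "x \<in> M" "y \<in> M" "a = h x" "b = h y" using ab by blast
      have "a - b = h (x \<oplus> \<ominus> y)" using xy MC by (auto simp: h_add h_uminus subset_eq)
      moreover have "x \<oplus> \<ominus> y \<in> M"
        using M.a_closed[OF xy(1) M.a_inv_closed[OF xy(2)]] uminus[OF subsetD[OF M xy(2)]] by simp
      ultimately show ?thesis by blast
    qed
    show "a * b \<in> h ` M" if ab: "a \<in> h ` M" "b \<in> h ` A" for a b
    proof -
      obtain x y where xy: "x \<in> M" "y \<in> A" "a = h x" "b = h y" using ab by blast
      have "a * b = h (x \<otimes> y)" using xy MC Ac by (auto simp: h_mult subset_eq)
      moreover have "x \<otimes> y \<in> M" using M.I_r_closed[OF xy(1)] xy by auto
      ultimately show ?thesis by blast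
    qed
    show "\<exists>t\<in>h ` A. s * t - 1 \<in> h ` M" if s: "s \<in> h ` A" "s \<notin> h ` M" for s
    proof -
      obtain x where x: "x \<in> A" "s = h x" "x \<notin> M" using s by blast
      let ?A = "C\<lparr>carrier := A\<rparr>"
      \<comment> \<open>The ideal \<open>M + (x)\<close> is strictly larger than \<open>M\<close>,
        hence everything; writing 1 as \<open>m + a x\<close> exhibits \<open>a\<close> as the
        inverse of \<open>x\<close> modulo \<open>M\<close>.\<close>
      let ?J = "M <+>\<^bsub>?A\<^esub> PIdl\<^bsub>?A\<^esub> x"
      have J: "ideal ?J ?A"
        by (rule A.add_ideals[OF M.ideal_axioms A.cgenideal_ideal]) (use x in auto)
      have "M \<subseteq> ?J"
      proof
        fix m assume m: "m \<in> M"
        have "\<zero> \<in> PIdl\<^bsub>?A\<^esub> x"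
          using additive_subgroup.zero_closed[OF ideal.axioms(1)[OF A.cgenideal_ideal[of x]]] x by simp
        then have "m \<oplus> \<zero> \<in> ?J" using m unfolding set_add_def' by auto
        then show "m \<in> ?J" using m MC by auto
      qed
      moreover have "?J \<subseteq> carrier ?A" using ideal.Icarr[OF J] by auto
      moreover have "x \<in> ?J"
      proof -
        have "x \<in> PIdl\<^bsub>?A\<^esub> x" using A.cgenideal_self[of x] x by simp
        then have "\<zero> \<oplus> x \<in> ?J" using M.zero_closed unfolding set_add_def' by auto
        then show ?thesis using x Ac by auto
      qed
      ultimately have "?J = carrier ?A" using M.I_maximal[OF J] x by auto
      then have "\<one> \<in> ?J" using A.one_closed by simp
      then obtain m a where ma: "m \<in> M" "a \<in> A" "\<one> = m \<oplus> (a \<otimes> x)"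
        unfolding set_add_def' cgenideal_def by auto
      have one: "1 = h m + h a * h x"
        using ma x Ac MC h_one by (auto simp: h_add h_mult subset_eq)
      have "s * h a - 1 = - h m"
        unfolding one x(2) by (simp add: algebra_simps)
      also have "\<dots> = h (\<ominus> m)" using h_uminus ma(1) MC by auto
      finally have "s * h a - 1 = h (\<ominus> m)" .
      moreover have "\<ominus> m \<in> M" using M.a_inv_closed[OF ma(1)] uminus[OF subsetD[OF M ma(1)]] by simp
      ultimately show ?thesis using ma by blast
    qed
  qed
qed

lemma h_localization:
  assumes "A \<subseteq> carrier C" "M \<subseteq> A" "\<zero> \<in> M"
  shows "h ` localization C A M = loc (h ` A) (h ` M)" "localization C A M \<subseteq> carrier C"
proof -
  have e: "h (a \<otimes> inv b) = h a / h b" if "a \<in> A" "b \<in> A" "b \<notin> M" for a b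
  proof -
    have "a \<in> carrier C" "b \<in> carrier C" "b \<noteq> \<zero>" using that assms by auto
    then show ?thesis using inv_closed[of b] by (simp add: h_mult h_inv divide_inverse)
  qed
  have m: "h b \<in> h ` M \<longleftrightarrow> b \<in> M" if "b \<in> A" for b
    using h_mem_iff[of b M] that assms by auto
  show "h ` localization C A M = loc (h ` A) (h ` M)"
  proof
    show "h ` localization C A M \<subseteq> loc (h ` A) (h ` M)"
      unfolding localization_def loc_def using e m by fastforce
    show "loc (h ` A) (h ` M) \<subseteq> h ` localization C A M"
    proof
      fix f assume "f \<in> loc (h ` A) (h ` M)"
      then obtain a b where ab: "a \<in> A" "b \<in> A" "f = h a / h b" "h b \<notin> h ` M" by (auto simp: loc_def)
      then have "f = h (a \<otimes> inv b)" "a \<otimes> inv b \<in> localization C A M"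
        using e m unfolding localization_def by auto
      then show "f \<in> h ` localization C A M" by blast
    qed
  qed
  show "localization C A M \<subseteq> carrier C"
  proof
    fix f assume "f \<in> localization C A M"
    then obtain a b where ab: "a \<in> A" "b \<in> A" "f = a \<otimes> inv b" "b \<notin> M" unfolding localization_def by blast
    then have "a \<in> carrier C" "inv b \<in> carrier C" using assms by (auto intro!: inv_closed)
    then show "f \<in> carrier C" unfolding ab(3) by (rule C.m_closed)
  qed
qed

lemma L_field: "f \<in> L \<Longrightarrow> inverse f \<in> L"
  using h_inv h_zero inv_closed by (cases "f = 0") (auto simp: image_iff, metis h_zero)

lemma h_scalars_local: "h ` scalars C \<subseteq> R \<Longrightarrow> is_subring R \<Longrightarrow> s \<in> h ` scalars C \<Longrightarrow> s \<noteq> 0 \<Longrightarrow> s \<notin> nonunits R"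
proof -
  assume a: "h ` scalars C \<subseteq> R" "s \<in> h ` scalars C" "s \<noteq> 0"
  then obtain x where x: "x \<in> scalars C" "s = h x" "x \<noteq> \<zero>" using h_zero by blast
  have "inv x \<in> scalars C" using x C.subfield_m_inv(1)[OF scalars_subfield, of x] by simp
  have "inverse s = h (inv x)" using h_inv[OF subsetD[OF scalars_in x(1)] x(3)] x(2) by simp
  then have "inverse s \<in> R" using \<open>inv x \<in> scalars C\<close> a by blast
  then show ?thesis using a by (auto simp: nonunits_def)
qed

text \<open>Used with two kinds of \<open>N\<close>: the nonunits of a local ring, and the multiples
  of a power of a uniformizer.\<close>

lemma ideal_vimage:
  assumes A: "subring A C"
    and N: "0 \<in> N" "\<And>a b. a \<in> N \<Longrightarrow> b \<in> N \<Longrightarrow> a + b \<in> N" "\<And>a. a \<in> N \<Longrightarrow> - a \<in> N"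
      "\<And>a b. a \<in> N \<Longrightarrow> b \<in> h ` A \<Longrightarrow> a * b \<in> N"
  shows "ideal {a \<in> A. h a \<in> N} (C\<lparr>carrier := A\<rparr>)"
proof -
  interpret A: cring "C\<lparr>carrier := A\<rparr>" by (rule subring_cring[OF A])
  have AC: "A \<subseteq> carrier C" using subringE(1)[OF A] .
  let ?M = "{a \<in> A. h a \<in> N}"
  show ?thesis
  proof (rule idealI[OF A.ring_axioms])
    show "subgroup ?M (add_monoid (C\<lparr>carrier := A\<rparr>))"
    proof (rule A.add.subgroupI)
      show "?M \<subseteq> carrier (C\<lparr>carrier := A\<rparr>)" by auto
      show "?M \<noteq> {}" using subringE(2)[OF A] h_zero N(1) by auto
      fix a assume a: "a \<in> ?M"
      then have "\<ominus> a \<in> ?M" using N(3) h_uminus[of a] subringE(5)[OF A] AC by auto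
      then show "\<ominus>\<^bsub>C\<lparr>carrier := A\<rparr>\<^esub> a \<in> ?M" using subring_uminus[OF A, of a] a by auto
      fix b assume b: "b \<in> ?M"
      have "h (a \<oplus> b) = h a + h b" using a b AC by (intro h_add) auto
      then have "a \<oplus> b \<in> ?M" using N(2) subringE(7)[OF A] a b by auto
      then show "a \<oplus>\<^bsub>C\<lparr>carrier := A\<rparr>\<^esub> b \<in> ?M" by simp
    qed
    fix a x assume a: "a \<in> ?M" and x: "x \<in> carrier (C\<lparr>carrier := A\<rparr>)"
    have "a \<in> carrier C" "x \<in> carrier C" using a x AC by auto
    then have "a \<otimes> x \<in> ?M" using N(4) h_mult[of a x] subringE(6)[OF A] a x by auto
    moreover have "x \<otimes> a = a \<otimes> x" using \<open>a \<in> carrier C\<close> \<open>x \<in> carrier C\<close> by (rule C.m_comm[rotated])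
    ultimately show "x \<otimes>\<^bsub>C\<lparr>carrier := A\<rparr>\<^esub> a \<in> ?M" "a \<otimes>\<^bsub>C\<lparr>carrier := A\<rparr>\<^esub> x \<in> ?M" by simp_all
  qed
qed

lemma maximalideal_vimage_nonunits:
  assumes A: "subring A C" and W: "is_local W" and AW: "h ` A \<subseteq> W"
    and inv: "\<And>a. a \<in> A \<Longrightarrow> h a \<notin> nonunits W \<Longrightarrow> \<exists>b\<in>A. h a * h b - 1 \<in> nonunits W"
  shows "maximalideal {a \<in> A. h a \<in> nonunits W} (C\<lparr>carrier := A\<rparr>)" (is "maximalideal ?M ?A")
proof (rule maximalidealI)
  have AC: "A \<subseteq> carrier C" using subringE(1)[OF A] .
  note Ws = is_localD(1)[OF W]
  show "ideal ?M ?A"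
    by (rule ideal_vimage[OF A])
      (use zero_nonunit[OF Ws] is_localD(2)[OF W] nonunits_uminus[OF Ws] nonunits_mult[OF Ws] AW in auto)
  have one: "\<one> \<in> A" "\<one> \<notin> ?M"
    using subringE(3)[OF A] one_not_nonunit[OF Ws] h_one by auto
  then show "carrier ?A \<noteq> ?M" by auto
  fix J assume J: "ideal J ?A" "?M \<subseteq> J" "J \<subseteq> carrier ?A"
  interpret J: ideal J ?A by fact
  show "J = ?M \<or> J = carrier ?A"
  proof (rule disjCI)
    assume "J \<noteq> carrier ?A"
    then have nJ: "\<one> \<notin> J" using J.one_imp_carrier by auto
    have "a \<in> ?M" if a: "a \<in> J" for a
    proof (rule ccontr)
      assume "a \<notin> ?M"
      have aA: "a \<in> A" "a \<in> carrier C" using a J(3) AC by auto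
      then obtain t where t: "t \<in> A" "h a * h t - 1 \<in> nonunits W" using inv \<open>a \<notin> ?M\<close> by blast
      \<comment> \<open>Both \<open>b\<close> and \<open>b - 1\<close> lie in \<open>J\<close>,
        hence so does 1.\<close>
      define b where "b = a \<otimes> t"
      have b: "b \<in> J" using J.I_r_closed[OF a, of t] t by (simp add: b_def)
      have hb: "h b = h a * h t" using h_mult[of a t] aA t AC by (auto simp: b_def)
      have bA: "b \<in> A" "b \<in> carrier C" using b J(3) AC by auto
      have m: "b \<oplus> \<ominus> \<one> \<in> ?M"
      proof -
        have "h (b \<oplus> \<ominus> \<one>) = h a * h t - 1" using h_add h_uminus h_one bA hb by simp
        then show ?thesis using t(2) subringE(5,7)[OF A] one bA by auto
      qed
      then have "b \<oplus> \<ominus> \<one> \<in> J" using J(2) by blast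
      from additive_subgroup.a_inv_closed[OF ideal.axioms(1)[OF J(1)] this] have "\<ominus> (b \<oplus> \<ominus> \<one>) \<in> J"
        using subring_uminus[OF A, of "b \<oplus> \<ominus> \<one>"] m by simp
      from additive_subgroup.a_closed[OF ideal.axioms(1)[OF J(1)] b(1) this] have "b \<oplus> \<ominus> (b \<oplus> \<ominus> \<one>) \<in> J" by simp
      moreover have "b \<oplus> \<ominus> (b \<oplus> \<ominus> \<one>) = \<one>"
      proof -
        have "h (b \<oplus> \<ominus> (b \<oplus> \<ominus> \<one>)) = h \<one>" using h_add h_uminus bA by simp
        then show ?thesis using h_eq_iff[of "b \<oplus> \<ominus> (b \<oplus> \<ominus> \<one>)" \<one>] bA by simp
      qed
      ultimately show False using nJ by simp
    qed
    then show "J = ?M" using J(2) by blast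
  qed
qed

text \<open>\<open>VV\<close> is a candidate for the set of local rings; its members dominate every local ring of
  a chart, and maximality of its members turns domination into equality.\<close>

lemma closed_points_eq:
  assumes VV: "\<And>V. V \<in> VV \<Longrightarrow> is_local V \<and> V \<subseteq> L \<and> V \<noteq> L \<and> h ` scalars C \<subseteq> V \<and> finite (residue_classes V)"
    and VV_maximal: "\<And>V R. V \<in> VV \<Longrightarrow> is_subring R \<Longrightarrow> V \<subseteq> R \<Longrightarrow> R \<subseteq> L \<Longrightarrow> R = V \<or> R = L"
    and chart_of: "\<And>V. V \<in> VV \<Longrightarrow> \<exists>c\<in>coords C. c \<noteq> \<zero> \<and> (\<forall>d\<in>coords C. h d / h c \<in> V)"
    and in_chart: "\<And>c. c \<in> coords C \<Longrightarrow> c \<noteq> \<zero> \<Longrightarrow> \<exists>V\<in>VV. \<forall>d\<in>coords C. h d / h c \<in> V"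
    and dominated: "\<And>R c. is_local R \<Longrightarrow> R \<subseteq> L \<Longrightarrow> R \<noteq> L \<Longrightarrow> h ` scalars C \<subseteq> R \<Longrightarrow> c \<in> coords C \<Longrightarrow> c \<noteq> \<zero>
      \<Longrightarrow> \<forall>d\<in>coords C. h d / h c \<in> R \<Longrightarrow> \<exists>V\<in>VV. V \<subseteq> R"
  shows "image h ` closed_points C = VV"
    and "\<And>R. R \<in> closed_points C \<Longrightarrow> R \<subseteq> carrier C"
proof -
  have point: "h ` localization C (chart_ring C c) M \<in> VV \<and> localization C (chart_ring C c) M \<subseteq> carrier C"
    if c: "c \<in> coords C" "c \<noteq> \<zero>" and M: "maximalideal M (C\<lparr>carrier := chart_ring C c\<rparr>)" for c M
  proof -
    let ?A = "chart_ring C c"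
    have A: "subring ?A C" by (rule chart_subring[OF c])
    interpret maximal_ideal_set "h ` ?A" "h ` M" by (rule maximal_ideal_set_image[OF A M])
    interpret M: maximalideal M "C\<lparr>carrier := ?A\<rparr>" by fact
    have MA: "M \<subseteq> ?A" using M.Icarr by auto
    have "\<zero> \<in> M" using additive_subgroup.zero_closed[OF ideal.axioms(1)[OF M.is_ideal]] by simp
    note R = h_localization[OF subringE(1)[OF A] MA this]
    define R' where "R' = localization C ?A M"
    have R': "h ` R' = V" "R' \<subseteq> carrier C" using R by (auto simp: R'_def)
    have sc: "h ` scalars C \<subseteq> V"
    proof -
      have "scalars C \<subseteq> ?A" unfolding chart_ring_def by (auto intro: generate_ring.incl)
      then show ?thesis using S_subset by blast
    qed
    have VL: "V \<subseteq> L" using R' by blast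
    \<comment> \<open>If the localization were the whole field, the chart ring would already be a
      field and equal to \<open>L\<close>. But \<open>in_chart\<close> places the chart ring inside
      a proper subring \<open>W\<close>.\<close>
    have "V \<noteq> L"
    proof
      assume VL: "V = L"
      have A_field: "inverse s \<in> h ` ?A" if s: "s \<in> h ` ?A" "s \<noteq> 0" for s
      proof -
        have L: "x \<notin> nonunits V" if "x \<in> V" "x \<noteq> 0" for x
          using that L_field[of x] unfolding VL nonunits_def by auto
        then have "s \<notin> h ` M" using N_nonunits s S_subset by blast
        then obtain t where t: "t \<in> h ` ?A" "s * t - 1 \<in> h ` M" using maximal s by blast
        then have "s * t - 1 = 0" using L[of "s * t - 1"] N_nonunits N_subset S_subset by blast
        then have "inverse s = t" using inverse_unique[of s t] by simp
        then show ?thesis using t by simp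
      qed
      have "V \<subseteq> h ` ?A"
      proof
        fix f assume "f \<in> V"
        then obtain s t where st: "s \<in> h ` ?A" "t \<in> h ` ?A" "t \<notin> h ` M" "f = s / t" by (auto simp: loc_def)
        then have "t \<noteq> 0" using zero_in_N by auto
        then show "f \<in> h ` ?A" using st A_field S_closed(4) by (auto simp: divide_inverse)
      qed
      then have LA: "L \<subseteq> h ` ?A" using VL by simp
      obtain W where W: "W \<in> VV" "\<forall>d\<in>coords C. h d / h c \<in> W" using in_chart c by blast
      have "h ` ?A \<subseteq> W" using chart_subset_iff[OF c, of W] VV[OF W(1)] W(2) is_localD(1) by auto
      then have "L \<subseteq> W" using LA by (rule subset_trans[rotated])
      then show False using VV[OF W(1)] by (metis subset_antisym)
    qed
    moreover have "\<forall>d\<in>coords C. h d / h c \<in> V"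
      using chart_subset_iff[OF c subring_V VL sc] S_subset by blast
    ultimately obtain W where W: "W \<in> VV" "W \<subseteq> V"
      using dominated[OF local_V VL _ sc c] by blast
    then have "V = W" using VV_maximal[OF W(1) subring_V W(2) VL] \<open>V \<noteq> L\<close> by auto
    then show ?thesis using W R' unfolding R'_def by auto
  qed
  have converse: "W \<in> image h ` closed_points C" if W: "W \<in> VV" for W
  proof -
    obtain c where c: "c \<in> coords C" "c \<noteq> \<zero>" "\<forall>d\<in>coords C. h d / h c \<in> W" using chart_of W by blast
    note W' = VV[OF W]
    have Wl: "is_local W" and Ws: "is_subring W" using W' is_localD(1) by auto
    note D = is_subringD[OF Ws]
    let ?A = "chart_ring C c"
    have A: "subring ?A C" by (rule chart_subring[OF c(1,2)])
    have AC: "?A \<subseteq> carrier C" using subringE(1)[OF A] .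
    have AW: "h ` ?A \<subseteq> W" using chart_subset_iff[OF c(1,2) Ws] W' c(3) by blast
    define M where "M = {a \<in> ?A. h a \<in> nonunits W}"
    have M: "maximalideal M (C\<lparr>carrier := ?A\<rparr>)"
      unfolding M_def
    proof (rule maximalideal_vimage_nonunits[OF A Wl AW])
      fix a assume a: "a \<in> ?A" "h a \<notin> nonunits W"
      then have "h a \<in> W" using AW by blast
      \<comment> \<open>Here the finite residue field is used: the inverse of \<open>h a\<close>
        modulo the nonunits is taken to be a power of \<open>h a\<close>, which stays in the chart
        ring.\<close>
      then obtain n where n: "n > 0" "h a ^ n - 1 \<in> nonunits W"
        using unit_power_cong_1[OF Wl _ _ a(2)] W' by blast
      have "is_subring (h ` ?A)" using subring_iff_is_subring[OF AC] A by simp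
      then have "h a ^ (n - 1) \<in> h ` ?A" using is_subringD(7) a by blast
      moreover have "h a ^ n = h a * h a ^ (n - 1)" using n(1) by (cases n) auto
      ultimately show "\<exists>b\<in>?A. h a * h b - 1 \<in> nonunits W" using n(2) by force
    qed
    define R where "R = localization C ?A M"
    have R: "h ` R \<in> VV" using point[OF c(1,2) M] unfolding R_def by blast
    interpret maximal_ideal_set "h ` ?A" "h ` M" by (rule maximal_ideal_set_image[OF A M])
    have MA: "M \<subseteq> ?A" and M0: "\<zero> \<in> M"
      using subringE(2)[OF A] h_zero zero_nonunit[OF Ws] by (auto simp: M_def)
    have RV: "h ` R = V" using h_localization[OF AC MA M0] unfolding R_def by blast
    \<comment> \<open>\<open>V\<close> is a member of \<open>VV\<close> by \<open>point\<close>, so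
      its maximality turns this inclusion into equality.\<close>
    have "V \<subseteq> W" by (rule V_least[OF Wl AW]) (auto simp: M_def)
    then have "W = V" using VV_maximal[OF R Ws] RV W' by auto
    moreover have "R \<in> closed_points C" unfolding closed_points_def R_def using c M by blast
    ultimately show ?thesis using RV by blast
  qed
  show "image h ` closed_points C = VV"
    using converse point unfolding closed_points_def by blast
  show "R \<subseteq> carrier C" if "R \<in> closed_points C" for R
    using that point unfolding closed_points_def by blast
qed


end

section \<open>Vector spaces over finite fields\<close>

text \<open>Adding an independent vector \<open>v\<close> multiplies the cardinality by that of
  \<open>K\<close>: two representations \<open>k v + w\<close> with different \<open>k\<close> would
  put a nonzero multiple of \<open>v\<close>, and then \<open>v\<close>, into the old span.\<close>

lemma (in ring) card_Span:
  assumes K: "subfield K R" and fin: "finite K" and "independent K Us"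
  shows "card (Span K Us) = card K ^ length Us"
  using assms(3)
proof (induction Us rule: list.induct)
  case Nil
  then show ?case by simp
next
  case (Cons v Us)
  then have v: "v \<in> carrier R" "v \<notin> Span K Us" and Us: "independent K Us"
    by (auto elim: independent.cases)
  have in_carr: "set Us \<subseteq> carrier R" using independent_in_carrier[OF Us] by simp
  note props = Span_subgroup_props[OF K in_carr]
  have KC: "K \<subseteq> carrier R" using subfieldE(3)[OF K] .
  let ?f = "\<lambda>(k, w). k \<otimes> v \<oplus> w"
  have "Span K (v # Us) = ?f ` (K \<times> Span K Us)"
    using line_extension_mem_iff by (fastforce simp: image_iff)
  moreover have "inj_on ?f (K \<times> Span K Us)"
  proof (rule inj_onI, clarify)
    fix k w k' w' assume a: "k \<in> K" "w \<in> Span K Us" "k' \<in> K" "w' \<in> Span K Us"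
      "k \<otimes> v \<oplus> w = k' \<otimes> v \<oplus> w'"
    have c: "k \<in> carrier R" "k' \<in> carrier R" "w \<in> carrier R" "w' \<in> carrier R"
      using a KC props(1) by auto
    have "(k \<ominus> k') \<otimes> v = (k \<otimes> v \<oplus> w) \<ominus> k' \<otimes> v \<ominus> w" using c v by algebra
    also have "\<dots> = w' \<oplus> \<ominus> w" unfolding a(5) using c v by algebra
    finally have e: "(k \<ominus> k') \<otimes> v = w' \<oplus> \<ominus> w" .
    also have "\<dots> \<in> Span K Us" using props(3,4) a by blast
    finally have "(k \<ominus> k') \<otimes> v \<in> Span K Us" .
    moreover have "k \<ominus> k' \<in> K"
      using subringE(5,7)[OF subfieldE(1)[OF K]] a by (simp add: a_minus_def)
    ultimately have "k \<ominus> k' = \<zero>"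
      using Span_m_inv_simprule[OF K in_carr, of "k \<ominus> k'" v] v by blast
    moreover from this have "w' \<oplus> \<ominus> w = \<zero>" using e v by simp
    ultimately show "k = k' \<and> w = w'" using c r_right_minus_eq[of k k'] r_right_minus_eq[of w' w]
      by (auto simp: a_minus_def)
  qed
  ultimately show ?case using Cons.IH[OF Us] by (simp add: card_image card_cartesian_product)
qed

lemma (in ring) card_of_dimension:
  assumes "subfield K R" "finite K" "dimension n K E"
  shows "card E = card K ^ n"
  using exists_base[OF assms(1,3)] card_Span[OF assms(1,2)] by metis

lemma (in ring) finite_dimension_of_finite:
  assumes "subfield K R" "finite (carrier R)"
  shows "finite_dimension K (carrier R)"
proof -
  obtain Us where Us: "set Us = carrier R" using finite_list[OF assms(2)] by blast
  then have "Span K Us = carrier R"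
    using Span_base_incl[OF assms(1), of Us] Span_subgroup_props(1)[OF assms(1), of Us] by auto
  then show ?thesis using Span_finite_dimension[OF assms(1), of Us] Us by simp
qed

section \<open>Residue degrees and ramification indices in a curve model\<close>

context curve_model
begin

lemma coset_eq_iff:
  assumes R: "R \<subseteq> carrier C" "is_local (h ` R)" and ab: "a \<in> R" "b \<in> R"
  shows "residue_class C R a = residue_class C R b \<longleftrightarrow> h a - h b \<in> nonunits (h ` R)"
proof -
  have M: "max_ideal C R \<subseteq> carrier C" using R max_ideal_subset by blast
  have e: "residue_class C R c = (\<lambda>m. m \<oplus> c) ` max_ideal C R" for c
    by (auto simp: residue_class_def local_ring_def a_r_coset_def r_coset_def)
  have img: "h ` residue_class C R c = (\<lambda>m. m + h c) ` nonunits (h ` R)" if "c \<in> R" for c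
  proof -
    have "h (m \<oplus> c) = h m + h c" if "m \<in> max_ideal C R" for m
      using that \<open>c \<in> R\<close> M R by (intro h_add) auto
    then have "h ` residue_class C R c = (\<lambda>m. m + h c) ` h ` max_ideal C R"
      unfolding e image_image by (rule image_cong[OF refl])
    then show ?thesis using h_max_ideal[OF R(1)] by simp
  qed
  have sub: "residue_class C R c \<subseteq> carrier C" if "c \<in> R" for c
  proof -
    have "c \<in> carrier C" using that R(1) by blast
    then show ?thesis using M unfolding e by auto
  qed
  have "residue_class C R a = residue_class C R b \<longleftrightarrow> h ` residue_class C R a = h ` residue_class C R b"
    using inj_on_image_eq_iff[OF inj_h sub sub] ab by blast
  also have "\<dots> \<longleftrightarrow> h a - h b \<in> nonunits (h ` R)"
    using img add_image_eq_iff[OF R(2)] ab by simp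
  finally show ?thesis .
qed

text \<open>The classes on the left are modulo the maximal ideal of \<open>R\<close>, those on the
  right modulo that of \<open>Z\<close>. They agree on \<open>Z\<close> because a nonunit of
  \<open>R\<close> lying in \<open>Z\<close> has no inverse in the smaller ring either, and
  conversely by the assumption on nonunits.\<close>

lemma card_image_residue_class:
  assumes R: "R \<subseteq> carrier C" "is_local (h ` R)" and Z: "Z \<subseteq> R" "is_local (h ` Z)"
    and "nonunits (h ` Z) \<subseteq> nonunits (h ` R)"
  shows "card (residue_class C R ` Z) = card (residue_classes (h ` Z))"
    "finite (residue_class C R ` Z) \<longleftrightarrow> finite (residue_classes (h ` Z))"
proof -
  have ZC: "Z \<subseteq> carrier C" using R Z by auto
  have "residue_class C R a = residue_class C R b \<longleftrightarrow> residue_class C Z a = residue_class C Z b"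
    if "a \<in> Z" "b \<in> Z" for a b
  proof -
    have "h a - h b \<in> h ` Z" using is_subringD(3)[OF is_localD(1)[OF Z(2)]] that by blast
    moreover have "x \<in> nonunits (h ` Z)" if "x \<in> nonunits (h ` R)" "x \<in> h ` Z" for x
      using that Z(1) by (auto simp: nonunits_def)
    ultimately have "h a - h b \<in> nonunits (h ` R) \<longleftrightarrow> h a - h b \<in> nonunits (h ` Z)"
      using assms(5) by blast
    then show ?thesis
      using coset_eq_iff[OF R, of a b] coset_eq_iff[OF ZC Z(2), of a b] that Z(1) by auto
  qed
  moreover have "(\<lambda>m. m + h a) ` nonunits (h ` Z) = (\<lambda>m. m + h b) ` nonunits (h ` Z) \<longleftrightarrow>
      residue_class C Z a = residue_class C Z b" if "a \<in> Z" "b \<in> Z" for a b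
    using that coset_eq_iff[OF ZC Z(2), of a b] add_image_eq_iff[OF Z(2), of "h a" "h b"] by simp
  ultimately have eq: "residue_class C R a = residue_class C R b \<longleftrightarrow>
      (\<lambda>m. m + h a) ` nonunits (h ` Z) = (\<lambda>m. m + h b) ` nonunits (h ` Z)" if "a \<in> Z" "b \<in> Z" for a b
    by (metis that)
  have "\<exists>g. bij_betw g (F ` Z) (G ` Z)"
    if "\<And>a b. a \<in> Z \<Longrightarrow> b \<in> Z \<Longrightarrow> F a = F b \<longleftrightarrow> G a = G b" for F :: "'f \<Rightarrow> 'f set" and G :: "'f \<Rightarrow> 'k set"
  proof -
    have "G (inv_into Z F (F a)) = G a" if "a \<in> Z" for a
      using that \<open>\<And>a b. a \<in> Z \<Longrightarrow> b \<in> Z \<Longrightarrow> F a = F b \<longleftrightarrow> G a = G b\<close>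
      by (metis f_inv_into_f imageI inv_into_into)
    then have "bij_betw (\<lambda>x. G (inv_into Z F x)) (F ` Z) (G ` Z)"
      unfolding bij_betw_def using that by (auto simp: inj_on_def image_image)
    then show ?thesis by blast
  qed
  from this[of "residue_class C R" "\<lambda>a. (\<lambda>m. m + h a) ` nonunits (h ` Z)"] eq
  obtain g where "bij_betw g (residue_class C R ` Z) ((\<lambda>a. (\<lambda>m. m + h a) ` nonunits (h ` Z)) ` Z)" by blast
  then show "card (residue_class C R ` Z) = card (residue_classes (h ` Z))"
    "finite (residue_class C R ` Z) \<longleftrightarrow> finite (residue_classes (h ` Z))"
    unfolding residue_classes_def image_image by (auto simp: bij_betw_same_card bij_betw_finite)
qed

text \<open>Over a finite field, degrees of residue field extensions can be read off from cardinalities.\<close>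

lemma residue_degree:
  assumes R: "R \<subseteq> carrier C" "is_local (h ` R)" and Z: "Z \<subseteq> R" "is_local (h ` Z)"
    and nu: "nonunits (h ` Z) \<subseteq> nonunits (h ` R)"
    and fin: "finite (residue_classes (h ` R))"
    and card: "card (residue_classes (h ` R)) = card (residue_classes (h ` Z)) ^ n"
  shows "(ring.dim (residue_field C R) over (residue_class C R ` Z)) (carrier (residue_field C R)) = n"
proof -
  have Rs: "subring R C" using subring_iff_is_subring[OF R(1)] is_localD(1)[OF R(2)] by simp
  have ZC: "Z \<subseteq> carrier C" using R Z by auto
  have Zs: "subring Z C" using subring_iff_is_subring[OF ZC] is_localD(1)[OF Z(2)] by simp
  let ?R = "local_ring C R" and ?M = "max_ideal C R"
  let ?F = "residue_field C R" and ?r = "residue_class C R"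
  have Req: "?R = C\<lparr>carrier := R\<rparr>" by (simp add: local_ring_def)
  have Meq: "?M = {a \<in> R. h a \<in> nonunits (h ` R)}"
    using max_ideal_iff[OF R(1)] max_ideal_subset by blast
  have "maximalideal ?M ?R"
    unfolding Req Meq
  proof (rule maximalideal_vimage_nonunits[OF Rs R(2) order_refl])
    fix a assume "a \<in> R" "h a \<notin> nonunits (h ` R)"
    then have "inverse (h a) \<in> h ` R" "h a \<noteq> 0" by (auto simp: nonunits_def)
    then show "\<exists>b\<in>R. h a * h b - 1 \<in> nonunits (h ` R)"
      using zero_nonunit[OF is_localD(1)[OF R(2)]] by (metis diff_self imageE right_inverse)
  qed
  then interpret M: maximalideal ?M ?R .
  interpret RC: cring ?R unfolding Req by (rule subring_cring[OF Rs])
  interpret F: field ?F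
    unfolding residue_field_def using M.quotient_is_field[OF RC.cring_axioms] .
  have r: "?r = (\<lambda>f. ?M +>\<^bsub>?R\<^esub> f)" by (auto simp: residue_class_def)
  interpret hom: ring_hom_ring ?R ?F ?r
    unfolding residue_field_def r using M.rcos_ring_hom_ring by simp
  have carr: "carrier ?F = ?r ` R"
    unfolding residue_field_def FactRing_def r A_RCOSETS_def' by (auto simp: Req)
  have K: "subfield (?r ` Z) ?F"
  proof (rule F.subfieldI')
    have "subring Z ?R"
      unfolding Req
    proof (rule ring.ring_incl_imp_subring)
      show "ring (C\<lparr>carrier := R\<rparr>)" using cring.axioms(1)[OF subring_cring[OF Rs]] .
      show "Z \<subseteq> carrier (C\<lparr>carrier := R\<rparr>)" using Z by simp
      show "ring (C\<lparr>carrier := R, carrier := Z\<rparr>)"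
        using subring_cring[OF Zs] by (simp add: cring_def)
    qed
    then show "subring (?r ` Z) ?F" by (rule hom.img_is_subring)
    \<comment> \<open>An element of \<open>Z\<close> with nonzero class is a unit of
      \<open>Z\<close>, so the inverse class also comes from \<open>Z\<close>.\<close>
    fix k assume "k \<in> ?r ` Z - {\<zero>\<^bsub>?F\<^esub>}"
    then obtain f where f: "f \<in> Z" "k = ?r f" "?r f \<noteq> \<zero>\<^bsub>?F\<^esub>" by blast
    have fR: "f \<in> R" "f \<in> carrier C" using f Z R by auto
    have zR: "\<zero> \<in> R" using subringE(2)[OF Rs] .
    have "?r \<zero> = \<zero>\<^bsub>?F\<^esub>" using hom.hom_zero by (simp add: Req)
    then have "h f \<notin> nonunits (h ` R)"
      using f(3) coset_eq_iff[OF R fR(1) zR] h_zero by auto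
    then have "h f \<notin> nonunits (h ` Z)" using nu by blast
    then have "inverse (h f) \<in> h ` Z" "h f \<noteq> 0" using f(1) by (auto simp: nonunits_def)
    then obtain g where g: "g \<in> Z" "h f * h g = 1" by (metis imageE right_inverse)
    have gR: "g \<in> R" "g \<in> carrier C" using g Z R by auto
    have "h (f \<otimes> g) = h \<one>" using h_mult fR gR g h_one by simp
    then have "f \<otimes> g = \<one>" using h_eq_iff[of "f \<otimes> g" \<one>] fR gR by simp
    then have "?r f \<otimes>\<^bsub>?F\<^esub> ?r g = \<one>\<^bsub>?F\<^esub>"
      using hom.hom_mult[of f g] hom.hom_one fR gR by (simp add: Req)
    then have "inv\<^bsub>?F\<^esub> (?r f) = ?r g"
      using F.comm_inv_char[of "?r f" "?r g"] fR gR carr by auto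
    then show "inv\<^bsub>?F\<^esub> k \<in> ?r ` Z" using f(2) g(1) by auto
  qed
  have finF: "finite (carrier ?F)" "card (carrier ?F) = card (residue_classes (h ` R))"
    using card_image_residue_class[OF R order_refl R(2) order_refl] fin carr by auto
  have KF: "?r ` Z \<subseteq> carrier ?F" using carr Z by auto
  have cK: "card (?r ` Z) = card (residue_classes (h ` Z))"
    using card_image_residue_class[OF R Z nu] by simp
  have finK: "finite (?r ` Z)" using KF finF finite_subset by blast
  define d where "d = (F.dim over (?r ` Z)) (carrier ?F)"
  have "F.finite_dimension (?r ` Z) (carrier ?F)" by (rule F.finite_dimension_of_finite[OF K finF(1)])
  then have "card (carrier ?F) = card (?r ` Z) ^ d"
    unfolding d_def by (rule F.card_of_dimension[OF K finK F.finite_dimensionE[OF K]])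
  moreover have "card (?r ` Z) > 1"
  proof -
    have "{\<zero>\<^bsub>?F\<^esub>, \<one>\<^bsub>?F\<^esub>} \<subseteq> ?r ` Z"
      using subringE(2,3)[OF subfieldE(1)[OF K]] by auto
    from card_mono[OF finK this] show ?thesis using F.one_not_zero by simp
  qed
  ultimately have "d = n" using card finF(2) cK by (simp add: power_inject_exp)
  then show ?thesis by (simp add: d_def)
qed

text \<open>The field of constants is a local ring with maximal ideal 0, so its residue classes are
  the constants themselves and \<open>residue_degree\<close> applies.\<close>

lemma point_degree_eq:
  assumes R: "R \<subseteq> carrier C" "is_local (h ` R)" "scalars C \<subseteq> R"
    and fin: "finite (residue_classes (h ` R))"
    and card: "card (residue_classes (h ` R)) = card (scalars C) ^ n"
  shows "point_degree C R = n"
proof -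
  have s: "is_subring (h ` scalars C)"
    using subring_iff_is_subring[OF scalars_in] subfieldE(1)[OF scalars_subfield] by simp
  have n: "nonunits (h ` scalars C) = {0}"
    using h_scalars_local[OF order_refl s] zero_nonunit[OF s] nonunits_subset by blast
  have loc: "is_local (h ` scalars C)" using s n by (simp add: is_local_def)
  have "card (residue_classes (h ` scalars C)) = card (h ` scalars C)"
    by (rule card_residue_classes[OF loc]) (auto simp: n)
  also have "\<dots> = card (scalars C)"
    using inj_h scalars_in by (meson card_image inj_on_subset)
  finally show ?thesis
    unfolding point_degree_def
    by (intro residue_degree[OF R(1,2,3) loc _ fin])
      (use n card zero_nonunit[OF is_localD(1)[OF R(2)]] in auto)
qed

lemma inertia_degree_eq:
  assumes R: "R \<subseteq> carrier C" "is_local (h ` R)" and Z: "\<phi> ` x \<subseteq> R" "is_local (h ` \<phi> ` x)"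
    and nu: "nonunits (h ` \<phi> ` x) \<subseteq> nonunits (h ` R)"
    and fin: "finite (residue_classes (h ` R))"
    and card: "card (residue_classes (h ` R)) = card (residue_classes (h ` \<phi> ` x)) ^ n"
  shows "inertia_degree C \<phi> R x = n"
  using residue_degree[OF R Z nu fin card] unfolding inertia_degree_def image_image by simp

text \<open>Here \<open>p\<close> is a uniformizer of the upper ring. The pulled-back maximal ideal
  lies in the multiples of \<open>p ^ e\<close> and contains one generator \<open>p ^ e * u\<close>
  of them, so it generates exactly the \<open>e\<close>-th power of the maximal ideal.\<close>

lemma ramification_index_eq:
  assumes R: "R \<subseteq> carrier C" "is_local (h ` R)"
    and pi: "p \<in> h ` R" "p \<noteq> 0" "nonunits (h ` R) = (*) p ` h ` R"
    and I: "h ` \<phi> ` max_ideal D x \<subseteq> (*) (p ^ e) ` h ` R" "\<phi> ` max_ideal D x \<subseteq> R"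
    and w: "p ^ e * u \<in> h ` \<phi> ` max_ideal D x" "u \<in> h ` R" "inverse u \<in> h ` R" "u \<noteq> 0"
  shows "ramification_index C D \<phi> R x = e"
proof -
  note loc = is_localD(1)[OF R(2)]
  note D = is_subringD[OF loc]
  have Rs: "subring R C" using subring_iff_is_subring[OF R(1)] loc by simp
  have Req: "local_ring C R = C\<lparr>carrier := R\<rparr>" by (simp add: local_ring_def)
  interpret RC: cring "C\<lparr>carrier := R\<rparr>" by (rule subring_cring[OF Rs])
  define P where "P n = {a \<in> R. h a \<in> (*) (p ^ n) ` h ` R}" for n
  have P_ideal: "ideal (P n) (C\<lparr>carrier := R\<rparr>)" for n
    unfolding P_def
  proof (rule ideal_vimage[OF Rs])
  qed (use principal_closed[OF loc] in auto)
  have M: "max_ideal C R = P 1"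
  proof -
    have "max_ideal C R = {a \<in> R. h a \<in> nonunits (h ` R)}"
      using max_ideal_iff[OF R(1)] max_ideal_subset[of R] by blast
    then show ?thesis by (simp add: P_def pi(3))
  qed
  have pow: "ideal_power (C\<lparr>carrier := R\<rparr>) (P 1) n = P n" for n
  proof (induction n)
    case 0
    then show ?case by (auto simp: P_def)
  next
    case (Suc n)
    have "ideal_prod (C\<lparr>carrier := R\<rparr>) (P 1) (P n) = P (Suc n)"
    proof
      show "ideal_prod (C\<lparr>carrier := R\<rparr>) (P 1) (P n) \<subseteq> P (Suc n)"
      proof
        fix s assume "s \<in> ideal_prod (C\<lparr>carrier := R\<rparr>) (P 1) (P n)"
        then show "s \<in> P (Suc n)"
        proof induction
          case (prod i j)
          then obtain a b where ab: "a \<in> R" "b \<in> R" "h i = p * h a" "h j = p ^ n * h b"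
            unfolding P_def by auto
          have ij: "i \<in> R" "j \<in> R" using prod by (auto simp: P_def)
          have "h (i \<otimes> j) = h i * h j" using ij R(1) by (intro h_mult) auto
          also have "\<dots> = p ^ Suc n * (h a * h b)" using ab by simp
          finally show ?case
            using ij subringE(6)[OF Rs] D(4)[of "h a" "h b"] ab(1,2) unfolding P_def by auto
        next
          case (sum s1 s2)
          then show ?case
            using additive_subgroup.a_closed[OF ideal.axioms(1)[OF P_ideal]] by blast
        qed
      qed
      show "P (Suc n) \<subseteq> ideal_prod (C\<lparr>carrier := R\<rparr>) (P 1) (P n)"
      proof
        fix s assume s: "s \<in> P (Suc n)"
        then obtain c where c: "c \<in> R" "h s = p ^ Suc n * h c" and sR: "s \<in> R" unfolding P_def by auto
        obtain a where a: "a \<in> R" "h a = p" using pi(1) by blast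
        obtain b where b: "b \<in> R" "h b = p ^ n * h c" using D(4)[OF D(7)[OF pi(1), of n], of "h c"] c by force
        have "a \<in> P 1" using a h_one D(1) unfolding P_def by (auto intro!: image_eqI[of _ _ 1])
        moreover have "b \<in> P n" using b c unfolding P_def by auto
        moreover have "s = a \<otimes> b"
        proof -
          have "h (a \<otimes> b) = h a * h b" using a b R(1) by (intro h_mult) auto
          then have "h s = h (a \<otimes> b)" using a b c by simp
          moreover have "s \<in> carrier C" "a \<otimes> b \<in> carrier C" using a b sR R(1) by auto
          ultimately show ?thesis using h_eq_iff by blast
        qed
        ultimately show "s \<in> ideal_prod (C\<lparr>carrier := R\<rparr>) (P 1) (P n)"
          using ideal_prod.prod[of a "P 1" b "P n" "C\<lparr>carrier := R\<rparr>"] by simp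
      qed
    qed
    then show ?case using Suc by simp
  qed
  \<comment> \<open>The definite description in \<open>ramification_index\<close> requires distinct
    powers to be distinct ideals; otherwise 1 would be a multiple of \<open>p\<close>.\<close>
  have P_inj: "m = n" if "P m = P n" for m n
  proof -
    have "\<not> m < n" if "P m = P n" for m n
    proof
      assume "m < n"
      obtain a where a: "a \<in> R" "h a = p ^ m" using D(7)[OF pi(1), of m] by force
      then have "a \<in> P m" using D(1) unfolding P_def by (auto intro!: image_eqI[of _ _ 1])
      then have "h a \<in> (*) (p ^ n) ` h ` R" using that unfolding P_def by blast
      then obtain b where b: "b \<in> h ` R" "p ^ m = p ^ n * b" unfolding a(2) by blast
      have "p ^ n = p ^ m * p * p ^ (n - m - 1)"
      proof -
        have "n = m + 1 + (n - m - 1)" using \<open>m < n\<close> by simp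
        then have "p ^ n = p ^ (m + 1 + (n - m - 1))" by simp
        then show ?thesis by (simp only: power_add power_one_right)
      qed
      then have "p ^ m * 1 = p ^ m * (p * (p ^ (n - m - 1) * b))" 
        using b(2) \<open>p ^ n = p ^ m * p * p ^ (n - m - 1)\<close> by (metis mult.assoc mult_1_right)
      then have "1 = p * (p ^ (n - m - 1) * b)" using pi(2) by (subst (asm) mult_left_cancel) auto
      moreover have "p ^ (n - m - 1) * b \<in> h ` R" using D(4,7) pi(1) b(1) by blast
      ultimately have "1 \<in> nonunits (h ` R)" unfolding pi(3) by blast
      then show False using one_not_nonunit[OF loc] by simp
    qed
    from this[of m n] this[of n m] that show ?thesis by auto
  qed
  have gen: "genideal (C\<lparr>carrier := R\<rparr>) (\<phi> ` max_ideal D x) = P e"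
  proof
    have "\<phi> ` max_ideal D x \<subseteq> P e" using I unfolding P_def by blast
    then show "genideal (C\<lparr>carrier := R\<rparr>) (\<phi> ` max_ideal D x) \<subseteq> P e"
      unfolding genideal_def using P_ideal by blast
    let ?G = "genideal (C\<lparr>carrier := R\<rparr>) (\<phi> ` max_ideal D x)"
    have G: "ideal ?G (C\<lparr>carrier := R\<rparr>)" "\<phi> ` max_ideal D x \<subseteq> ?G"
      using RC.genideal_ideal[of "\<phi> ` max_ideal D x"] RC.genideal_self[of "\<phi> ` max_ideal D x"] I(2) by auto
    obtain g where g: "g \<in> \<phi> ` max_ideal D x" "h g = p ^ e * u" using w(1) by (metis imageE)
    show "P e \<subseteq> ?G"
    proof
      fix a assume "a \<in> P e"
      then obtain b where b: "b \<in> h ` R" "h a = p ^ e * b" "a \<in> R" unfolding P_def by auto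
      obtain c where c: "c \<in> R" "h c = inverse u * b" using D(4)[OF w(3) b(1)] by force
      have gR: "g \<in> R" using g I by blast
      have "h (g \<otimes> c) = h g * h c" using gR c R(1) by (intro h_mult) auto
      also have "\<dots> = h a" using g b c w(4) by simp
      finally have "g \<otimes> c = a" using h_eq_iff[of "g \<otimes> c" a] gR c b R(1) by auto
      moreover have "g \<otimes> c \<in> ?G" using ideal.I_r_closed[OF G(1), of g c] G(2) g c by auto
      ultimately show "a \<in> ?G" by simp
    qed
  qed
  show ?thesis
    unfolding ramification_index_def Req M pow gen
    by (rule the_equality) (use P_inj in auto)
qed

end

hide_const (open) Divisibility.irreducible
hide_fact (open) Divisibility.irreducible_def
section \<open>Polynomials over a field\<close>

text \<open>A nonzero combination of least degree divides every combination, by division with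
  remainder. It therefore divides both \<open>p\<close> and \<open>s\<close>, and irreducibility of
  \<open>p\<close> makes it a unit.\<close>

lemma irreducible_bezout:
  fixes p s :: "'a::field poly"
  assumes "irreducible p" "\<not> p dvd s"
  shows "\<exists>a b. a * p + b * s = 1"
proof -
  define Q where "Q d \<longleftrightarrow> d \<noteq> 0 \<and> (\<exists>a b. d = a * p + b * s)" for d
  have "Q p" 
  proof -
    have "p = 1 * p + 0 * s" by simp
    moreover have "p \<noteq> 0" using assms(1) by auto
    ultimately show ?thesis unfolding Q_def by blast
  qed
  then obtain d where d: "Q d" and min: "\<And>e. Q e \<Longrightarrow> degree d \<le> degree e"
    using ex_has_least_nat[of Q p degree] by blast
  then obtain a b where ab: "d = a * p + b * s" "d \<noteq> 0" by (auto simp: Q_def)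
  have dvd: "d dvd a' * p + b' * s" for a' b'
  proof (rule ccontr)
    let ?e = "(a' * p + b' * s) mod d"
    assume "\<not> d dvd a' * p + b' * s"
    then have "?e \<noteq> 0" by (simp add: dvd_eq_mod_eq_0)
    moreover have "?e = (a' - ((a' * p + b' * s) div d) * a) * p + (b' - ((a' * p + b' * s) div d) * b) * s"
      by (simp add: minus_div_mult_eq_mod[symmetric] ab(1) algebra_simps)
    ultimately have "Q ?e" unfolding Q_def by blast
    then show False using min degree_mod_less'[OF ab(2) \<open>?e \<noteq> 0\<close>] by force
  qed
  have "d dvd p" "d dvd s" using dvd[of 1 0] dvd[of 0 1] by auto
  then have "d dvd 1" using irreducibleD'[OF assms(1)] assms(2) dvd_trans by blast
  then obtain c where "1 = d * c" by blast
  then have "(c * a) * p + (c * b) * s = 1" by (simp add: ab(1) algebra_simps)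
  then show ?thesis by blast
qed

lemma irreducible_degree_pos: "irreducible p \<Longrightarrow> degree p > 0" for p :: "'a::field poly"
  using is_unit_iff_degree[of p] by (auto simp: irreducible_def)

lemma irreducible_factor:
  fixes p s :: "'a::field poly"
  assumes p: "irreducible p" and "s \<noteq> 0"
  shows "\<exists>n u. s = p ^ n * u \<and> \<not> p dvd u"
  using assms(2)
proof (induction "degree s" arbitrary: s rule: less_induct)
  case less
  show ?case
  proof (cases "p dvd s")
    case True
    then obtain s' where s': "s = p * s'" by blast
    then have "p \<noteq> 0" "s' \<noteq> 0" using less.prems by auto
    then have "degree s' < degree s" using s' irreducible_degree_pos[OF p] by (simp add: degree_mult_eq)
    then obtain n u where "s' = p ^ n * u" "\<not> p dvd u" using less.hyps \<open>s' \<noteq> 0\<close> by blast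
    then show ?thesis using s' by (intro exI[of _ "Suc n"] exI[of _ u]) (simp add: mult.assoc)
  next
    case False
    then have "s = p ^ 0 * s \<and> \<not> p dvd s" by simp
    then show ?thesis by blast
  qed
qed

text \<open>Phrased by coefficients so that \<open>n = 0\<close> gives exactly the zero polynomial,
  which a bound \<open>degree r < n\<close> would miss.\<close>

definition polys_below :: "nat \<Rightarrow> 'a::zero poly set" where
  "polys_below n = {r. \<forall>i\<ge>n. coeff r i = 0}"

lemma polys_below_iff_degree: "n > 0 \<Longrightarrow> r \<in> polys_below n \<longleftrightarrow> degree r < n"
  unfolding polys_below_def
  by (auto simp: coeff_eq_0) (metis coeff_0 degree_0 leading_coeff_0_iff not_le)

lemma card_polys_below:
  "finite (polys_below n :: 'a::{zero,finite} poly set)"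
  "card (polys_below n :: 'a::{zero,finite} poly set) = card (UNIV :: 'a set) ^ n"
proof -
  have "finite (polys_below n :: 'a poly set) \<and> card (polys_below n :: 'a poly set) = card (UNIV :: 'a set) ^ n"
  proof (induction n)
    case 0
    have "polys_below 0 = {0 :: 'a poly}" by (auto simp: polys_below_def poly_eq_iff)
    then show ?case by simp
  next
    case (Suc n)
    have "polys_below (Suc n) = (\<lambda>(a, r). pCons a r) ` (UNIV \<times> (polys_below n :: 'a poly set))"
    proof (intro equalityI subsetI)
      fix r :: "'a poly" assume r: "r \<in> polys_below (Suc n)"
      obtain a r' where e: "r = pCons a r'" by (cases r)
      have "coeff r' i = 0" if "i \<ge> n" for i
        using r that unfolding polys_below_def e by (auto dest!: spec[of _ "Suc i"])
      then have "r' \<in> polys_below n" by (simp add: polys_below_def)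
      then show "r \<in> (\<lambda>(a, r). pCons a r) ` (UNIV \<times> polys_below n)" using e by force
    next
      fix r :: "'a poly" assume "r \<in> (\<lambda>(a, r). pCons a r) ` (UNIV \<times> polys_below n)"
      then show "r \<in> polys_below (Suc n)" by (auto simp: polys_below_def coeff_pCons split: nat.splits)
    qed
    moreover have "inj_on (\<lambda>(a, r). pCons a r) (UNIV \<times> (polys_below n :: 'a poly set))"
      by (auto simp: inj_on_def)
    ultimately show ?case using Suc by (simp add: card_image card_cartesian_product)
  qed
  then show "finite (polys_below n :: 'a poly set)"
    "card (polys_below n :: 'a poly set) = card (UNIV :: 'a set) ^ n" by auto
qed

section \<open>The local rings of the projective line\<close>

lemma const_fract_simps [simp]:
  "const_fract 0 = 0" "const_fract 1 = 1" "const_fract (a + b) = const_fract a + const_fract b"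
  "const_fract (a - b) = const_fract a - const_fract b" "const_fract (- a) = - const_fract a"
  "const_fract (a * b) = const_fract a * const_fract b"
  "const_fract a = const_fract b \<longleftrightarrow> a = b" "const_fract a = 0 \<longleftrightarrow> a = 0"
  by (simp_all add: const_fract_def one_pCons[symmetric] flip: to_fract_add to_fract_diff to_fract_mult to_fract_uminus)

lemma inverse_const_fract: "inverse (const_fract a) = const_fract (inverse a)"
proof (cases "a = 0")
  case False
  have "const_fract a * const_fract (inverse a) = 1" using False by (simp flip: const_fract_simps(6))
  then show ?thesis by (rule inverse_unique)
qed simp

lemma var_fract_nz [simp]: "var_fract \<noteq> 0"
  by (simp add: var_fract_def)

lemma to_fract_pCons: "to_fract (pCons a q) = const_fract a + var_fract * to_fract q"
  by (simp add: const_fract_def var_fract_def flip: to_fract_add to_fract_mult)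

lemma to_fract_smult: "to_fract (smult c q) = const_fract c * to_fract q"
  by (simp add: const_fract_def flip: to_fract_mult)

lemma var_fract_power: "var_fract ^ n = to_fract (monom 1 n)"
  by (induction n) (simp_all add: monom_0 one_pCons[symmetric] monom_Suc to_fract_pCons)

lemma fract_cases: obtains a b where "f = to_fract a / to_fract b" "b \<noteq> 0"
  by (cases f) (auto simp: Fract_conv_to_fract)

definition poly_fracts :: "'a::field poly fract set" where
  "poly_fracts = range to_fract"

text \<open>The ring of polynomials in \<open>1/t\<close>, that is, the coordinate ring of the chart
  around infinity.\<close>

definition inf_fracts :: "'a::field poly fract set" where
  "inf_fracts = {to_fract q / var_fract ^ n | q n. degree q \<le> n}"

definition place :: "'a::field poly \<Rightarrow> 'a poly fract set" where
  "place p = loc poly_fracts ((*) (to_fract p) ` poly_fracts)"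

definition place_inf :: "'a::field poly fract set" where
  "place_inf = loc inf_fracts ((*) (inverse var_fract) ` inf_fracts)"

text \<open>Monic representatives make \<open>place\<close> injective, so finite places correspond
  to monic irreducible polynomials.\<close>

definition places :: "'a::field poly fract set set" where
  "places = insert place_inf (place ` {p. irreducible p \<and> lead_coeff p = 1})"

lemma subring_poly_fracts: "is_subring poly_fracts"
  unfolding poly_fracts_def
  by (rule is_subringI) (auto simp flip: to_fract_1 to_fract_diff to_fract_mult)

lemma mem_principal_poly: "to_fract s \<in> (*) (to_fract p) ` poly_fracts \<longleftrightarrow> p dvd s"
  by (auto simp: poly_fracts_def image_iff dvd_def simp flip: to_fract_mult)

lemma principal_prime_poly:
  assumes p: "irreducible p"
  shows "principal_prime poly_fracts (to_fract p)"
proof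
  show "is_subring poly_fracts" by (rule subring_poly_fracts)
  show "to_fract p \<in> poly_fracts" by (simp add: poly_fracts_def)
  show "to_fract p \<noteq> 0" using p by auto
  show "1 \<notin> (*) (to_fract p) ` poly_fracts"
    using mem_principal_poly[of 1 p] p unfolding irreducible_def to_fract_1 by blast
  show "\<exists>t\<in>poly_fracts. s * t - 1 \<in> (*) (to_fract p) ` poly_fracts"
    if s: "s \<in> poly_fracts" "s \<notin> (*) (to_fract p) ` poly_fracts" for s
  proof -
    obtain s' where s': "s = to_fract s'" using s by (auto simp: poly_fracts_def)
    then have "\<not> p dvd s'" using that mem_principal_poly by blast
    obtain a b where "a * p + b * s' = 1" using irreducible_bezout[OF p \<open>\<not> p dvd s'\<close>] by blast
    then have e: "s' * b - 1 = p * (- a)" by (simp add: algebra_simps)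
    have "s * to_fract b - 1 = to_fract (s' * b - 1)" by (simp add: s')
    then have "s * to_fract b - 1 \<in> (*) (to_fract p) ` poly_fracts"
      using mem_principal_poly[of "s' * b - 1" p] e by simp
    then show ?thesis by (auto simp: poly_fracts_def)
  qed
  show "\<exists>n. \<exists>u\<in>poly_fracts. s = to_fract p ^ n * u \<and> u \<notin> (*) (to_fract p) ` poly_fracts"
    if s: "s \<in> poly_fracts" "s \<noteq> 0" for s
  proof -
    obtain s' where s': "s = to_fract s'" "s' \<noteq> 0" using s by (auto simp: poly_fracts_def)
    obtain n u where u: "s' = p ^ n * u" "\<not> p dvd u" using irreducible_factor[OF p s'(2)] by blast
    have "to_fract (p ^ n) = to_fract p ^ n" by (induction n) simp_all
    then have "s = to_fract p ^ n * to_fract u" by (simp add: s' u)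
    moreover have "to_fract u \<notin> (*) (to_fract p) ` poly_fracts" using u(2) mem_principal_poly by blast
    moreover have "to_fract u \<in> poly_fracts" by (simp add: poly_fracts_def)
    ultimately show ?thesis by blast
  qed
qed

lemma inf_fractsI: "degree q \<le> n \<Longrightarrow> to_fract q / var_fract ^ n \<in> inf_fracts"
  by (auto simp: inf_fracts_def)

lemma subring_inf_fracts: "is_subring inf_fracts"
proof (rule is_subringI)
  show "1 \<in> inf_fracts" using inf_fractsI[of 1 0] by simp
  fix a b :: "'a poly fract" assume "a \<in> inf_fracts" "b \<in> inf_fracts"
  then obtain q n r m where e: "a = to_fract q / var_fract ^ n" "b = to_fract r / var_fract ^ m"
    "degree q \<le> n" "degree r \<le> m" by (auto simp: inf_fracts_def)
  have "a * b = to_fract (q * r) / var_fract ^ (n + m)" by (simp add: e power_add)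
  moreover have "degree (q * r) \<le> n + m" using degree_mult_le[of q r] e by linarith
  ultimately show "a * b \<in> inf_fracts" using inf_fractsI by metis
  have "a - b = to_fract (q * monom 1 m - r * monom 1 n) / var_fract ^ (n + m)"
    by (simp add: e var_fract_power[symmetric] power_add field_simps)
  moreover have "degree (q * monom 1 m - r * monom 1 n) \<le> n + m"
    using degree_mult_le[of q "monom 1 m"] degree_mult_le[of r "monom 1 n"]
      degree_monom_le[of "1::'a" m] degree_monom_le[of "1::'a" n] e
    by (intro degree_diff_le) linarith+
  ultimately show "a - b \<in> inf_fracts" using inf_fractsI by metis
qed

text \<open>As a polynomial in \<open>1/t\<close>, the fraction
  \<open>to_fract q / var_fract ^ n\<close> has constant term \<open>coeff q n\<close>: this
  coefficient is its value at infinity.\<close>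

lemma mem_principal_inf:
  assumes "degree q \<le> n"
  shows "to_fract q / var_fract ^ n \<in> (*) (inverse var_fract) ` inf_fracts \<longleftrightarrow> coeff q n = 0"
proof
  assume "to_fract q / var_fract ^ n \<in> (*) (inverse var_fract) ` inf_fracts"
  then obtain r m where r: "to_fract q / var_fract ^ n = inverse var_fract * (to_fract r / var_fract ^ m)" "degree r \<le> m"
    by (auto simp: inf_fracts_def)
  then have "to_fract q * var_fract ^ Suc m = to_fract r * var_fract ^ n" by (simp add: field_simps)
  then have e: "q * monom 1 (Suc m) = r * monom 1 n" unfolding var_fract_power to_fract_mult[symmetric] to_fract_eq_iff .
  have shift: "coeff (f * monom 1 k) (l + k) = coeff f l" for f :: "'a poly" and k l
    using coeff_monom_mult[of 1 k f "l + k"] by (simp add: mult.commute)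
  have "coeff q n = coeff (r * monom 1 n) (n + Suc m)"
    unfolding e[symmetric] by (rule shift[symmetric])
  also have "\<dots> = coeff r (Suc m)" using shift[of r n "Suc m"] by (simp add: add.commute)
  also have "\<dots> = 0" using r(2) by (simp add: coeff_eq_0)
  finally show "coeff q n = 0" .
next
  assume c: "coeff q n = 0"
  show "to_fract q / var_fract ^ n \<in> (*) (inverse var_fract) ` inf_fracts"
  proof (cases n)
    case 0
    then have "q = 0" using assms c by (simp add: leading_coeff_0_iff[symmetric])
    then show ?thesis using is_subringD(2)[OF subring_inf_fracts] by (intro image_eqI[of _ _ 0]) auto
  next
    case (Suc m)
    have "degree q \<le> m" using assms c Suc by (metis le_SucE leading_coeff_0_iff degree_0 le0)
    then show ?thesis using inf_fractsI[of q m] Suc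
      by (intro image_eqI[of _ _ "to_fract q / var_fract ^ m"]) (auto simp: field_simps)
  qed
qed

lemma inf_fracts_minus_const:
  assumes "s \<in> inf_fracts"
  obtains c where "s - const_fract c \<in> (*) (inverse var_fract) ` inf_fracts"
proof -
  obtain q n where q: "s = to_fract q / var_fract ^ n" "degree q \<le> n" using assms by (auto simp: inf_fracts_def)
  let ?r = "q - monom (coeff q n) n"
  have "monom (coeff q n) n = smult (coeff q n) (monom 1 n)" by (simp add: smult_monom)
  then have e: "s - const_fract (coeff q n) = to_fract ?r / var_fract ^ n"
    by (simp add: q to_fract_smult diff_divide_distrib flip: var_fract_power)
  moreover have "degree ?r \<le> n" using q(2) degree_monom_le by (intro degree_diff_le) auto
  moreover have "coeff ?r n = 0" by simp
  ultimately have "s - const_fract (coeff q n) \<in> (*) (inverse var_fract) ` inf_fracts"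
    unfolding e using mem_principal_inf by blast
  then show ?thesis by (rule that)
qed

lemma const_in_inf: "const_fract c \<in> inf_fracts"
  using inf_fractsI[of "[:c:]" 0] by (simp add: const_fract_def)

lemma const_in_principal_inf: "const_fract c \<in> (*) (inverse var_fract) ` inf_fracts \<longleftrightarrow> c = 0"
  using mem_principal_inf[of "[:c:]" 0] by (simp add: const_fract_def)

lemma principal_prime_inf: "principal_prime inf_fracts (inverse (var_fract :: 'a::field poly fract))"
proof
  show "is_subring inf_fracts" by (rule subring_inf_fracts)
  show "inverse var_fract \<in> inf_fracts" using inf_fractsI[of 1 1] by (simp add: divide_inverse)
  show "inverse var_fract \<noteq> 0" by simp
  show "1 \<notin> (*) (inverse var_fract) ` inf_fracts" using const_in_principal_inf[of 1] by simp
  show "\<exists>t\<in>inf_fracts. s * t - 1 \<in> (*) (inverse var_fract) ` inf_fracts"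
    if s: "s \<in> inf_fracts" "s \<notin> (*) (inverse var_fract) ` inf_fracts" for s :: "'a poly fract"
  proof -
    obtain c where c: "s - const_fract c \<in> (*) (inverse var_fract) ` inf_fracts" using inf_fracts_minus_const[OF s(1)] .
    then have "c \<noteq> 0" using s(2) by auto
    have "s * const_fract (inverse c) - 1 = (s - const_fract c) * const_fract (inverse c)"
      using \<open>c \<noteq> 0\<close> by (simp add: algebra_simps flip: const_fract_simps(6))
    then show ?thesis using principal_closed(4)[OF subring_inf_fracts c] const_in_inf by metis
  qed
  show "\<exists>n. \<exists>u\<in>inf_fracts. s = inverse var_fract ^ n * u \<and> u \<notin> (*) (inverse var_fract) ` inf_fracts"
    if s: "s \<in> inf_fracts" "s \<noteq> 0" for s :: "'a poly fract"
  proof -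
    obtain q n where q: "s = to_fract q / var_fract ^ n" "degree q \<le> n" using s by (auto simp: inf_fracts_def)
    \<comment> \<open>The order of vanishing at infinity is \<open>n - degree q\<close>; dividing by
      that power of \<open>1/t\<close> leaves the nonzero constant term
      \<open>lead_coeff q\<close>.\<close>
    let ?u = "to_fract q / var_fract ^ degree q"
    have "var_fract ^ n = var_fract ^ (n - degree q) * (var_fract :: 'a poly fract) ^ degree q"
      using q(2) by (simp flip: power_add)
    then have "s = inverse var_fract ^ (n - degree q) * ?u" unfolding q(1) by (simp add: field_simps)
    moreover have "q \<noteq> 0" using s q by auto
    ultimately show ?thesis using inf_fractsI[of q "degree q"] mem_principal_inf[of q "degree q"]
      by (metis leading_coeff_0_iff order_refl)
  qed
qed

lemma fractions_poly: "fractions poly_fracts = UNIV"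
proof -
  have "f \<in> fractions poly_fracts" for f :: "'a poly fract"
  proof (rule fract_cases[of f])
    fix a b :: "'a poly" assume "f = to_fract a / to_fract b" "b \<noteq> 0"
    moreover have "to_fract a \<in> poly_fracts" "to_fract b \<in> poly_fracts" by (auto simp: poly_fracts_def)
    ultimately show ?thesis unfolding fractions_def using to_fract_eq_0_iff by blast
  qed
  then show ?thesis by auto
qed

lemma fractions_inf: "fractions inf_fracts = UNIV"
proof -
  have "f \<in> fractions inf_fracts" for f :: "'a poly fract"
  proof (rule fract_cases[of f])
    fix a b :: "'a poly" assume f: "f = to_fract a / to_fract b" "b \<noteq> 0"
    let ?n = "max (degree a) (degree b)"
    have "f = (to_fract a / var_fract ^ ?n) / (to_fract b / var_fract ^ ?n)" using f by simp
    moreover have "to_fract a / var_fract ^ ?n \<in> inf_fracts" "to_fract b / var_fract ^ ?n \<in> inf_fracts"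
      by (auto intro: inf_fractsI)
    moreover have "to_fract b / var_fract ^ ?n \<noteq> 0" using f by simp
    ultimately show ?thesis unfolding fractions_def by blast
  qed
  then show ?thesis by auto
qed

lemma places_cases:
  assumes "x \<in> places"
  obtains S \<pi> where "principal_prime S \<pi>" "fractions S = UNIV" "x = loc S ((*) \<pi> ` S)" "range const_fract \<subseteq> S"
proof -
  have "range const_fract \<subseteq> poly_fracts" by (auto simp: const_fract_def poly_fracts_def)
  then show ?thesis
    using assms principal_prime_poly principal_prime_inf fractions_poly fractions_inf const_in_inf that
    unfolding places_def place_def place_inf_def by blast
qed

text \<open>The remainders modulo \<open>p\<close> form a system of representatives, and the residue
  field of the localization is that of the polynomial ring modulo \<open>p\<close>.\<close>

lemma card_residue_place:
  fixes p :: "'a::{field,finite} poly"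
  assumes p: "irreducible p"
  shows "card (residue_classes (place p)) = card (UNIV :: 'a set) ^ degree p"
proof -
  interpret principal_prime poly_fracts "to_fract p" by (rule principal_prime_poly[OF p])
  have d: "degree p > 0" by (rule irreducible_degree_pos[OF p])
  have "card (residue_classes (place p)) = card (to_fract ` (polys_below (degree p) :: 'a poly set))"
    unfolding place_def
  proof (rule card_residue_classes_V)
    show "to_fract ` polys_below (degree p) \<subseteq> poly_fracts" by (auto simp: poly_fracts_def)
    fix s :: "'a poly fract" assume "s \<in> poly_fracts"
    then obtain s' where s': "s = to_fract s'" by (auto simp: poly_fracts_def)
    have "p dvd s' - s' mod p" by (simp add: minus_mod_eq_mult_div)
    then have "s - to_fract (s' mod p) \<in> I" using mem_principal_poly[of "s' - s' mod p" p] s' by simp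
    moreover have "s' mod p \<in> polys_below (degree p)"
      using polys_below_iff_degree[OF d, of "s' mod p"] degree_mod_less[of p s'] d by (metis degree_0 not_gr0)
    ultimately show "\<exists>t\<in>to_fract ` polys_below (degree p). s - t \<in> I" by blast
  next
    fix s t :: "'a poly fract" assume "s \<in> to_fract ` polys_below (degree p)" "t \<in> to_fract ` polys_below (degree p)" "s - t \<in> I"
    then obtain s' t' where st: "s = to_fract s'" "t = to_fract t'" "s' \<in> polys_below (degree p)" "t' \<in> polys_below (degree p)"
      by blast
    then have e: "s = to_fract s'" "t = to_fract t'" "degree s' < degree p" "degree t' < degree p" "p dvd s' - t'"
      using polys_below_iff_degree[OF d] mem_principal_poly[of "s' - t'" p] \<open>s - t \<in> I\<close> by auto
    have "s' - t' = 0"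
    proof (rule ccontr)
      assume "s' - t' \<noteq> 0"
      then have "degree p \<le> degree (s' - t')" using e(5) by (rule dvd_imp_degree_le[rotated])
      then show False using degree_diff_less[OF e(3,4)] by simp
    qed
    then show "s = t" using e by simp
  qed
  also have "\<dots> = card (UNIV :: 'a set) ^ degree p"
    by (subst card_image) (auto simp: inj_on_def card_polys_below)
  finally show ?thesis .
qed

lemma card_residue_place_inf:
  "card (residue_classes (place_inf :: 'a::{field,finite} poly fract set)) = card (UNIV :: 'a set)"
proof -
  interpret principal_prime "inf_fracts :: 'a poly fract set" "inverse var_fract" by (rule principal_prime_inf)
  have "card (residue_classes (place_inf :: 'a poly fract set)) = card (range (const_fract :: 'a \<Rightarrow> _))"
    unfolding place_inf_def
  proof (rule card_residue_classes_V)
    show "range const_fract \<subseteq> inf_fracts" using const_in_inf by auto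
    show "\<exists>t\<in>range const_fract. s - t \<in> I" if "s \<in> inf_fracts" for s :: "'a poly fract"
      using inf_fracts_minus_const[OF that] by (metis rangeI)
    show "s = t" if st: "s \<in> range const_fract" "t \<in> range const_fract" "s - t \<in> I" for s t :: "'a poly fract"
    proof -
      obtain b c where "s = const_fract b" "t = const_fract c" using st by blast
      then show ?thesis using const_in_principal_inf[of "b - c"] st(3) by simp
    qed
  qed
  also have "\<dots> = card (UNIV :: 'a set)" by (rule card_image) (auto simp: inj_on_def)
  finally show ?thesis .
qed

lemma poly_fracts_subset:
  assumes "is_subring R" "range const_fract \<subseteq> R" "var_fract \<in> R"
  shows "poly_fracts \<subseteq> R"
proof -
  note D = is_subringD[OF assms(1)]
  have "to_fract q \<in> R" for q
  proof (induction q)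
    case (pCons a q)
    have "const_fract a \<in> R" using assms(2) by blast
    then show ?case using D(6)[OF _ D(4)[OF assms(3) pCons.IH]] by (simp add: to_fract_pCons)
  qed (use D in auto)
  then show ?thesis by (auto simp: poly_fracts_def)
qed

lemma inf_fracts_subset:
  assumes "is_subring R" "range const_fract \<subseteq> R" "inverse var_fract \<in> R"
  shows "inf_fracts \<subseteq> R"
proof -
  note D = is_subringD[OF assms(1)]
  have "to_fract q / var_fract ^ n \<in> R" if "degree q \<le> n" for q n
    using that
  proof (induction q arbitrary: n)
    case (pCons a q)
    have a: "const_fract a * inverse var_fract ^ n \<in> R" using D(4,7) assms by blast
    show ?case
    proof (cases "q = 0")
      case True
      then show ?thesis using a by (simp add: to_fract_pCons divide_inverse power_inverse)
    next
      case False
      then obtain m where m: "n = Suc m" "degree q \<le> m" using pCons.prems by (cases n) auto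
      have "to_fract (pCons a q) / var_fract ^ n = const_fract a * inverse var_fract ^ n + to_fract q / var_fract ^ m"
        by (simp add: m to_fract_pCons field_simps power_inverse)
      then show ?thesis using D(6)[OF a pCons.IH[OF m(2)]] by simp
    qed
  qed (use D in auto)
  then show ?thesis by (auto simp: inf_fracts_def)
qed

lemma const_unit:
  assumes "range const_fract \<subseteq> R" "c \<noteq> 0"
  shows "const_fract c \<in> R" "const_fract c \<notin> nonunits R"
  using assms inverse_const_fract[of c] by (auto simp: nonunits_def)

text \<open>If \<open>t\<close> is in \<open>R\<close>, take a nonzero polynomial of least degree
  among the nonunits of \<open>R\<close>. One exists, as otherwise \<open>R\<close> would contain
  all fractions; it is irreducible because the nonunits form a prime ideal. If \<open>t\<close> is
  not in \<open>R\<close>, then \<open>1/t\<close> is a nonunit and \<open>R\<close> dominates the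
  place at infinity.\<close>

lemma places_dominated:
  assumes R: "is_local R" "R \<noteq> UNIV" "range const_fract \<subseteq> R" "var_fract \<in> R \<or> inverse var_fract \<in> R"
  shows "\<exists>x\<in>places. x \<subseteq> R"
proof (cases "var_fract \<in> R")
  case True
  note Rs = is_localD(1)[OF R(1)]
  have P: "poly_fracts \<subseteq> R" by (rule poly_fracts_subset[OF Rs R(3) True])
  then have PR: "to_fract q \<in> R" for q by (auto simp: poly_fracts_def)
  define Q where "Q f \<longleftrightarrow> f \<noteq> 0 \<and> to_fract f \<in> nonunits R" for f
  have "\<exists>f. Q f"
  proof (rule ccontr)
    assume "\<not> ?thesis"
    then have "inverse (to_fract f) \<in> R" if "f \<noteq> 0" for f
      using that PR unfolding Q_def nonunits_def by auto
    then have "to_fract a / to_fract b \<in> R" if "b \<noteq> 0" for a b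
      using that PR is_subringD(4)[OF Rs] by (auto simp: divide_inverse)
    then have "R = UNIV" by (metis UNIV_eq_I fract_cases)
    then show False using R(2) by simp
  qed
  then obtain f where f: "Q f" and min: "\<And>g. Q g \<Longrightarrow> degree f \<le> degree g"
    using ex_has_least_nat[of Q _ degree] by blast
  define p where "p = smult (inverse (lead_coeff f)) f"
  have f0: "f \<noteq> 0" using f by (simp add: Q_def)
  have p: "Q p" "lead_coeff p = 1" "degree p = degree f"
    using f f0 nonunits_mult[OF Rs, of "to_fract f" "const_fract (inverse (lead_coeff f))"] R(3)
    by (auto simp: p_def Q_def to_fract_smult mult.commute)
  have nconst: "degree g \<noteq> 0" if "Q g" for g
  proof
    assume "degree g = 0"
    then obtain c where "g = [:c:]" by (rule degree_eq_zeroE)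
    then show False using that const_unit(2)[OF R(3), of c] by (auto simp: Q_def const_fract_def)
  qed
  have "irreducible p"
  proof (rule Factorial_Ring.irreducibleI)
    show "p \<noteq> 0" using p by (auto simp: Q_def)
    show "\<not> p dvd 1" using nconst[OF p(1)] is_unit_iff_degree[OF \<open>p \<noteq> 0\<close>] by simp
    fix a b assume ab: "p = a * b"
    then have nz: "a \<noteq> 0" "b \<noteq> 0" using \<open>p \<noteq> 0\<close> by auto
    have "Q a \<or> Q b"
      using p(1) nz nonunits_mult_iff[OF Rs PR PR] by (auto simp: Q_def ab)
    then have "degree p \<le> degree a \<or> degree p \<le> degree b" using min p(3) by auto
    then have "degree a = 0 \<or> degree b = 0" using nz by (auto simp: ab degree_mult_eq)
    then show "a dvd 1 \<or> b dvd 1" using nz is_unit_iff_degree by blast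
  qed
  then interpret principal_prime poly_fracts "to_fract p" by (rule principal_prime_poly)
  have "to_fract p \<in> nonunits R" using p by (simp add: Q_def)
  then have "I \<subseteq> nonunits R" using nonunits_mult[OF Rs] P by auto
  then have "place p \<subseteq> R" unfolding place_def by (rule V_least[OF R(1) P])
  then show ?thesis using \<open>irreducible p\<close> p(2) by (auto simp: places_def)
next
  case False
  note Rs = is_localD(1)[OF R(1)]
  have P: "inf_fracts \<subseteq> R" using inf_fracts_subset[OF Rs R(3)] R(4) False by auto
  interpret principal_prime "inf_fracts" "inverse var_fract" by (rule principal_prime_inf)
  have "inverse var_fract \<in> nonunits R" using False R(4) by (auto simp: nonunits_def)
  then have "I \<subseteq> nonunits R" using nonunits_mult[OF Rs] P by auto
  then have "place_inf \<subseteq> R" unfolding place_inf_def by (rule V_least[OF R(1) P])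
  then show ?thesis by (auto simp: places_def)
qed

lemma place_maximal:
  assumes "x \<in> places" "is_subring R" "x \<subseteq> R"
  shows "R = x \<or> R = UNIV"
proof (rule places_cases[OF assms(1)])
  fix S \<pi> assume "principal_prime S \<pi>" and S: "fractions S = UNIV" "x = loc S ((*) \<pi> ` S)"
  interpret principal_prime S \<pi> by fact
  show ?thesis using V_maximal[of R] assms S by auto
qed

lemma place_local:
  assumes "x \<in> places"
  shows "is_local x" "x \<noteq> UNIV" "range const_fract \<subseteq> x"
proof -
  obtain S \<pi> where pp: "principal_prime S \<pi>" and S: "fractions S = UNIV" "x = loc S ((*) \<pi> ` S)" "range const_fract \<subseteq> S"
    by (rule places_cases[OF assms])
  interpret principal_prime S \<pi> by fact
  show "is_local x" "x \<noteq> UNIV" "range const_fract \<subseteq> x"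
    using local_V V_neq_fractions S_subset S by auto
qed

lemma place_poly_nonunits:
  assumes "irreducible p"
  shows "to_fract s \<in> nonunits (place p) \<longleftrightarrow> p dvd s" "to_fract s \<in> place p"
    "inverse var_fract \<in> place p \<longleftrightarrow> \<not> p dvd [:0, 1:]"
proof -
  interpret principal_prime poly_fracts "to_fract p" by (rule principal_prime_poly[OF assms])
  have s: "to_fract s \<in> poly_fracts" for s by (simp add: poly_fracts_def)
  show n: "to_fract s \<in> nonunits (place p) \<longleftrightarrow> p dvd s" for s
    unfolding place_def using nonunits_Int_S[OF s] mem_principal_poly by blast
  show i: "to_fract s \<in> place p" for s unfolding place_def using S_subset s by blast
  show "inverse var_fract \<in> place p \<longleftrightarrow> \<not> p dvd [:0, 1:]"
    using n[of "[:0,1:]"] i[of "[:0,1:]"] unfolding nonunits_def var_fract_def by auto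
qed

lemma place_inj:
  assumes "irreducible p" "irreducible p'" "lead_coeff p = 1" "lead_coeff p' = 1" "place p = place p'"
  shows "p = p'"
proof -
  have d: "p dvd p'" "p' dvd p"
    using place_poly_nonunits(1)[OF assms(1), of p'] place_poly_nonunits(1)[OF assms(2), of p]
      place_poly_nonunits(1)[OF assms(1), of p] place_poly_nonunits(1)[OF assms(2), of p'] assms(5) by auto
  then obtain c where c: "p' = p * c" by blast
  have "p \<noteq> 0" "p' \<noteq> 0" using assms(1,2) by auto
  then have "degree c = 0"
    using c dvd_imp_degree_le[OF d(2)] by (auto simp: degree_mult_eq)
  then obtain e where "c = [:e:]" by (rule degree_eq_zeroE)
  moreover from this have "e = 1" using c assms(3,4) \<open>p' \<noteq> 0\<close> by (cases "e = 0") auto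
  ultimately show ?thesis using c by simp
qed

lemma var_notin_place_inf: "var_fract \<notin> place_inf"
  using principal_prime.inverse_pi_notin[OF principal_prime_inf] by (simp add: place_inf_def)

lemma inverse_var_nonunit_place_inf: "inverse var_fract \<in> nonunits place_inf"
proof -
  interpret principal_prime "inf_fracts" "inverse var_fract" by (rule principal_prime_inf)
  show ?thesis using pi_in S_subset var_notin_place_inf unfolding place_inf_def nonunits_def by auto
qed

lemma place_inf_neq: "irreducible p \<Longrightarrow> place p \<noteq> place_inf"
  using place_poly_nonunits(2)[of p "[:0,1:]"] var_notin_place_inf by (auto simp: var_fract_def)

section \<open>The projective line as a curve: closed points and degrees\<close>

lemma proj_line_simps [simp]:
  "carrier proj_line = UNIV" "a \<otimes>\<^bsub>proj_line\<^esub> b = a * b" "a \<oplus>\<^bsub>proj_line\<^esub> b = a + b"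
  "\<one>\<^bsub>proj_line\<^esub> = 1" "\<zero>\<^bsub>proj_line\<^esub> = 0" "scalars proj_line = range const_fract"
  "coords proj_line = {var_fract, 1}"
  by (simp_all add: proj_line_def ring.extend_def ring_of_type_algebra_def)

lemma field_proj_line: "field proj_line"
proof -
  have "\<exists>y. x + y = 0" for x :: "'a poly fract" using add.right_inverse by blast
  moreover have "x \<noteq> 0 \<Longrightarrow> \<exists>y. x * y = 1" for x :: "'a poly fract"
    by (rule exI[of _ "inverse x"]) auto
  ultimately show ?thesis
    by unfold_locales (auto simp: algebra_simps Units_def add_eq_0_iff)
qed

lemma curve_model_proj_line: "curve_model (proj_line :: 'a::field poly fract curve) id"
proof -
  interpret field "proj_line :: 'a poly fract curve" by (rule field_proj_line)
  have m: "\<ominus>\<^bsub>proj_line\<^esub> a = - a" for a :: "'a poly fract"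
    using minus_equality[of "- a" a] by simp
  have i: "inv\<^bsub>proj_line\<^esub> a = inverse a" if "a \<noteq> 0" for a :: "'a poly fract"
    using comm_inv_char[of a "inverse a"] that by simp
  show "curve_model (proj_line :: 'a poly fract curve) id"
  proof (intro curve_model.intro curve_model_axioms.intro field_proj_line)
    show "subfield (scalars proj_line) (proj_line :: 'a poly fract curve)"
    proof (rule subfieldI')
      show "subring (scalars proj_line) (proj_line :: 'a poly fract curve)"
        by (rule subringI) (auto simp: m simp flip: const_fract_simps(2,3,5,6))
      show "inv\<^bsub>proj_line\<^esub> k \<in> scalars proj_line" if "k \<in> scalars proj_line - {\<zero>\<^bsub>proj_line\<^esub>}" for k :: "'a poly fract"
        using that i by (auto simp: inverse_const_fract)
    qed
  qed auto
qed

lemma irreducible_X: "irreducible ([:c, 1:] :: 'a::field poly)"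
  by (rule irreducible_linear_field_poly) simp

lemma finite_residue_place:
  assumes "x \<in> (places :: 'a::{field,finite} poly fract set set)"
  shows "finite (residue_classes x)"
proof -
  \<comment> \<open>A positive cardinality suffices, since \<open>card\<close> of an infinite set is
    0.\<close>
  have "card (residue_classes x) \<noteq> 0"
    using assms by (auto simp: places_def card_residue_place card_residue_place_inf finite_UNIV_card_ge_0)
  then show ?thesis by (meson card.infinite)
qed

theorem closed_points_proj_line: "closed_points (proj_line :: 'a::{field,finite} poly fract curve) = places"
proof -
  have "image id ` closed_points (proj_line :: 'a poly fract curve) = places"
  proof (rule curve_model.closed_points_eq(1)[OF curve_model_proj_line])
    show "is_local V \<and> V \<subseteq> id ` carrier proj_line \<and> V \<noteq> id ` carrier proj_line \<and> id ` scalars proj_line \<subseteq> V \<and> finite (residue_classes V)"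
      if "V \<in> places" for V :: "'a poly fract set"
      using place_local[OF that] finite_residue_place[OF that] by simp
    show "R = V \<or> R = id ` carrier proj_line" if "V \<in> places" "is_subring R" "V \<subseteq> R" "R \<subseteq> id ` carrier proj_line" for V R :: "'a poly fract set"
      using place_maximal[OF that(1-3)] by simp
    show "\<exists>c\<in>coords proj_line. c \<noteq> \<zero>\<^bsub>proj_line\<^esub> \<and> (\<forall>d\<in>coords proj_line. id d / id c \<in> V)"
      if "V \<in> places" for V :: "'a poly fract set"
    proof -
      have "1 \<in> V" using is_subringD(1) is_localD(1) place_local(1)[OF that] by blast
      moreover have "var_fract \<in> V \<or> inverse var_fract \<in> V"
        using that place_poly_nonunits(2)[of _ "[:0,1:]"] inverse_var_nonunit_place_inf nonunits_subset
        by (auto simp: places_def var_fract_def)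
      ultimately show ?thesis by (auto simp: divide_inverse)
    qed
    show "\<exists>V\<in>places. \<forall>d\<in>coords proj_line. id d / id c \<in> V"
      if "c \<in> coords proj_line" "c \<noteq> \<zero>\<^bsub>proj_line\<^esub>" for c :: "'a poly fract"
    proof -
      \<comment> \<open>The chart of the coordinate 1 is met by the place at 0, the chart of the
        coordinate \<open>t\<close> by the place at infinity.\<close>
      let ?p = "[:0,1:] :: 'a poly"
      have p: "place ?p \<in> places"
        unfolding places_def using irreducible_X[of 0] by (intro insertI2 imageI) auto
      have i: "place_inf \<in> (places :: 'a poly fract set set)" by (auto simp: places_def)
      have "1 \<in> place ?p" "1 \<in> (place_inf :: 'a poly fract set)"
        using p i is_subringD(1) is_localD(1) place_local(1) by blast+
      moreover have "var_fract \<in> place ?p" "inverse var_fract \<in> (place_inf :: 'a poly fract set)"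
        using place_poly_nonunits(2)[OF irreducible_X, of ?p 0] inverse_var_nonunit_place_inf nonunits_subset
        by (auto simp: var_fract_def)
      moreover have "c = var_fract \<or> c = 1" using that by simp
      ultimately show ?thesis using p i by (auto simp: divide_inverse)
    qed
    show "\<exists>V\<in>places. V \<subseteq> R"
      if "is_local R" "R \<subseteq> id ` carrier proj_line" "R \<noteq> id ` carrier proj_line" "id ` scalars proj_line \<subseteq> R" "c \<in> coords proj_line" "c \<noteq> \<zero>\<^bsub>proj_line\<^esub>"
        "\<forall>d\<in>coords proj_line. id d / id c \<in> R" for R :: "'a poly fract set" and c
      using places_dominated[of R] that by (auto simp: divide_inverse)
  qed
  then show ?thesis by simp
qed

lemma point_degree_place:
  "irreducible p \<Longrightarrow> lead_coeff p = 1 \<Longrightarrow> point_degree proj_line (place p) = degree p"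
  "point_degree proj_line (place_inf :: 'a::{field,finite} poly fract set) = 1"
  for p :: "'a::{field,finite} poly"
proof -
  have c: "card (range (const_fract :: 'a \<Rightarrow> _)) = card (UNIV :: 'a set)"
    by (rule card_image) (auto simp: inj_on_def)
  show "point_degree proj_line (place p) = degree p" if "irreducible p" "lead_coeff p = 1"
  proof -
    have "place p \<in> places" using that by (simp add: places_def)
    then show ?thesis
      using place_local[of "place p"] finite_residue_place card_residue_place[OF that(1)] c
      by (intro curve_model.point_degree_eq[OF curve_model_proj_line]) auto
  qed
  have "place_inf \<in> (places :: 'a poly fract set set)" by (simp add: places_def)
  then show "point_degree proj_line (place_inf :: 'a poly fract set) = 1"
    using place_local[of "place_inf :: 'a poly fract set"] finite_residue_place card_residue_place_inf[where 'a='a] c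
    by (intro curve_model.point_degree_eq[OF curve_model_proj_line]) auto
qed

lemma card_residue_classes_places:
  fixes x :: "'a::{field,finite} poly fract set"
  assumes "x \<in> places"
  shows "card (residue_classes x) = card (UNIV :: 'a set) ^ point_degree proj_line x" "point_degree proj_line x > 0"
  using assms
  by (auto simp: places_def point_degree_place card_residue_place card_residue_place_inf irreducible_degree_pos)

section \<open>Quadratic extensions of discrete valuation rings\<close>

lemma residue_representatives:
  assumes "is_local R"
  obtains T where "T \<subseteq> R" "\<And>a. a \<in> R \<Longrightarrow> \<exists>t\<in>T. a - t \<in> nonunits R"
    "\<And>s t. s \<in> T \<Longrightarrow> t \<in> T \<Longrightarrow> s - t \<in> nonunits R \<Longrightarrow> s = t" "card T = card (residue_classes R)"
proof -
  let ?c = "\<lambda>a. (\<lambda>m. m + a) ` nonunits R"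
  have "\<exists>T\<subseteq>R. inj_on ?c T \<and> ?c ` R = ?c ` T"
    using subset_image_inj[of "?c ` R" ?c R] by (rule iffD1) (rule order_refl)
  then obtain T where T: "T \<subseteq> R" "?c ` T = ?c ` R" "inj_on ?c T" by metis
  note eq = add_image_eq_iff[OF assms]
  have 1: "\<exists>t\<in>T. a - t \<in> nonunits R" if "a \<in> R" for a
  proof -
    have "?c a \<in> ?c ` T" using that T(2) by blast
    then obtain t where "t \<in> T" "?c a = ?c t" by blast
    then show ?thesis using eq that T(1) by blast
  qed
  have 2: "s = t" if "s \<in> T" "t \<in> T" "s - t \<in> nonunits R" for s t
    using that eq[of s t] T(1) inj_onD[OF T(3)] by blast
  show ?thesis using that[OF T(1) 1 2] card_residue_classes[OF assms T(1) 1 2] by simp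
qed

text \<open>\<open>A\<close> is a discrete valuation ring with uniformizer \<open>p\<close> whose
  fraction field is the whole type (\<open>power_A\<close>). The assumption \<open>no_root\<close>
  makes 1 and \<open>\<eta>\<close> linearly independent, and \<open>smooth\<close> is regularity of
  \<open>A[\<eta>]\<close>: at a double root modulo \<open>p\<close> the polynomial must not vanish
  modulo \<open>p ^ 2\<close>.\<close>

locale quadratic_extension =
  fixes A :: "'b::field set" and p h1 h0 :: 'b and \<eta> :: "'b alg_closure"
  assumes local_A: "is_local A" and p_in: "p \<in> A" and p_nz: "p \<noteq> 0"
    and nonunits_A: "nonunits A = (*) p ` A"
    and power_A: "\<And>f. f \<noteq> 0 \<Longrightarrow> \<exists>n u. u \<in> A \<and> inverse u \<in> A \<and> (f = p ^ n * u \<or> p ^ n * f = u)"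
    and h1_in: "h1 \<in> A" and h0_in: "h0 \<in> A"
    and root: "\<eta> ^ 2 + to_ac h1 * \<eta> + to_ac h0 = 0"
    and no_root: "\<And>f. f ^ 2 + h1 * f + h0 \<noteq> 0"
    and smooth: "\<And>g. g \<in> A \<Longrightarrow> 2 * g + h1 \<in> nonunits A \<Longrightarrow> g ^ 2 + h1 * g + h0 \<notin> (*) (p ^ 2) ` A"
begin

section \<open>Arithmetic of the quadratic extension and its norm\<close>

definition elt where "elt a b = to_ac a + to_ac b * \<eta>"
definition S where "S = {elt a b | a b. a \<in> A \<and> b \<in> A}"
definition L where "L = {elt a b | a b. True}"
definition w where "w g = g ^ 2 + h1 * g + h0"
text \<open>The norm of \<open>a + b \<eta>\<close>, with conjugate \<open>a + b \<eta>'\<close>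
  where \<open>\<eta>' = - h1 - \<eta>\<close> is the other root.\<close>

definition nm where "nm a b = a ^ 2 - h1 * a * b + h0 * b ^ 2"

lemmas A_closed = is_subringD[OF is_localD(1)[OF local_A]]

lemma eta_square: "\<eta> * \<eta> = - to_ac h1 * \<eta> - to_ac h0"
proof -
  have "\<eta> * \<eta> = (\<eta> ^ 2 + to_ac h1 * \<eta> + to_ac h0) - to_ac h1 * \<eta> - to_ac h0"
    by (simp add: power2_eq_square)
  then show ?thesis unfolding root by simp
qed

lemma elt_mult: "elt a b * elt c d = elt (a * c - h0 * b * d) (a * d + b * c - h1 * b * d)"
proof -
  have "elt a b * elt c d = to_ac (a * c) + to_ac (a * d + b * c) * \<eta> + to_ac (b * d) * (\<eta> * \<eta>)"
    by (simp add: elt_def algebra_simps)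
  also have "\<dots> = elt (a * c - h0 * b * d) (a * d + b * c - h1 * b * d)"
    unfolding eta_square by (simp add: elt_def algebra_simps)
  finally show ?thesis .
qed

lemma elt_diff: "elt a b - elt c d = elt (a - c) (b - d)"
  by (simp add: elt_def algebra_simps)

lemma elt_const: "elt a 0 = to_ac a"
  by (simp add: elt_def)

lemma elt_one: "elt 1 0 = 1"
  by (simp add: elt_def)

lemma elt_eq_0: "elt a b = 0 \<longleftrightarrow> a = 0 \<and> b = 0"
proof
  assume e: "elt a b = 0"
  have "b = 0"
  proof (rule ccontr)
    assume b: "b \<noteq> 0"
    then have "\<eta> = to_ac (- a / b)" using e by (simp add: elt_def field_simps add_eq_0_iff)
    then have "to_ac ((- a / b) ^ 2 + h1 * (- a / b) + h0) = 0" using root by simp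
    then have "(- a / b) ^ 2 + h1 * (- a / b) + h0 = 0" by (metis to_ac_0 to_ac_eq_iff)
    then show False using no_root by blast
  qed
  then show "a = 0 \<and> b = 0" using e by (simp add: elt_def)
qed (simp add: elt_def)

lemma elt_eq_iff: "elt a b = elt c d \<longleftrightarrow> a = c \<and> b = d"
  using elt_eq_0[of "a - c" "b - d"] elt_diff[of a b c d] by auto

lemma elt_conj: "elt a b * elt (a - h1 * b) (- b) = to_ac (nm a b)"
  unfolding elt_mult elt_const[symmetric] elt_eq_iff nm_def by (simp add: algebra_simps power2_eq_square)

lemma nm_eq_0: "nm a b = 0 \<longleftrightarrow> a = 0 \<and> b = 0"
proof
  assume "nm a b = 0"
  then have "elt a b * elt (a - h1 * b) (- b) = 0" using elt_conj by simp
  then show "a = 0 \<and> b = 0" unfolding mult_eq_0_iff elt_eq_0 by auto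
qed (simp add: nm_def)

lemma nm_mult: "nm (a * c - h0 * b * d) (a * d + b * c - h1 * b * d) = nm a b * nm c d"
  unfolding nm_def by (simp add: power2_eq_square algebra_simps)

lemma elt_inverse: "elt a b \<noteq> 0 \<Longrightarrow> inverse (elt a b) = elt ((a - h1 * b) / nm a b) (- b / nm a b)"
proof -
  assume "elt a b \<noteq> 0"
  then have n: "nm a b \<noteq> 0" using elt_eq_0 nm_eq_0 by blast
  have "elt a b * elt ((a - h1 * b) / nm a b) (- b / nm a b) = elt a b * elt (a - h1 * b) (- b) / to_ac (nm a b)"
    unfolding times_divide_eq_right[symmetric] by (simp add: elt_def add_divide_distrib diff_divide_distrib)
  also have "\<dots> = 1" using n by (simp add: elt_conj)
  finally show ?thesis by (rule inverse_unique)
qed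

lemma nm_in: "a \<in> A \<Longrightarrow> b \<in> A \<Longrightarrow> nm a b \<in> A"
  unfolding nm_def using h1_in h0_in A_closed by auto

lemma S_eltI: "a \<in> A \<Longrightarrow> b \<in> A \<Longrightarrow> elt a b \<in> S"
  by (auto simp: S_def)

lemma subring_S: "is_subring S"
proof (rule is_subringI)
  show "1 \<in> S" using S_eltI[of 1 0] A_closed by (simp add: elt_one)
  fix s t assume "s \<in> S" "t \<in> S"
  then obtain a b c d where e: "s = elt a b" "t = elt c d" "a \<in> A" "b \<in> A" "c \<in> A" "d \<in> A" by (auto simp: S_def)
  show "s - t \<in> S" unfolding e elt_diff using e A_closed by (intro S_eltI) auto
  show "s * t \<in> S" unfolding e elt_mult using e A_closed h1_in h0_in by (intro S_eltI) auto
qed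

lemma subring_L: "is_subring L"
proof (rule is_subringI)
  show "1 \<in> L" unfolding L_def using elt_one by force
  show "s - t \<in> L" "s * t \<in> L" if "s \<in> L" "t \<in> L" for s t
    using that elt_diff elt_mult unfolding L_def by blast+
qed

lemma inverse_L: "f \<in> L \<Longrightarrow> inverse f \<in> L"
  using elt_inverse unfolding L_def by (cases "f = 0") auto

lemma fractions_S: "fractions S = L"
proof
  have "S \<subseteq> L" by (auto simp: S_def L_def)
  then show "fractions S \<subseteq> L"
    using is_subringD(4)[OF subring_L] inverse_L unfolding fractions_def divide_inverse by blast
  \<comment> \<open>A power of \<open>p\<close> serves as denominator for any element of the base
    field.\<close>
  have den: "\<exists>d. d \<in> A \<and> d \<noteq> 0 \<and> d * a \<in> A" for a
  proof (cases "a = 0")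
    case False
    then obtain n u where u: "u \<in> A" "a = p ^ n * u \<or> p ^ n * a = u" using power_A by blast
    have "p ^ n \<in> A" "p ^ n * (p ^ n * u) \<in> A" using A_closed p_in u by auto
    then show ?thesis using u p_nz by (intro exI[of _ "p ^ n"]) auto
  qed (use A_closed in auto)
  show "L \<subseteq> fractions S"
  proof
    fix f assume "f \<in> L"
    then obtain a b where f: "f = elt a b" by (auto simp: L_def)
    obtain d e where d: "d \<in> A" "d \<noteq> 0" "d * a \<in> A" "e \<in> A" "e \<noteq> 0" "e * b \<in> A" using den by metis
    have "f = elt (e * (d * a)) (d * (e * b)) / elt (d * e) 0"
      using d by (simp add: f elt_def field_simps)
    moreover have "elt (e * (d * a)) (d * (e * b)) \<in> S" "elt (d * e) 0 \<in> S"
      using d A_closed by (auto intro!: S_eltI)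
    moreover have "elt (d * e) 0 \<noteq> 0" using d by (simp add: elt_eq_0)
    ultimately show "f \<in> fractions S" unfolding fractions_def by blast
  qed
qed

lemma unit_A: "u \<in> A \<Longrightarrow> u \<notin> nonunits A \<longleftrightarrow> u \<noteq> 0 \<and> inverse u \<in> A"
  by (auto simp: nonunits_def)

lemma p_nonunit: "p \<in> nonunits A"
  unfolding nonunits_A using A_closed(1) by force

lemma p_mult_nonunit: "c \<in> A \<Longrightarrow> p * c \<in> nonunits A"
  unfolding nonunits_A by blast

lemma A_power:
  assumes "f \<in> A" "f \<noteq> 0"
  shows "\<exists>n u. u \<in> A \<and> u \<notin> nonunits A \<and> f = p ^ n * u"
proof -
  obtain n u where u: "u \<in> A" "inverse u \<in> A" "f = p ^ n * u \<or> p ^ n * f = u"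
    using power_A assms by blast
  have u0: "u \<noteq> 0" using u(3) assms p_nz by auto
  then have uu: "u \<notin> nonunits A" using u by (simp add: unit_A)
  have "n = 0" if "p ^ n * f = u"
  proof (rule ccontr)
    assume "n \<noteq> 0"
    then obtain k where "n = Suc k" by (cases n) auto
    then have "u = p * (p ^ k * f)" using that by (simp add: mult.assoc)
    moreover have "p ^ k * f \<in> A" using A_closed(4,7) assms p_in by auto
    ultimately show False using uu p_mult_nonunit by simp
  qed
  then have "f = p ^ n * u" using u(3) by auto
  then show ?thesis using u uu by blast
qed

lemma const_nonunit:
  assumes "is_subring R" "to_ac p \<in> nonunits R" "to_ac ` A \<subseteq> R"
  shows "to_ac ` nonunits A \<subseteq> nonunits R"
  using nonunits_mult[OF assms(1,2)] assms(3) unfolding nonunits_A by auto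

lemma const_in_S: "to_ac ` A \<subseteq> S"
  using S_eltI[of _ 0] A_closed(2) by (auto simp: elt_const)

text \<open>Encodes that \<open>V\<close> has ramification index \<open>e\<close> over
  \<open>A\<close>. It is phrased with \<open>nonunits A\<close> instead of \<open>p\<close>, so
  that it depends on \<open>A\<close> alone and can be quoted without fixing a uniformizer or an
  equation.\<close>

definition unif where "unif V e \<longleftrightarrow> (\<exists>\<pi> u. \<pi> \<in> V \<and> \<pi> \<noteq> 0 \<and> nonunits V = (*) \<pi> ` V \<and>
   to_ac ` nonunits A \<subseteq> (*) (\<pi> ^ e) ` V \<and> \<pi> ^ e * u \<in> to_ac ` nonunits A \<and> u \<in> V \<and> inverse u \<in> V \<and> u \<noteq> 0)"

lemma unifI:
  assumes V: "is_subring V" "S \<subseteq> V" "\<pi> \<in> V" "\<pi> \<noteq> 0" "nonunits V = (*) \<pi> ` V"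
    and u: "to_ac p = \<pi> ^ e * u" "u \<in> V" "inverse u \<in> V" "u \<noteq> 0"
  shows "unif V e"
  unfolding unif_def
proof (intro exI conjI)
  show "to_ac ` nonunits A \<subseteq> (*) (\<pi> ^ e) ` V"
  proof clarify
    fix a assume "a \<in> nonunits A"
    then obtain b where b: "b \<in> A" "a = p * b" unfolding nonunits_A by blast
    have "to_ac a = \<pi> ^ e * (u * to_ac b)" by (simp add: b u(1))
    moreover have "u * to_ac b \<in> V" using is_subringD(4)[OF V(1) u(2)] const_in_S b V(2) by blast
    ultimately show "to_ac a \<in> (*) (\<pi> ^ e) ` V" by blast
  qed
  show "\<pi> ^ e * u \<in> to_ac ` nonunits A" unfolding u(1)[symmetric] using p_nonunit by blast
qed (use assms in auto)

text \<open>The maximal proper subrings of the extension field that are local, contain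
  \<open>S\<close> and dominate \<open>A\<close>: the candidates for the points above
  \<open>A\<close>. Only \<open>A\<close> and \<open>\<eta>\<close> enter the definition.\<close>

definition good where "good V \<longleftrightarrow> is_local V \<and> S \<subseteq> V \<and> V \<subseteq> L \<and> V \<noteq> L \<and> to_ac ` nonunits A \<subseteq> nonunits V \<and>
   (\<forall>R. is_subring R \<longrightarrow> V \<subseteq> R \<longrightarrow> R \<subseteq> L \<longrightarrow> R = V \<or> R = L)"

lemma good_loc:
  assumes "principal_prime S \<pi>" "to_ac p \<in> (*) \<pi> ` S"
  shows "good (loc S ((*) \<pi> ` S))"
proof -
  interpret principal_prime S \<pi> by fact
  have "to_ac p \<in> nonunits V" using assms(2) N_nonunits by blast
  then show ?thesis
    unfolding good_def using local_V S_subset V_subset_fractions V_neq_fractions V_maximal fractions_S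
      const_nonunit[OF subring_V] const_in_S by auto
qed

subsection \<open>Points given by a simple root\<close>

text \<open>The norm of \<open>\<eta> - g\<close> is \<open>w g\<close>. If \<open>w g\<close> is a uniformizer then \<open>\<eta> - g\<close> generates a maximal
  ideal of \<open>S\<close>, and dividing an element of \<open>S\<close> by \<open>\<eta> - g\<close> lowers the valuation of its norm by 1.\<close>

definition Vr where "Vr g = loc S ((*) (elt (- g) 1) ` S)"

context
  fixes g u0
  assumes g: "g \<in> A" and wg: "w g = p * u0" and u0: "u0 \<in> A" "u0 \<notin> nonunits A"
begin

lemma u0_inv: "u0 \<noteq> 0" "inverse u0 \<in> A"
  using u0 unit_A by auto

lemma nm_root: "nm (- g) 1 = p * u0"
  using wg by (simp add: nm_def w_def)

text \<open>The quotient of \<open>S\<close> by \<open>\<eta> - g\<close> is \<open>A\<close> modulo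
  \<open>w g\<close>, hence \<open>A\<close> modulo \<open>p\<close>, via evaluation of
  \<open>\<eta>\<close> at \<open>g\<close>; so membership is decided by
  \<open>a + b * g\<close>.\<close>

lemma mem_root_ideal:
  assumes "a \<in> A" "b \<in> A"
  shows "elt a b \<in> (*) (elt (- g) 1) ` S \<longleftrightarrow> a + b * g \<in> nonunits A"
proof
  assume "elt a b \<in> (*) (elt (- g) 1) ` S"
  then obtain c d where cd: "c \<in> A" "d \<in> A" "elt a b = elt (- g) 1 * elt c d" by (auto simp: S_def)
  then have ab: "a = - g * c - h0 * 1 * d" "b = - g * d + 1 * c - h1 * 1 * d" unfolding elt_mult elt_eq_iff by blast+
  have "a + b * g = - d * w g" unfolding ab by (simp add: w_def power2_eq_square algebra_simps)
  also have "\<dots> = p * (- d * u0)" using wg by simp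
  finally show "a + b * g \<in> nonunits A" using p_mult_nonunit[of "- d * u0"] cd u0 A_closed(4,5) by simp
next
  assume "a + b * g \<in> nonunits A"
  then obtain c where c: "c \<in> A" "a + b * g = p * c" unfolding nonunits_A by blast
  \<comment> \<open>Since \<open>w\<close> vanishes at \<open>\<eta>\<close>, one has
    \<open>w g = (g - \<eta>) (g + \<eta> + h1)\<close>. Writing \<open>a + b * g\<close> as
    \<open>?k * w g\<close> therefore exhibits a multiple of \<open>\<eta> - g\<close>, and with it
    the cofactor.\<close>
  let ?k = "c * inverse u0"
  have k: "?k \<in> A" using c A_closed u0_inv by auto
  have e: "p * c = ?k * w g" using u0_inv wg by simp
  have "elt a b = elt (- g) 1 * elt (b - ?k * (g + h1)) (- ?k)"
    unfolding elt_mult elt_eq_iff using c(2) unfolding e by (simp add: w_def power2_eq_square algebra_simps)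
  moreover have "elt (b - ?k * (g + h1)) (- ?k) \<in> S"
    using k assms g h1_in A_closed by (intro S_eltI) auto
  ultimately show "elt a b \<in> (*) (elt (- g) 1) ` S" by blast
qed

lemma root_factor:
  assumes "a \<in> A" "b \<in> A" "nm a b = p ^ n * u" "u \<in> A" "u \<notin> nonunits A"
  shows "\<exists>k. \<exists>s\<in>S. elt a b = elt (- g) 1 ^ k * s \<and> s \<notin> (*) (elt (- g) 1) ` S"
  using assms
proof (induction n arbitrary: a b u rule: less_induct)
  case (less n)
  show ?case
  proof (cases "elt a b \<in> (*) (elt (- g) 1) ` S")
    case True
    then obtain c d where cd: "c \<in> A" "d \<in> A" "elt a b = elt (- g) 1 * elt c d" by (auto simp: S_def)
    then have "nm a b = nm (- g) 1 * nm c d"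
      using nm_mult[of "- g" c 1 d] unfolding elt_mult elt_eq_iff by simp
    then have e: "p ^ n * u = p * (u0 * nm c d)" using nm_root less.prems by simp
    have "n \<noteq> 0"
    proof
      assume "n = 0"
      then have "u = p * (u0 * nm c d)" using e by simp
      moreover have "u0 * nm c d \<in> A" using A_closed(4) u0(1) nm_in[OF cd(1,2)] by simp
      ultimately show False using less.prems(5) p_mult_nonunit by simp
    qed
    then obtain m where m: "n = Suc m" by (cases n) auto
    then have "nm c d = p ^ m * (u * inverse u0)" using e p_nz u0_inv by (simp add: field_simps)
    moreover have "u * inverse u0 \<in> A" using less.prems A_closed(4) u0_inv by simp
    moreover have "u * inverse u0 \<notin> nonunits A"
      using nonunits_mult_iff[OF is_localD(1)[OF local_A] less.prems(4) u0_inv(2)] less.prems(5) u0 u0_inv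
      by (auto simp: nonunits_def)
    ultimately obtain k s where "s \<in> S" "elt c d = elt (- g) 1 ^ k * s" "s \<notin> (*) (elt (- g) 1) ` S"
      using less.IH[of m c d] m cd by blast
    moreover from this have "elt a b = elt (- g) 1 ^ Suc k * s" by (simp add: cd(3) mult.assoc)
    ultimately show ?thesis by blast
  next
    case False
    then have "elt a b = elt (- g) 1 ^ 0 * elt a b \<and> elt a b \<notin> (*) (elt (- g) 1) ` S" by simp
    then show ?thesis using S_eltI less.prems by blast
  qed
qed

lemma principal_prime_root: "principal_prime S (elt (- g) 1)"
proof
  show "is_subring S" by (rule subring_S)
  show "elt (- g) 1 \<in> S" using g A_closed by (intro S_eltI) auto
  show "elt (- g) 1 \<noteq> 0" by (simp add: elt_eq_0)
  show "1 \<notin> (*) (elt (- g) 1) ` S"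
    using mem_root_ideal[of 1 0] one_not_nonunit[OF is_localD(1)[OF local_A]] A_closed by (simp add: elt_one)
  show "\<exists>t\<in>S. s * t - 1 \<in> (*) (elt (- g) 1) ` S" if s: "s \<in> S" "s \<notin> (*) (elt (- g) 1) ` S" for s
  proof -
    obtain a b where ab: "s = elt a b" "a \<in> A" "b \<in> A" using s by (auto simp: S_def)
    \<comment> \<open>This is the residue of \<open>s\<close>; its inverse in \<open>A\<close>
      inverts \<open>s\<close> modulo \<open>\<eta> - g\<close>.\<close>
    let ?c = "a + b * g"
    have c: "?c \<in> A" "?c \<notin> nonunits A" using s ab mem_root_ideal[of a b] A_closed g by auto
    then have ci: "?c \<noteq> 0" "inverse ?c \<in> A" using unit_A by auto
    have "s * elt (inverse ?c) 0 - 1 = elt (a * inverse ?c - 1) (b * inverse ?c)"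
      by (simp add: ab(1) elt_mult elt_one[symmetric] elt_diff del: inverse_divide)
    moreover have "(a * inverse ?c - 1) + (b * inverse ?c) * g = ?c * inverse ?c - 1"
      by (simp only: algebra_simps)
    then have "(a * inverse ?c - 1) + (b * inverse ?c) * g \<in> nonunits A"
      using ci zero_nonunit[OF is_localD(1)[OF local_A]] by simp
    ultimately have "s * elt (inverse ?c) 0 - 1 \<in> (*) (elt (- g) 1) ` S"
      using mem_root_ideal[of "a * inverse ?c - 1" "b * inverse ?c"] ab ci A_closed by simp
    then show ?thesis using S_eltI[OF ci(2) A_closed(2)] by blast
  qed
  show "\<exists>n. \<exists>u\<in>S. s = elt (- g) 1 ^ n * u \<and> u \<notin> (*) (elt (- g) 1) ` S" if s: "s \<in> S" "s \<noteq> 0" for s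
  proof -
    obtain a b where ab: "s = elt a b" "a \<in> A" "b \<in> A" using s by (auto simp: S_def)
    then have "nm a b \<noteq> 0" using s elt_eq_0 nm_eq_0 by blast
    then obtain n u where "nm a b = p ^ n * u" "u \<in> A" "u \<notin> nonunits A"
      using A_power[OF nm_in[OF ab(2,3)]] by blast
    then show ?thesis using root_factor[OF ab(2,3)] ab(1) by blast
  qed
qed

text \<open>The conjugate of \<open>\<eta> - g\<close> is \<open>-(\<eta> + g + h1)\<close>, and
  their product is the norm \<open>p * u0\<close>.\<close>

lemma p_factor: "to_ac p = elt (- g) 1 * (elt (g + h1) 1 * to_ac (- inverse u0))"
proof -
  have "elt (- g) 1 * elt (g + h1) 1 = - (elt (- g) 1 * elt (- g - h1 * 1) (- 1))"
    by (simp add: elt_def algebra_simps)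
  also have "\<dots> = - to_ac (p * u0)" unfolding elt_conj nm_root ..
  finally have "elt (- g) 1 * elt (g + h1) 1 * to_ac (- inverse u0) = to_ac (p * u0) * to_ac (inverse u0)"
    by simp
  also have "\<dots> = to_ac (p * u0 * inverse u0)" by (simp only: to_ac_mult)
  also have "\<dots> = to_ac p" using u0_inv by simp
  finally show ?thesis by (simp add: mult.assoc)
qed

lemma other_in: "elt (g + h1) 1 \<in> S" "to_ac (- inverse u0) \<in> S"
proof -
  show "elt (g + h1) 1 \<in> S" using g h1_in A_closed(1,6) by (intro S_eltI) auto
  have "- inverse u0 \<in> A" using A_closed(5) u0_inv(2) by blast
  then show "to_ac (- inverse u0) \<in> S" using const_in_S by blast
qed

lemma good_Vr: "good (Vr g)"
proof -
  have "to_ac p \<in> (*) (elt (- g) 1) ` S"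
    using p_factor is_subringD(4)[OF subring_S other_in] by blast
  then show ?thesis unfolding Vr_def by (rule good_loc[OF principal_prime_root])
qed

text \<open>Modulo \<open>\<eta> - g\<close> every element of \<open>S\<close> is congruent to an
  element of \<open>A\<close>, so representatives for \<open>A\<close> also serve above.\<close>

lemma card_residue_Vr: "card (residue_classes (Vr g)) = card (residue_classes A)"
proof -
  interpret pp: principal_prime S "elt (- g) 1" by (rule principal_prime_root)
  obtain T where T: "T \<subseteq> A" "\<And>a. a \<in> A \<Longrightarrow> \<exists>t\<in>T. a - t \<in> nonunits A"
    "\<And>s t. s \<in> T \<Longrightarrow> t \<in> T \<Longrightarrow> s - t \<in> nonunits A \<Longrightarrow> s = t" "card T = card (residue_classes A)"
    using residue_representatives[OF local_A] by blast
  have "card (residue_classes (Vr g)) = card (to_ac ` T)"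
    unfolding Vr_def
  proof (rule pp.card_residue_classes_V)
    show "to_ac ` T \<subseteq> S" using T(1) const_in_S by blast
    show "\<exists>t\<in>to_ac ` T. s - t \<in> pp.I" if s: "s \<in> S" for s
    proof -
      obtain a b where ab: "s = elt a b" "a \<in> A" "b \<in> A" using s by (auto simp: S_def)
      obtain t where t: "t \<in> T" "(a + b * g) - t \<in> nonunits A" using T(2)[of "a + b * g"] ab A_closed(4,6) g by auto
      have "s - to_ac t = elt (a - t) b" using elt_diff[of a b t 0] by (simp add: ab(1) elt_const)
      moreover have "(a - t) + b * g \<in> nonunits A" using t(2) by (simp add: algebra_simps)
      ultimately have "s - to_ac t \<in> pp.I" using mem_root_ideal[of "a - t" b] ab t T(1) A_closed by auto
      then show ?thesis using t by blast
    qed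
    show "s = t" if st: "s \<in> to_ac ` T" "t \<in> to_ac ` T" "s - t \<in> pp.I" for s t
    proof -
      obtain a b where ab: "s = to_ac a" "t = to_ac b" "a \<in> T" "b \<in> T" using st by blast
      have "s - t = elt (a - b) 0" by (simp add: ab elt_const)
      then have m: "elt (a - b) 0 \<in> pp.I" using st(3) by metis
      have "a - b \<in> A" using ab T(1) A_closed(3) by auto
      then have "(a - b) + 0 * g \<in> nonunits A" using mem_root_ideal[of "a - b" 0] m A_closed(2) by blast
      then have "a - b \<in> nonunits A" by simp
      then show ?thesis using T(3) ab by blast
    qed
  qed
  also have "\<dots> = card T" by (rule card_image) (auto simp: inj_on_def)
  finally show ?thesis using T(4) by simp
qed

lemma Vr_least:
  assumes "is_local R" "S \<subseteq> R" "elt (- g) 1 \<in> nonunits R"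
  shows "Vr g \<subseteq> R"
proof -
  interpret pp: principal_prime S "elt (- g) 1" by (rule principal_prime_root)
  have "pp.I \<subseteq> nonunits R" using nonunits_mult[OF is_localD(1)[OF assms(1)] assms(3)] assms(2) by auto
  then show ?thesis unfolding Vr_def by (rule pp.V_least[OF assms(1,2)])
qed

lemma Vr_nonunit: "elt (- g) 1 \<in> nonunits (Vr g)"
proof -
  interpret pp: principal_prime S "elt (- g) 1" by (rule principal_prime_root)
  have "elt (- g) 1 \<in> pp.I" using pp.S_closed(1) by force
  then show ?thesis unfolding Vr_def using pp.N_nonunits by blast
qed

text \<open>By \<open>p_factor\<close> and primality of the nonunits. The alternative decides which
  of the two conjugate local rings is contained in \<open>R\<close>.\<close>

lemma nonunit_factor:
  assumes "is_local R" "S \<subseteq> R" "to_ac p \<in> nonunits R"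
  shows "elt (- g) 1 \<in> nonunits R \<or> elt (g + h1) 1 \<in> nonunits R"
proof -
  note Rs = is_localD(1)[OF assms(1)]
  have m: "elt (- g) 1 \<in> R" "elt (g + h1) 1 \<in> R" "to_ac (- inverse u0) \<in> R"
    using assms(2) other_in S_eltI[of "- g" 1] g A_closed by auto
  have "to_ac (- inverse u0) \<notin> nonunits R"
  proof -
    have "to_ac (- u0) \<in> R" using const_in_S u0 assms(2) A_closed(5) by blast
    moreover have "inverse (to_ac (- inverse u0)) = to_ac (- u0)" by (simp flip: to_ac_inverse)
    ultimately show ?thesis using u0_inv by (auto simp: nonunits_def)
  qed
  then show ?thesis
    using assms(3) nonunits_mult_iff[OF Rs m(1) is_subringD(4)[OF Rs m(2,3)]]
      nonunits_mult_iff[OF Rs m(2,3)] unfolding p_factor by auto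
qed

text \<open>Evaluated at \<open>g\<close>, the factor \<open>\<eta> + g + h1\<close> becomes
  \<open>2 * g + h1\<close>, so \<open>\<eta> - g\<close> divides it. Both factors have the same
  norm, hence the quotient has norm 1 and is a unit of \<open>S\<close>; thus \<open>p\<close> is a
  unit times \<open>(\<eta> - g) ^ 2\<close>.\<close>

lemma unif_Vr_ramified:
  assumes r: "2 * g + h1 \<in> nonunits A"
  shows "unif (Vr g) 2" "\<exists>s\<in>S. elt (g + h1) 1 = elt (- g) 1 * s \<and> s \<notin> nonunits S"
proof -
  interpret pp: principal_prime S "elt (- g) 1" by (rule principal_prime_root)
  have "elt (g + h1) 1 \<in> pp.I"
    using mem_root_ideal[of "g + h1" 1] r g h1_in A_closed by (simp add: algebra_simps mult_2)
  then obtain c d where cd: "c \<in> A" "d \<in> A" "elt (g + h1) 1 = elt (- g) 1 * elt c d" by (auto simp: S_def)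
  then have "nm (g + h1) 1 = nm (- g) 1 * nm c d"
    using nm_mult[of "- g" c 1 d] unfolding elt_mult elt_eq_iff by simp
  moreover have "nm (g + h1) 1 = nm (- g) 1" by (simp add: nm_def power2_eq_square algebra_simps)
  moreover have "nm (- g) 1 \<noteq> 0" by (simp add: nm_eq_0)
  ultimately have n1: "nm c d = 1" by simp
  let ?s = "elt c d"
  have s: "?s \<in> S" "?s \<noteq> 0" "inverse ?s \<in> S"
  proof -
    show "?s \<in> S" using cd S_eltI by blast
    show "?s \<noteq> 0" using n1 nm_eq_0[of c d] elt_eq_0 by auto
    have "?s * elt (c - h1 * d) (- d) = 1" unfolding elt_conj n1 by simp
    then have "inverse ?s = elt (c - h1 * d) (- d)" by (rule inverse_unique)
    then show "inverse ?s \<in> S" using cd h1_in A_closed by (auto intro!: S_eltI)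
  qed
  then show "\<exists>s\<in>S. elt (g + h1) 1 = elt (- g) 1 * s \<and> s \<notin> nonunits S" using cd(3) by (auto simp: nonunits_def)
  let ?u = "?s * to_ac (- inverse u0)"
  have "to_ac p = elt (- g) 1 ^ 2 * ?u"
    unfolding p_factor cd(3) by (simp add: power2_eq_square mult.assoc)
  moreover have "?u \<in> S" using is_subringD(4)[OF subring_S s(1) other_in(2)] .
  moreover have "inverse ?u \<in> S"
  proof -
    have "inverse ?u = inverse ?s * to_ac (- u0)" by (simp add: mult.commute flip: to_ac_inverse)
    moreover have "to_ac (- u0) \<in> S" using const_in_S u0(1) A_closed(5) by blast
    ultimately show ?thesis using is_subringD(4)[OF subring_S s(3)] by metis
  qed
  moreover have "?u \<noteq> 0" using s u0_inv by simp
  ultimately show "unif (Vr g) 2"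
    unfolding Vr_def using pp.subring_V pp.S_subset pp.pi_in pp.pi_nz pp.nonunits_V
    by (intro unifI[of _ "elt (- g) 1" 2 ?u]) auto
qed

text \<open>Now the evaluation \<open>2 * g + h1\<close> of the second factor of \<open>p\<close> is
  a unit, so \<open>p\<close> and \<open>\<eta> - g\<close> differ by a unit of the
  localization.\<close>

lemma Vr_unramified:
  assumes r: "2 * g + h1 \<notin> nonunits A"
  shows "unif (Vr g) 1" "elt (g + h1) 1 \<notin> nonunits (Vr g)"
proof -
  interpret pp: principal_prime S "elt (- g) 1" by (rule principal_prime_root)
  have "elt (g + h1) 1 \<notin> pp.I"
    using mem_root_ideal[of "g + h1" 1] r g h1_in A_closed by (simp add: algebra_simps mult_2)
  then show n: "elt (g + h1) 1 \<notin> nonunits (Vr g)"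
    unfolding Vr_def using pp.S_unit other_in by blast
  let ?u = "elt (g + h1) 1 * to_ac (- inverse u0)"
  have "to_ac p = elt (- g) 1 ^ 1 * ?u" using p_factor by simp
  moreover have V: "?u \<in> Vr g" "elt (g + h1) 1 \<in> Vr g"
    unfolding Vr_def using is_subringD(4)[OF subring_S other_in] other_in pp.S_subset by auto
  moreover have "inverse ?u \<in> Vr g"
  proof -
    have "inverse ?u = inverse (elt (g + h1) 1) * to_ac (- u0)" by (simp add: mult.commute flip: to_ac_inverse)
    moreover have "to_ac (- u0) \<in> Vr g" unfolding Vr_def using const_in_S u0 A_closed(5) pp.S_subset by blast
    moreover have "inverse (elt (g + h1) 1) \<in> Vr g" using n V(2) by (auto simp: nonunits_def)
    ultimately show ?thesis using pp.V_closed(4) unfolding Vr_def by metis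
  qed
  moreover have "?u \<noteq> 0" using u0_inv by (simp add: elt_eq_0)
  ultimately show "unif (Vr g) 1"
    using pp.subring_V pp.S_subset pp.pi_in pp.pi_nz pp.nonunits_V
    by (intro unifI[of _ "elt (- g) 1" 1 ?u]) (auto simp: Vr_def)
qed

end

text \<open>A root modulo \<open>p\<close> can be chosen so that \<open>w\<close> vanishes there to first order only:
  replace \<open>g\<close> by \<open>g + p\<close> in the unramified case, and use smoothness in the ramified one.\<close>

lemma exists_simple_root:
  assumes g: "g \<in> A" "w g \<in> nonunits A"
  obtains g' u0 where "g' \<in> A" "w g' = p * u0" "u0 \<in> A" "u0 \<notin> nonunits A" "g' - g \<in> nonunits A"
proof (cases "w g \<in> (*) (p ^ 2) ` A")
  case False
  obtain u0 where u0: "u0 \<in> A" "w g = p * u0" using g unfolding nonunits_A by blast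
  have "u0 \<notin> nonunits A"
  proof
    assume "u0 \<in> nonunits A"
    then obtain v where "v \<in> A" "u0 = p * v" unfolding nonunits_A by blast
    moreover from this have "w g = p ^ 2 * v" using u0 by (simp add: power2_eq_square mult.assoc)
    ultimately have "w g \<in> (*) (p ^ 2) ` A" by blast
    then show False using False by simp
  qed
  have "g - g \<in> nonunits A" using zero_nonunit[OF is_localD(1)[OF local_A]] by simp
  then show ?thesis by (rule that[OF g(1) u0(2,1) \<open>u0 \<notin> nonunits A\<close>])
next
  case True
  then obtain c where c: "c \<in> A" "w g = p ^ 2 * c" by blast
  let ?d = "2 * g + h1"
  have d: "?d \<notin> nonunits A" using smooth[OF g(1)] True unfolding w_def by blast
  have dA: "?d \<in> A" unfolding mult_2 by (intro A_closed(6) g(1) h1_in)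
  \<comment> \<open>From the expansion \<open>w (g + p) = w g + p (2 g + h1) + p ^ 2\<close> and
    \<open>w g = p ^ 2 * c\<close>.\<close>
  let ?u = "?d + p * (1 + c)"
  have "w (g + p) = p * ?u" using c(2) unfolding w_def by (simp add: algebra_simps power2_eq_square)
  moreover have "p * (1 + c) \<in> nonunits A" using p_mult_nonunit[of "1 + c"] c A_closed(1,6) by simp
  ultimately show ?thesis
    using that[of "g + p" ?u] unit_plus_nonunit[OF local_A dA d] g p_in A_closed(6) p_nonunit by simp
qed

subsection \<open>The inert case\<close>

context
  assumes inert: "\<And>g. g \<in> A \<Longrightarrow> w g \<notin> nonunits A"
begin

text \<open>If \<open>b\<close> is a unit, the norm is \<open>b ^ 2\<close> times the value of
  \<open>w\<close> at \<open>- a / b\<close>, which is a unit by inertness. If \<open>b\<close> is a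
  nonunit, the norm is \<open>a ^ 2\<close> plus a nonunit.\<close>

lemma nm_unit:
  assumes "a \<in> A" "b \<in> A" "a \<notin> nonunits A \<or> b \<notin> nonunits A"
  shows "nm a b \<notin> nonunits A"
proof (cases "b \<in> nonunits A")
  case False
  then have b: "b \<noteq> 0" "inverse b \<in> A" using unit_A assms by auto
  let ?c = "- a * inverse b"
  have c: "?c \<in> A" using assms b A_closed(4,5) by simp
  have "nm a b = b * (b * w ?c)" using b by (simp add: nm_def w_def field_simps power2_eq_square)
  moreover have "w ?c \<in> A" unfolding w_def by (intro A_closed(4,6,7) c h1_in h0_in)
  ultimately show ?thesis
    using inert[OF c] False nonunits_mult_iff[OF is_localD(1)[OF local_A]] assms A_closed(4) by metis
next
  case True
  then have a: "a \<notin> nonunits A" using assms by simp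
  have "a * a \<in> A" "a * a \<notin> nonunits A"
    using a nonunits_mult_iff[OF is_localD(1)[OF local_A]] assms A_closed by auto
  moreover have "b * (h0 * b - h1 * a) \<in> nonunits A"
    using nonunits_mult[OF is_localD(1)[OF local_A] True] assms h0_in h1_in A_closed by auto
  moreover have "nm a b = a * a + b * (h0 * b - h1 * a)" by (simp add: nm_def algebra_simps power2_eq_square)
  ultimately show ?thesis using unit_plus_nonunit(2)[OF local_A] by simp
qed

lemma mem_inert_ideal:
  assumes "a \<in> A" "b \<in> A"
  shows "elt a b \<in> (*) (to_ac p) ` S \<longleftrightarrow> a \<in> nonunits A \<and> b \<in> nonunits A"
proof -
  have e: "to_ac p * elt c d = elt (p * c) (p * d)" for c d by (simp add: elt_def algebra_simps)
  show ?thesis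
  proof
    assume "elt a b \<in> (*) (to_ac p) ` S"
    then obtain c d where "c \<in> A" "d \<in> A" "elt a b = to_ac p * elt c d" by (auto simp: S_def)
    then show "a \<in> nonunits A \<and> b \<in> nonunits A" using p_mult_nonunit unfolding e elt_eq_iff by blast
  next
    assume "a \<in> nonunits A \<and> b \<in> nonunits A"
    then obtain c d where "c \<in> A" "d \<in> A" "a = p * c" "b = p * d" unfolding nonunits_A by blast
    then show "elt a b \<in> (*) (to_ac p) ` S" using e[of c d] S_eltI[of c d] by (metis imageI)
  qed
qed

text \<open>Division by \<open>p\<close> lowers the valuation of the norm by 2. So two powers of
  \<open>p\<close> are removed from \<open>p ^ n\<close> at each stage, and neither can be missing
  because \<open>u\<close> is a unit.\<close>

lemma inert_factor:
  assumes "a \<in> A" "b \<in> A" "nm a b = p ^ n * u" "u \<in> A" "u \<notin> nonunits A"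
  shows "\<exists>k. \<exists>s\<in>S. elt a b = to_ac p ^ k * s \<and> s \<notin> (*) (to_ac p) ` S"
  using assms
proof (induction n arbitrary: a b rule: less_induct)
  case (less n)
  show ?case
  proof (cases "elt a b \<in> (*) (to_ac p) ` S")
    case True
    then obtain c d where cd: "c \<in> A" "d \<in> A" "elt a b = to_ac p * elt c d" by (auto simp: S_def)
    then have "elt a b = elt (p * c) (p * d)" by (simp add: elt_def algebra_simps)
    then have "nm a b = p ^ 2 * nm c d" unfolding elt_eq_iff by (simp add: nm_def algebra_simps power2_eq_square)
    then have e: "p ^ n * u = p * (p * nm c d)" using less.prems by (simp add: power2_eq_square mult.assoc)
    have "n \<noteq> 0"
    proof
      assume "n = 0"
      then have "u = p * (p * nm c d)" using e by simp
      moreover have "p * nm c d \<in> A" using A_closed(4) p_in nm_in[OF cd(1,2)] by simp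
      ultimately show False using less.prems(5) p_mult_nonunit by simp
    qed
    then obtain m where m: "n = Suc m" by (cases n) auto
    then have e2: "p ^ m * u = p * nm c d" using e p_nz by simp
    have "m \<noteq> 0"
    proof
      assume "m = 0"
      then have "u = p * nm c d" using e2 by simp
      then show False using less.prems(5) p_mult_nonunit nm_in[OF cd(1,2)] by simp
    qed
    then obtain l where l: "m = Suc l" by (cases m) auto
    then have "nm c d = p ^ l * u" using e2 p_nz by simp
    then obtain k s where "s \<in> S" "elt c d = to_ac p ^ k * s" "s \<notin> (*) (to_ac p) ` S"
      using less.IH[of l c d] m l cd less.prems by auto
    moreover from this have "elt a b = to_ac p ^ Suc k * s" by (simp add: cd(3) mult.assoc)
    ultimately show ?thesis by blast
  next
    case False
    then have "elt a b = to_ac p ^ 0 * elt a b \<and> elt a b \<notin> (*) (to_ac p) ` S" by simp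
    then show ?thesis using S_eltI less.prems by blast
  qed
qed

lemma principal_prime_inert: "principal_prime S (to_ac p)"
proof
  show "is_subring S" by (rule subring_S)
  show "to_ac p \<in> S" using const_in_S p_in by blast
  show "to_ac p \<noteq> 0" using p_nz by simp
  show "1 \<notin> (*) (to_ac p) ` S"
    using mem_inert_ideal[of 1 0] one_not_nonunit[OF is_localD(1)[OF local_A]] A_closed by (simp add: elt_one)
  show "\<exists>t\<in>S. s * t - 1 \<in> (*) (to_ac p) ` S" if s: "s \<in> S" "s \<notin> (*) (to_ac p) ` S" for s
  proof -
    obtain a b where ab: "s = elt a b" "a \<in> A" "b \<in> A" using s by (auto simp: S_def)
    \<comment> \<open>\<open>S\<close> is already local here: an element outside the ideal has unit
      norm and hence a true inverse in \<open>S\<close>, not only one modulo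
      \<open>p\<close>.\<close>
    then have "nm a b \<notin> nonunits A" using nm_unit[of a b] mem_inert_ideal[of a b] s by auto
    then have n: "nm a b \<noteq> 0" "inverse (nm a b) \<in> A" using unit_A nm_in ab by auto
    have s0: "s \<noteq> 0" using n nm_eq_0 elt_eq_0 ab by auto
    have "inverse s = elt ((a - h1 * b) * inverse (nm a b)) (- b * inverse (nm a b))"
      using elt_inverse s0 ab(1) by (simp add: divide_inverse)
    then have "inverse s \<in> S" using n ab h1_in A_closed by (auto intro!: S_eltI)
    moreover have "0 \<in> (*) (to_ac p) ` S" using principal_closed(1)[OF subring_S] .
    ultimately show ?thesis using s0 by (intro bexI[of _ "inverse s"]) auto
  qed
  show "\<exists>n. \<exists>u\<in>S. s = to_ac p ^ n * u \<and> u \<notin> (*) (to_ac p) ` S" if s: "s \<in> S" "s \<noteq> 0" for s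
  proof -
    obtain a b where ab: "s = elt a b" "a \<in> A" "b \<in> A" using s by (auto simp: S_def)
    then have "nm a b \<noteq> 0" using s elt_eq_0 nm_eq_0 by blast
    then obtain n u where "nm a b = p ^ n * u" "u \<in> A" "u \<notin> nonunits A"
      using A_power[OF nm_in[OF ab(2,3)]] by blast
    then show ?thesis using inert_factor[OF ab(2,3)] ab(1) by blast
  qed
qed

definition Vi where "Vi = loc S ((*) (to_ac p) ` S)"

lemma Vi_facts:
  shows "good Vi" "unif Vi 1" "card (residue_classes Vi) = card (residue_classes A) ^ 2"
    "\<And>R. is_local R \<Longrightarrow> S \<subseteq> R \<Longrightarrow> to_ac p \<in> nonunits R \<Longrightarrow> Vi \<subseteq> R"
proof -
  interpret pp: principal_prime S "to_ac p" by (rule principal_prime_inert)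
  have "to_ac p \<in> pp.I" using pp.S_closed(1) by force
  then show "good Vi" unfolding Vi_def by (rule good_loc[OF principal_prime_inert])
  show "unif Vi 1"
    unfolding Vi_def using pp.subring_V pp.S_subset pp.pi_in pp.pi_nz pp.nonunits_V pp.V_closed(1)
    by (intro unifI[of _ "to_ac p" 1 1]) auto
  show "Vi \<subseteq> R" if "is_local R" "S \<subseteq> R" "to_ac p \<in> nonunits R" for R
  proof -
    have "pp.I \<subseteq> nonunits R" using nonunits_mult[OF is_localD(1)[OF that(1)] that(3)] that(2) by auto
    then show ?thesis unfolding Vi_def by (rule pp.V_least[OF that(1,2)])
  qed
  obtain T where T: "T \<subseteq> A" "\<And>a. a \<in> A \<Longrightarrow> \<exists>t\<in>T. a - t \<in> nonunits A"
    "\<And>s t. s \<in> T \<Longrightarrow> t \<in> T \<Longrightarrow> s - t \<in> nonunits A \<Longrightarrow> s = t" "card T = card (residue_classes A)"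
    using residue_representatives[OF local_A] by blast
  \<comment> \<open>Modulo \<open>p\<close> the elements 1 and \<open>\<eta>\<close> stay
    independent, so pairs of representatives describe the quadratic residue extension.\<close>
  let ?T = "(\<lambda>(a, b). elt a b) ` (T \<times> T)"
  have "card (residue_classes Vi) = card ?T"
    unfolding Vi_def
  proof (rule pp.card_residue_classes_V)
    show "?T \<subseteq> S" using T(1) S_eltI by auto
    show "\<exists>t\<in>?T. s - t \<in> pp.I" if s: "s \<in> S" for s
    proof -
      obtain a b where ab: "s = elt a b" "a \<in> A" "b \<in> A" using s by (auto simp: S_def)
      obtain c d where cd: "c \<in> T" "d \<in> T" "a - c \<in> nonunits A" "b - d \<in> nonunits A" using T(2) ab by meson
      have "s - elt c d \<in> pp.I"
        using mem_inert_ideal[of "a - c" "b - d"] cd ab T(1) A_closed(3) by (auto simp: elt_diff)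
      then show ?thesis using cd by auto
    qed
    show "s = t" if st: "s \<in> ?T" "t \<in> ?T" "s - t \<in> pp.I" for s t
    proof -
      obtain a b c d where ab: "s = elt a b" "t = elt c d" "a \<in> T" "b \<in> T" "c \<in> T" "d \<in> T" using st by auto
      then have "a - c \<in> nonunits A \<and> b - d \<in> nonunits A"
        using mem_inert_ideal[of "a - c" "b - d"] st(3) T(1) A_closed(3) by (auto simp: elt_diff)
      then show ?thesis using T(3) ab by blast
    qed
  qed
  also have "\<dots> = card (T \<times> T)" by (rule card_image) (auto simp: inj_on_def elt_eq_iff)
  finally show "card (residue_classes Vi) = card (residue_classes A) ^ 2"
    using T(4) by (simp add: card_cartesian_product power2_eq_square)
qed

end

text \<open>Completeness of a list of local rings: whatever dominates \<open>A\<close> and contains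
  \<open>S\<close> contains a member. Together with maximality of the members it identifies all good
  rings.\<close>

definition dominating where "dominating Vs \<longleftrightarrow> (\<forall>R. is_local R \<longrightarrow> S \<subseteq> R \<longrightarrow> to_ac p \<in> nonunits R \<longrightarrow> (\<exists>V\<in>Vs. V \<subseteq> R))"

theorem inert_case:
  assumes "\<And>g. g \<in> A \<Longrightarrow> w g \<notin> nonunits A"
  shows "\<exists>V. dominating {V} \<and> good V \<and> unif V 1 \<and> card (residue_classes V) = card (residue_classes A) ^ 2"
proof (intro exI conjI)
  show "dominating {Vi}" unfolding dominating_def using Vi_facts(4)[OF assms] by simp
qed (use Vi_facts(1-3)[OF assms] in auto)

text \<open>The substitution of \<open>- h1 - g\<close> for \<open>g\<close> comes from conjugation:
  it preserves the value of \<open>w\<close> and exchanges the two factors of \<open>p\<close>, so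
  facts about one root transfer to the other.\<close>

lemma other_root:
  assumes g: "g \<in> A" "w g = p * u0"
  shows "- h1 - g \<in> A" "w (- h1 - g) = p * u0" "2 * (- h1 - g) + h1 = - (2 * g + h1)"
    "elt (- (- h1 - g)) 1 = elt (g + h1) 1" "elt ((- h1 - g) + h1) 1 = elt (- g) 1"
  using g A_closed h1_in by (auto simp: w_def power2_eq_square algebra_simps)

theorem split_case:
  assumes g: "g \<in> A" "w g \<in> nonunits A" "2 * g + h1 \<notin> nonunits A"
  shows "\<exists>V V'. V \<noteq> V' \<and> dominating {V, V'} \<and> (\<forall>W\<in>{V, V'}. good W \<and> unif W 1 \<and> card (residue_classes W) = card (residue_classes A))"
proof -
  obtain f u0 where f: "f \<in> A" "w f = p * u0" "u0 \<in> A" "u0 \<notin> nonunits A" "f - g \<in> nonunits A"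
    using exists_simple_root[OF g(1,2)] .
  \<comment> \<open>Passing to a simple root \<open>f\<close> congruent to \<open>g\<close> changes
    the derivative \<open>2 * g + h1\<close> only by a nonunit.\<close>
  have "2 * (f - g) \<in> nonunits A" unfolding mult_2 by (rule is_localD(2)[OF local_A f(5) f(5)])
  moreover have "2 * f + h1 = (2 * g + h1) + 2 * (f - g)" by (simp add: algebra_simps)
  moreover have "2 * g + h1 \<in> A" unfolding mult_2 by (intro A_closed(6) g(1) h1_in)
  ultimately have r: "2 * f + h1 \<notin> nonunits A" using unit_plus_nonunit(2)[OF local_A] g(3) by metis
  define f' where "f' = - h1 - f"
  note o = other_root[OF f(1,2), folded f'_def]
  have r': "2 * f' + h1 \<notin> nonunits A"
    using r nonunits_uminus[OF is_localD(1)[OF local_A], of "- (2 * f + h1)"] unfolding o(3) by (simp only: minus_minus) blast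
  \<comment> \<open>The element \<open>\<eta> + f + h1\<close> is a unit in the first ring and a
    nonunit in the second.\<close>
  have "Vr f \<noteq> Vr f'"
    using Vr_unramified(2)[OF f(1-4) r] Vr_nonunit[OF o(1,2) f(3,4)] unfolding o(4) by auto
  moreover have "dominating {Vr f, Vr f'}"
    unfolding dominating_def
  proof (intro allI impI)
    fix R assume R: "is_local R" "S \<subseteq> R" "to_ac p \<in> nonunits R"
    have "Vr f \<subseteq> R \<or> Vr f' \<subseteq> R"
      using nonunit_factor[OF f(1-4) R] Vr_least[OF f(1-4) R(1,2)] Vr_least[OF o(1,2) f(3,4) R(1,2)]
      unfolding o(4) by blast
    then show "\<exists>V\<in>{Vr f, Vr f'}. V \<subseteq> R" by blast
  qed
  ultimately show ?thesis
    using good_Vr[OF f(1-4)] good_Vr[OF o(1,2) f(3,4)] Vr_unramified(1)[OF f(1-4) r] Vr_unramified(1)[OF o(1,2) f(3,4) r']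
      card_residue_Vr[OF f(1-4)] card_residue_Vr[OF o(1,2) f(3,4)] by blast
qed

theorem ramified_case:
  assumes g: "g \<in> A" "w g \<in> nonunits A" "2 * g + h1 \<in> nonunits A"
  shows "\<exists>V. dominating {V} \<and> good V \<and> unif V 2 \<and> card (residue_classes V) = card (residue_classes A)"
proof -
  obtain f u0 where f: "f \<in> A" "w f = p * u0" "u0 \<in> A" "u0 \<notin> nonunits A" "f - g \<in> nonunits A"
    using exists_simple_root[OF g(1,2)] .
  have "2 * (f - g) \<in> nonunits A" unfolding mult_2 by (rule is_localD(2)[OF local_A f(5) f(5)])
  moreover have "2 * f + h1 = (2 * g + h1) + 2 * (f - g)" by (simp add: algebra_simps)
  ultimately have r: "2 * f + h1 \<in> nonunits A" using is_localD(2)[OF local_A g(3)] by metis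
  obtain s where s: "s \<in> S" "elt (f + h1) 1 = elt (- f) 1 * s" "s \<notin> nonunits S"
    using unif_Vr_ramified(2)[OF f(1-4) r] by blast
  have "dominating {Vr f}"
    unfolding dominating_def
  proof (intro allI impI)
    fix R assume R: "is_local R" "S \<subseteq> R" "to_ac p \<in> nonunits R"
    note Rs = is_localD(1)[OF R(1)]
    \<comment> \<open>A unit of \<open>S\<close> stays a unit in \<open>R\<close>. The two factors
      of \<open>p\<close> are therefore associated in \<open>R\<close>, and whichever is a nonunit,
      \<open>\<eta> - f\<close> is one.\<close>
    have "s \<notin> nonunits R" "s \<in> R" "elt (- f) 1 \<in> R"
      using s R(2) S_eltI[of "- f" 1] f(1) A_closed by (auto simp: nonunits_def)
    then have "elt (- f) 1 \<in> nonunits R"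
      using nonunit_factor[OF f(1-4) R] nonunits_mult_iff[OF Rs] unfolding s(2) by blast
    then show "\<exists>V\<in>{Vr f}. V \<subseteq> R" using Vr_least[OF f(1-4) R(1,2)] by blast
  qed
  then show ?thesis
    using good_Vr[OF f(1-4)] unif_Vr_ramified(1)[OF f(1-4) r] card_residue_Vr[OF f(1-4)] by blast
qed

end

section \<open>Smoothness of Weierstrass curves\<close>

text \<open>The Weierstrass equation reads \<open>y\<^sup>2 + c1 y + c0 = 0\<close>.\<close>

definition c1_poly :: "'a::field weierstrass \<Rightarrow> 'a poly" where
  "c1_poly W = [:a\<^sub>3 W, a\<^sub>1 W:]"

definition c0_poly :: "'a::field weierstrass \<Rightarrow> 'a poly" where
  "c0_poly W = - [:a\<^sub>6 W, a\<^sub>4 W, a\<^sub>2 W, 1:]"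

text \<open>The discriminant in terms of the invariants \<open>b\<^sub>2, b\<^sub>4, b\<^sub>6, b\<^sub>8\<close>, whose behaviour under
  \<open>x \<mapsto> x + r\<close> is as in \<open>disc_translate\<close>.\<close>

definition disc :: "'r::comm_ring_1 \<Rightarrow> 'r \<Rightarrow> 'r \<Rightarrow> 'r \<Rightarrow> 'r" where
  "disc b2 b4 b6 b8 = - (b2 ^ 2 * b8) - 8 * b4 ^ 3 - 27 * b6 ^ 2 + 9 * b2 * b4 * b6"

lemma dvd_disc: "p dvd b4 \<Longrightarrow> p dvd b6 \<Longrightarrow> p dvd b8 \<Longrightarrow> p dvd disc b2 b4 b6 b8"
  unfolding disc_def power2_eq_square power3_eq_cube
  by (intro dvd_diff dvd_add) (auto intro: dvd_mult dvd_mult2)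

text \<open>The two sides differ by a multiple of the relation assumed between the
  \<open>b\<close>-invariants, with cofactor \<open>6 r b2 + 36 r ^ 2\<close>. No division occurs,
  so characteristics 2 and 3 are covered.\<close>

lemma disc_translate:
  fixes r :: "'r::comm_ring_1"
  assumes "4 * b8 = b2 * b6 - b4 ^ 2"
  shows "disc (b2 + 12 * r) (b4 + r * b2 + 6 * r ^ 2) (b6 + 2 * r * b4 + r ^ 2 * b2 + 4 * r ^ 3)
      (b8 + 3 * r * b6 + 3 * r ^ 2 * b4 + r ^ 3 * b2 + 3 * r ^ 4) = disc b2 b4 b6 b8"
proof -
  have "disc (b2 + 12 * r) (b4 + r * b2 + 6 * r ^ 2) (b6 + 2 * r * b4 + r ^ 2 * b2 + 4 * r ^ 3)
      (b8 + 3 * r * b6 + 3 * r ^ 2 * b4 + r ^ 3 * b2 + 3 * r ^ 4) =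
      disc b2 b4 b6 b8 - (6 * r * b2 + 36 * r ^ 2) * (4 * b8 - (b2 * b6 - b4 ^ 2))"
    unfolding disc_def by (simp add: power2_eq_square power3_eq_cube power4_eq_xxxx algebra_simps)
  then show ?thesis using assms by simp
qed

text \<open>Moving a singular point to the origin gives a Weierstrass equation with the same discriminant,
  in which \<open>a\<^sub>3\<close>, \<open>a\<^sub>4\<close> and \<open>a\<^sub>6\<close> vanish.\<close>

lemma dvd_discriminant:
  fixes p g :: "'a::field poly"
  assumes "p dvd 2 * g + c1_poly W" "p ^ 2 dvd g ^ 2 + c1_poly W * g + c0_poly W"
  shows "p dvd [:discriminant W:]"
proof -
  \<comment> \<open>Translating by the variable itself: modulo \<open>p\<close> it becomes a root of
    \<open>p\<close>, so \<open>(r, g)\<close> is the singular point and no residue field has to be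
    constructed.\<close>
  define r :: "'a poly" where "r = [:0, 1:]"
  define A1 where "A1 = [:a\<^sub>1 W:]"
  define A2 where "A2 = [:a\<^sub>2 W:]"
  define A3 where "A3 = [:a\<^sub>3 W:]"
  define A4 where "A4 = [:a\<^sub>4 W:]"
  define A6 where "A6 = [:a\<^sub>6 W:]"
  note defs = A1_def A2_def A3_def A4_def A6_def
  have c1: "c1_poly W = A3 + A1 * r" by (simp add: c1_poly_def r_def defs)
  have c0: "c0_poly W = - (A6 + A4 * r + A2 * r ^ 2 + r ^ 3)"
    by (simp add: c0_poly_def r_def defs power2_eq_square power3_eq_cube)
  define b2 where "b2 = A1 ^ 2 + 4 * A2"
  define b4 where "b4 = 2 * A4 + A1 * A3"
  define b6 where "b6 = A3 ^ 2 + 4 * A6"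
  define b8 where "b8 = A1 ^ 2 * A6 + 4 * A2 * A6 - A1 * A3 * A4 + A2 * A3 ^ 2 - A4 ^ 2"
  have "disc b2 b4 b6 b8 = [:discriminant W:]"
  proof -
    have "b2 = [:a\<^sub>1 W ^ 2 + 4 * a\<^sub>2 W:]" "b4 = [:2 * a\<^sub>4 W + a\<^sub>1 W * a\<^sub>3 W:]" "b6 = [:a\<^sub>3 W ^ 2 + 4 * a\<^sub>6 W:]"
      "b8 = [:a\<^sub>1 W ^ 2 * a\<^sub>6 W + 4 * a\<^sub>2 W * a\<^sub>6 W - a\<^sub>1 W * a\<^sub>3 W * a\<^sub>4 W + a\<^sub>2 W * a\<^sub>3 W ^ 2 - a\<^sub>4 W ^ 2:]"
      by (simp_all add: b2_def b4_def b6_def b8_def defs power2_eq_square numeral_poly mult_ac)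
    moreover have "disc [:x:] [:y:] [:z:] [:v:] = [:disc x y z v:]" for x y z v :: 'a
      by (simp add: disc_def power2_eq_square power3_eq_cube numeral_poly mult_ac)
    ultimately show ?thesis by (simp only: disc_def discriminant_def Let_def)
  qed
  \<comment> \<open>The coefficients after the substitution of \<open>x + r\<close> for
    \<open>x\<close> and \<open>y + g\<close> for \<open>y\<close>; the coefficient of
    \<open>x y\<close> remains \<open>A1\<close>.\<close>
  define B2 where "B2 = A2 + 3 * r"
  define B3 where "B3 = A3 + r * A1 + 2 * g"
  define B4 where "B4 = A4 + 2 * r * A2 - g * A1 + 3 * r ^ 2"
  define B6 where "B6 = A6 + r * A4 + r ^ 2 * A2 + r ^ 3 - g * A3 - g ^ 2 - r * g * A1"
  have w: "g ^ 2 + c1_poly W * g + c0_poly W = - B6"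
    unfolding c1 c0 B6_def by (simp add: algebra_simps)
  have d3: "p dvd B3" using assms(1) unfolding c1 B3_def by (simp add: algebra_simps)
  obtain k where k: "B6 = p ^ 2 * k" using assms(2) unfolding w dvd_minus_iff by blast
  then have d6: "p dvd B6" by (simp add: power2_eq_square mult.assoc)
  \<comment> \<open>Divisibility of \<open>B6\<close> by \<open>p ^ 2\<close> makes its derivative
    divisible by \<open>p\<close>. By the product rule this derivative is \<open>B4\<close> minus a
    multiple of \<open>B3\<close>, which yields divisibility of \<open>B4\<close>.\<close>
  have "pderiv B6 = p * (2 * pderiv p * k + p * pderiv k)"
    unfolding k by (simp add: pderiv_mult power2_eq_square algebra_simps)
  moreover have "pderiv B6 = B4 - pderiv g * B3"
    unfolding B6_def B4_def B3_def defs r_def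
    by (simp add: pderiv_add pderiv_diff pderiv_mult pderiv_smult pderiv_pCons power2_eq_square power3_eq_cube algebra_simps numeral_poly)
  ultimately have "B4 = p * (2 * pderiv p * k + p * pderiv k) + pderiv g * B3" by (simp add: algebra_simps)
  then have d4: "p dvd B4" using d3 by simp
  have "b8 * 4 = b2 * b6 - b4 ^ 2"
    unfolding b2_def b4_def b6_def b8_def by (simp add: power2_eq_square algebra_simps)
  then have "disc b2 b4 b6 b8 = disc (b2 + 12 * r) (b4 + r * b2 + 6 * r ^ 2) (b6 + 2 * r * b4 + r ^ 2 * b2 + 4 * r ^ 3)
      (b8 + 3 * r * b6 + 3 * r ^ 2 * b4 + r ^ 3 * b2 + 3 * r ^ 4)" using disc_translate by (metis mult.commute)
  also have "b4 + r * b2 + 6 * r ^ 2 = 2 * B4 + A1 * B3"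
    unfolding b2_def b4_def B4_def B3_def by (simp add: power2_eq_square power3_eq_cube power4_eq_xxxx algebra_simps)
  also have "b6 + 2 * r * b4 + r ^ 2 * b2 + 4 * r ^ 3 = B3 ^ 2 + 4 * B6"
    unfolding b2_def b4_def b6_def B3_def B6_def by (simp add: power2_eq_square power3_eq_cube power4_eq_xxxx algebra_simps)
  also have "b8 + 3 * r * b6 + 3 * r ^ 2 * b4 + r ^ 3 * b2 + 3 * r ^ 4 =
      A1 ^ 2 * B6 + 4 * B2 * B6 - A1 * B3 * B4 + B2 * B3 ^ 2 - B4 ^ 2"
    unfolding b2_def b4_def b6_def b8_def B2_def B3_def B4_def B6_def by (simp add: power2_eq_square power3_eq_cube power4_eq_xxxx algebra_simps)
  finally have e: "disc b2 b4 b6 b8 = disc (b2 + 12 * r) (2 * B4 + A1 * B3) (B3 ^ 2 + 4 * B6)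
     (A1 ^ 2 * B6 + 4 * B2 * B6 - A1 * B3 * B4 + B2 * B3 ^ 2 - B4 ^ 2)" .
  have 4: "p dvd 2 * B4 + A1 * B3" using d3 d4 by simp
  have 6: "p dvd B3 ^ 2 + 4 * B6" using d3 d6 by (simp add: power2_eq_square)
  have 8: "p dvd A1 ^ 2 * B6 + 4 * B2 * B6 - A1 * B3 * B4 + B2 * B3 ^ 2 - B4 ^ 2"
    using d3 d4 d6 by (intro dvd_diff dvd_add) (auto simp: power2_eq_square)
  have "p dvd disc b2 b4 b6 b8"
    unfolding e by (rule dvd_disc[OF 4 6 8])
  then show ?thesis using \<open>disc b2 b4 b6 b8 = [:discriminant W:]\<close> by simp
qed

section \<open>The local rings of a Weierstrass curve\<close>

definition c1 :: "'a::field weierstrass \<Rightarrow> 'a poly fract" where "c1 W = to_fract (c1_poly W)"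
definition c0 :: "'a::field weierstrass \<Rightarrow> 'a poly fract" where "c0 W = to_fract (c0_poly W)"

text \<open>Either root serves, as everything later rests on the equation alone.\<close>

definition ycoord :: "'a::field weierstrass \<Rightarrow> 'a poly fract alg_closure" where
  "ycoord W = (SOME y. y ^ 2 + to_ac (c1 W) * y + to_ac (c0 W) = 0)"

lemma ycoord_root: "ycoord W ^ 2 + to_ac (c1 W) * ycoord W + to_ac (c0 W) = 0"
proof -
  have "\<exists>y. poly [:to_ac (c0 W), to_ac (c1 W), 1:] y = 0"
    by (rule alg_closed_imp_poly_has_root) simp
  then have "\<exists>y. y ^ 2 + to_ac (c1 W) * y + to_ac (c0 W) = 0"
    by (auto simp: power2_eq_square algebra_simps)
  then show ?thesis unfolding ycoord_def by (rule someI_ex)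
qed

lemma degree_c0_poly: "degree (c0_poly W) = 3"
  by (simp add: c0_poly_def)

lemma degree_c1_poly: "degree (c1_poly W) \<le> 1"
  by (simp add: c1_poly_def)

text \<open>Parity of degrees. With \<open>f = u / v\<close>, the term \<open>c0 * v ^ 2\<close> has
  the odd degree \<open>3 + 2 deg v\<close>. If \<open>deg u\<close> is at least
  \<open>deg v + 2\<close>, the remaining terms have the even degree \<open>2 deg u\<close>;
  otherwise their degree is at most \<open>2 deg v + 2\<close>.\<close>

lemma weierstrass_no_root: "f ^ 2 + c1 W * f + c0 W \<noteq> 0"
proof
  assume f: "f ^ 2 + c1 W * f + c0 W = 0"
  obtain u v where uv: "f = to_fract u / to_fract v" "v \<noteq> 0" by (rule fract_cases)
  have "to_fract (u ^ 2 + c1_poly W * u * v + c0_poly W * v ^ 2) = to_fract v ^ 2 * (f ^ 2 + c1 W * f + c0 W)"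
    using uv(2) by (simp add: uv(1) c1_def c0_def power2_eq_square field_simps)
  then have "u ^ 2 + c1_poly W * u * v + c0_poly W * v ^ 2 = 0"
    unfolding f mult_zero_right to_fract_eq_0_iff .
  then have e: "u ^ 2 + c1_poly W * u * v = - (c0_poly W * v ^ 2)" by (simp add: add_eq_0_iff)
  have "c0_poly W \<noteq> 0" using degree_c0_poly[of W] by auto
  then have d: "degree (u ^ 2 + c1_poly W * u * v) = 3 + 2 * degree v"
    unfolding e using uv(2) degree_c0_poly[of W] by (simp add: degree_mult_eq degree_power_eq)
  have m: "degree (c1_poly W * u * v) \<le> 1 + degree u + degree v"
    using degree_mult_le[of "c1_poly W * u" v] degree_mult_le[of "c1_poly W" u] degree_c1_poly[of W] by linarith
  have s: "degree (u ^ 2) = 2 * degree u" by (cases "u = 0") (auto simp: degree_power_eq)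
  show False
  proof (cases "degree u \<ge> degree v + 2")
    case True
    then have "degree (u ^ 2 + c1_poly W * u * v) = degree (u ^ 2)"
      using m s by (intro degree_add_eq_left) linarith
    then show False using d s by presburger
  next
    case False
    then have "degree (u ^ 2 + c1_poly W * u * v) \<le> 2 * degree v + 2"
      using m s by (intro degree_add_le) linarith+
    then show False using d by simp
  qed
qed

lemma quadratic_extension_finite:
  assumes W: "elliptic W" and p: "irreducible p"
  shows "quadratic_extension (place p) (to_fract p) (c1 W) (c0 W) (ycoord W)"
proof -
  interpret pp: principal_prime poly_fracts "to_fract p" by (rule principal_prime_poly[OF p])
  have V: "place p = pp.V" by (simp add: place_def)
  \<comment> \<open>Divisibility by \<open>p\<close> in the local ring descends to the polynomial
    ring, with the same quotient.\<close>
  have dvd1: "p dvd s \<and> (\<exists>s'. s = p * s' \<and> to_fract s' = a)" if "to_fract s = to_fract p * a" "a \<in> pp.V" for s a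
  proof -
    have "to_fract s \<in> nonunits pp.V" unfolding pp.nonunits_V using that by blast
    then have "p dvd s" using place_poly_nonunits(1)[OF p] V by simp
    then obtain s' where "s = p * s'" by blast
    moreover from this have "to_fract p * to_fract s' = to_fract p * a" using that by simp
    then have "to_fract s' = a" using pp.pi_nz by simp
    ultimately show ?thesis by auto
  qed
  show ?thesis
  proof
    show "is_local (place p)" unfolding V by (rule pp.local_V)
    show "to_fract p \<in> place p" "to_fract p \<noteq> 0" using place_poly_nonunits(2)[OF p] pp.pi_nz by auto
    show "nonunits (place p) = (*) (to_fract p) ` place p" unfolding V by (rule pp.nonunits_V)
    show "\<exists>n u. u \<in> place p \<and> inverse u \<in> place p \<and> (f = to_fract p ^ n * u \<or> to_fract p ^ n * f = u)" if "f \<noteq> 0" for f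
      unfolding V using pp.fractions_power[of f] that fractions_poly by auto
    show "c1 W \<in> place p" "c0 W \<in> place p" unfolding c1_def c0_def by (rule place_poly_nonunits(2)[OF p])+
    show "ycoord W ^ 2 + to_ac (c1 W) * ycoord W + to_ac (c0 W) = 0" by (rule ycoord_root)
    show "f ^ 2 + c1 W * f + c0 W \<noteq> 0" for f by (rule weierstrass_no_root)
    show "g ^ 2 + c1 W * g + c0 W \<notin> (*) (to_fract p ^ 2) ` place p"
      if g: "g \<in> place p" "2 * g + c1 W \<in> nonunits (place p)" for g
    proof
      assume "g ^ 2 + c1 W * g + c0 W \<in> (*) (to_fract p ^ 2) ` place p"
      then obtain a where a: "a \<in> pp.V" "g ^ 2 + c1 W * g + c0 W = to_fract p ^ 2 * a" unfolding V by blast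
      \<comment> \<open>\<open>dvd_discriminant\<close> concerns polynomials, so \<open>g\<close> is
        replaced by a polynomial congruent to it modulo \<open>p\<close>.\<close>
      obtain g0 where "g - to_fract g0 \<in> nonunits pp.V"
        using pp.residue_in_S[of g] g(1) unfolding V poly_fracts_def by blast
      then obtain b where b: "b \<in> pp.V" "g - to_fract g0 = to_fract p * b" unfolding pp.nonunits_V by blast
      obtain c where c: "c \<in> pp.V" "2 * g + c1 W = to_fract p * c" using g(2) unfolding V pp.nonunits_V by blast
      have g0: "to_fract g0 = g - to_fract p * b" using b(2) by (simp add: algebra_simps)
      have "to_fract (2 * g0 + c1_poly W) = to_fract p * (c - 2 * b)"
      proof -
        have "to_fract (2 :: 'a poly) = 2" using to_fract_add[of "1 :: 'a poly" 1] by simp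
        then have "to_fract (2 * g0 + c1_poly W) = (2 * g + c1 W) - to_fract p * (2 * b)"
          by (simp add: g0 c1_def algebra_simps)
        then show ?thesis unfolding c(2) by (simp add: algebra_simps)
      qed
      moreover have "c - 2 * b \<in> pp.V" unfolding mult_2 using pp.V_closed(3,6) b c by blast
      ultimately have 1: "p dvd 2 * g0 + c1_poly W" using dvd1 by blast
      \<comment> \<open>Second-order expansion at \<open>g\<close>: the linear term contains
        \<open>p\<close> twice, once from \<open>g - g0\<close> and once from the derivative, so
        divisibility by \<open>p ^ 2\<close> survives the change to \<open>g0\<close>.\<close>
      have "to_fract (g0 ^ 2 + c1_poly W * g0 + c0_poly W) = (g ^ 2 + c1 W * g + c0 W) - to_fract p * b * (2 * g + c1 W) + (to_fract p * b) ^ 2"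
        unfolding power2_eq_square by (simp add: g0 c1_def c0_def algebra_simps)
      also have "\<dots> = to_fract p * (to_fract p * (a - b * c + b ^ 2))"
        unfolding a(2) c(2) by (simp add: algebra_simps power2_eq_square)
      finally have e: "to_fract (g0 ^ 2 + c1_poly W * g0 + c0_poly W) = to_fract p * (to_fract p * (a - b * c + b ^ 2))" .
      have m: "a - b * c + b ^ 2 \<in> pp.V" using pp.V_closed(3,4,6,7) a b c by simp
      have "to_fract p * (a - b * c + b ^ 2) \<in> pp.V" using pp.V_closed(4) m pp.pi_in pp.S_subset by blast
      then obtain s where s: "g0 ^ 2 + c1_poly W * g0 + c0_poly W = p * s" "to_fract s = to_fract p * (a - b * c + b ^ 2)"
        using dvd1[OF e] by blast
      have "p dvd s" using dvd1[OF s(2) m] by blast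
      then have "p ^ 2 dvd g0 ^ 2 + c1_poly W * g0 + c0_poly W" unfolding s(1) by (auto simp: power2_eq_square)
      then have "p dvd [:discriminant W:]" using dvd_discriminant 1 by blast
      moreover have "[:discriminant W:] dvd 1" using W by (simp add: elliptic_def is_unit_iff_degree)
      ultimately have "p dvd 1" by (rule dvd_trans)
      then show False using p by (simp add: irreducible_def)
    qed
  qed
qed


text \<open>These are the coefficients of the equation for \<open>y/x ^ 2\<close>; they vanish at
  infinity because the degrees 1 and 3 are below 2 and 4.\<close>

lemma coeffs_nonunit_inf:
  "c1 W / var_fract ^ 2 \<in> nonunits place_inf" "c0 W / var_fract ^ 4 \<in> nonunits place_inf"
proof -
  interpret pp: principal_prime inf_fracts "inverse var_fract :: 'a poly fract" by (rule principal_prime_inf)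
  show "c1 W / var_fract ^ 2 \<in> nonunits place_inf"
    unfolding c1_def place_inf_def
    using degree_c1_poly[of W] mem_principal_inf[of "c1_poly W" 2] pp.N_nonunits by (auto simp: coeff_eq_0)
  show "c0 W / var_fract ^ 4 \<in> nonunits place_inf"
    unfolding c0_def place_inf_def
    using degree_c0_poly[of W] mem_principal_inf[of "c0_poly W" 4] pp.N_nonunits by (auto simp: coeff_eq_0)
qed

text \<open>The constant coefficient has valuation exactly 1 at infinity, since
  \<open>c0_poly W\<close> has degree 3 and the denominator is the fourth power of \<open>t\<close>.
  The equation is thus of Eisenstein type, which gives smoothness without the discriminant.\<close>

lemma quadratic_extension_infinite:
  fixes W :: "'a::field weierstrass"
  shows "quadratic_extension place_inf (inverse var_fract) (c1 W / var_fract ^ 2) (c0 W / var_fract ^ 4)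
    (ycoord W / to_ac (var_fract ^ 2))"
proof -
  interpret pp: principal_prime inf_fracts "inverse var_fract :: 'a poly fract" by (rule principal_prime_inf)
  have V: "(place_inf :: 'a poly fract set) = pp.V" by (simp add: place_inf_def)
  let ?h1 = "c1 W / var_fract ^ 2" and ?h0 = "c0 W / var_fract ^ 4"
  \<comment> \<open>The unit part of the constant coefficient; its value at infinity is -1.\<close>
  define v where "v = to_fract (c0_poly W) / var_fract ^ 3"
  have v: "v \<in> inf_fracts" "v \<notin> pp.I"
    unfolding v_def using inf_fractsI[of "c0_poly W" 3] mem_principal_inf[of "c0_poly W" 3] degree_c0_poly[of W]
    by (auto simp: c0_poly_def numeral_3_eq_3)
  have h0: "?h0 = inverse var_fract * v" by (simp add: c0_def v_def field_simps power_numeral_reduce)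
  have vu: "v \<in> pp.V" "v \<notin> nonunits pp.V" using v pp.S_subset pp.S_unit by auto
  have h1n: "?h1 \<in> nonunits pp.V" and h0n: "?h0 \<in> nonunits pp.V"
    using coeffs_nonunit_inf[of W] unfolding V by auto
  show ?thesis
  proof
    show "is_local (place_inf :: 'a poly fract set)" unfolding V by (rule pp.local_V)
    show "inverse var_fract \<in> (place_inf :: 'a poly fract set)" "inverse (var_fract :: 'a poly fract) \<noteq> 0" unfolding V using pp.pi_in pp.S_subset pp.pi_nz by auto
    show "nonunits place_inf = (*) (inverse (var_fract :: 'a poly fract)) ` place_inf" unfolding V by (rule pp.nonunits_V)
    show "\<exists>n u. u \<in> place_inf \<and> inverse u \<in> place_inf \<and> (f = inverse var_fract ^ n * u \<or> inverse var_fract ^ n * f = u)"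
      if "f \<noteq> 0" for f :: "'a poly fract"
      unfolding V using pp.fractions_power[of f] that fractions_inf by auto
    show "?h1 \<in> place_inf" "?h0 \<in> place_inf" unfolding V using h1n h0n nonunits_subset by blast+
    let ?T = "to_ac (var_fract ^ 2)"
    have "(ycoord W / ?T) ^ 2 + to_ac ?h1 * (ycoord W / ?T) + to_ac ?h0 =
        (ycoord W ^ 2 + to_ac (c1 W) * ycoord W + to_ac (c0 W)) / ?T ^ 2"
      by (simp add: field_simps power2_eq_square power4_eq_xxxx)
    then show "(ycoord W / ?T) ^ 2 + to_ac ?h1 * (ycoord W / ?T) + to_ac ?h0 = 0" unfolding ycoord_root by simp
    show "f ^ 2 + ?h1 * f + ?h0 \<noteq> 0" for f
    proof
      assume f: "f ^ 2 + ?h1 * f + ?h0 = 0"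
      have "(f * var_fract ^ 2) ^ 2 + c1 W * (f * var_fract ^ 2) + c0 W = var_fract ^ 4 * (f ^ 2 + ?h1 * f + ?h0)"
        by (simp add: field_simps power2_eq_square power4_eq_xxxx)
      then show False unfolding f using weierstrass_no_root[of "f * var_fract ^ 2" W] by simp
    qed
    show "g ^ 2 + ?h1 * g + ?h0 \<notin> (*) (inverse var_fract ^ 2) ` place_inf" if g: "g \<in> place_inf" for g
    proof
      assume "g ^ 2 + ?h1 * g + ?h0 \<in> (*) (inverse var_fract ^ 2) ` place_inf"
      then obtain a where a: "a \<in> pp.V" "g ^ 2 + ?h1 * g + ?h0 = inverse var_fract * (inverse var_fract * a)"
        unfolding V by (auto simp: power2_eq_square mult.assoc)
      have gV: "g \<in> pp.V" using g V by simp
      have pi: "inverse var_fract \<in> pp.V" "inverse var_fract \<in> nonunits pp.V"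
        using pp.pi_in pp.S_subset inverse_var_nonunit_place_inf V by auto
      have 1: "inverse var_fract * (inverse var_fract * a) \<in> nonunits pp.V"
        unfolding pp.nonunits_V using pp.V_closed(4)[OF pi(1) a(1)] by blast
      have "?h1 * g \<in> nonunits pp.V" using nonunits_mult[OF pp.subring_V h1n gV] .
      then have "inverse var_fract * (inverse var_fract * a) - ?h1 * g - ?h0 \<in> nonunits pp.V"
        using nonunits_diff[OF pp.local_V] 1 h0n by blast
      moreover have "g * g = inverse var_fract * (inverse var_fract * a) - ?h1 * g - ?h0"
        unfolding a(2)[symmetric] by (simp add: power2_eq_square)
      ultimately have "g * g \<in> nonunits pp.V" by simp
      \<comment> \<open>Once \<open>g\<close> is divisible by the uniformizer, so are both other
        terms twice, and the constant coefficient would have valuation at least 2.\<close>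
      then have "g \<in> nonunits pp.V" using nonunits_mult_iff[OF pp.subring_V gV gV] by blast
      then obtain b where b: "b \<in> pp.V" "g = inverse var_fract * b" unfolding pp.nonunits_V by blast
      obtain c where c: "c \<in> pp.V" "?h1 = inverse var_fract * c" using h1n unfolding pp.nonunits_V by blast
      have "inverse var_fract * v = inverse var_fract * (inverse var_fract * (a - b * b - c * b))"
        unfolding h0[symmetric]
      proof -
        have "?h0 = inverse var_fract * (inverse var_fract * a) - ?h1 * g - g ^ 2" unfolding a(2)[symmetric] by simp
        also have "\<dots> = inverse var_fract * (inverse var_fract * (a - b * b - c * b))"
          unfolding c(2) b(2) by (simp add: algebra_simps power2_eq_square)
        finally show "?h0 = inverse var_fract * (inverse var_fract * (a - b * b - c * b))" .
      qed
      then have "v = inverse var_fract * (a - b * b - c * b)" using pp.pi_nz by simp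
      moreover have "a - b * b - c * b \<in> pp.V" using pp.V_closed(3,4) a(1) b(1) c(1) by simp
      ultimately have "v \<in> nonunits pp.V" unfolding pp.nonunits_V by blast
      then show False using vu(2) by simp
    qed
  qed
qed

section \<open>Ramified, split and inert families of local rings\<close>

abbreviation uniformizes where "uniformizes \<equiv> quadratic_extension.unif"

definition ramified_set :: "'b::field set \<Rightarrow> 'b alg_closure set set \<Rightarrow> bool" where
  "ramified_set A Vs \<longleftrightarrow> (\<exists>V. Vs = {V} \<and> uniformizes A V 2 \<and> card (residue_classes V) = card (residue_classes A))"

definition split_set :: "'b::field set \<Rightarrow> 'b alg_closure set set \<Rightarrow> bool" where
  "split_set A Vs \<longleftrightarrow> (\<exists>V V'. V \<noteq> V' \<and> Vs = {V, V'} \<and>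
     (\<forall>W\<in>Vs. uniformizes A W 1 \<and> card (residue_classes W) = card (residue_classes A)))"

definition inert_set :: "'b::field set \<Rightarrow> 'b alg_closure set set \<Rightarrow> bool" where
  "inert_set A Vs \<longleftrightarrow> (\<exists>V. Vs = {V} \<and> uniformizes A V 1 \<and> card (residue_classes V) = card (residue_classes A) ^ 2)"

context quadratic_extension
begin

text \<open>A good ring dominates \<open>A\<close>, so it contains a member of the list, and
  maximality of that member forces equality.\<close>

lemma good_iff_dominating:
  assumes "dominating Vs" "\<forall>V\<in>Vs. good V"
  shows "good V \<longleftrightarrow> V \<in> Vs"
proof
  assume V: "good V"
  have "to_ac p \<in> nonunits V" using V p_nonunit unfolding good_def by blast
  moreover have VV: "is_local V" "S \<subseteq> V" "V \<subseteq> L" "V \<noteq> L" using V unfolding good_def by auto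
  ultimately obtain V' where V': "V' \<in> Vs" "V' \<subseteq> V" using assms(1) unfolding dominating_def by meson
  have "good V'" using assms(2) V' by blast
  then have "V = V' \<or> V = L" using is_localD(1)[OF VV(1)] V'(2) VV(3) unfolding good_def by simp
  then have "V = V'" using VV(4) by simp
  then show "V \<in> Vs" using V' by simp
qed (use assms in auto)

text \<open>The first statement serves arbitrary places; the other three, which read the type off a
  root modulo \<open>p\<close>, serve the rational places.\<close>

lemma trichotomy:
  shows "ramified_set A (Collect good) \<or> split_set A (Collect good) \<or> inert_set A (Collect good)"
    and "(\<And>g. g \<in> A \<Longrightarrow> w g \<notin> nonunits A) \<Longrightarrow> inert_set A (Collect good)"
    and "\<And>g. g \<in> A \<Longrightarrow> w g \<in> nonunits A \<Longrightarrow> 2 * g + h1 \<in> nonunits A \<Longrightarrow> ramified_set A (Collect good)"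
    and "\<And>g. g \<in> A \<Longrightarrow> w g \<in> nonunits A \<Longrightarrow> 2 * g + h1 \<notin> nonunits A \<Longrightarrow> split_set A (Collect good)"
proof -
  have c: "Collect good = Vs" if "dominating Vs" "\<forall>V\<in>Vs. good V" for Vs
    using good_iff_dominating[OF that] by auto
  show I: "inert_set A (Collect good)" if "\<And>g. g \<in> A \<Longrightarrow> w g \<notin> nonunits A"
  proof -
    note t = that
    obtain V where V: "dominating {V}" "good V" "unif V 1" "card (residue_classes V) = card (residue_classes A) ^ 2"
      using inert_case[OF t] by auto
    then have "Collect good = {V}" using c[of "{V}"] by simp
    then show ?thesis using V unfolding inert_set_def by blast
  qed
  show R: "ramified_set A (Collect good)" if "g \<in> A" "w g \<in> nonunits A" "2 * g + h1 \<in> nonunits A" for g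
  proof -
    note t = that
    obtain V where V: "dominating {V}" "good V" "unif V 2" "card (residue_classes V) = card (residue_classes A)"
      using ramified_case[OF t] by auto
    then have "Collect good = {V}" using c[of "{V}"] by simp
    then show ?thesis using V unfolding ramified_set_def by blast
  qed
  show S: "split_set A (Collect good)" if g: "g \<in> A" "w g \<in> nonunits A" "2 * g + h1 \<notin> nonunits A" for g
  proof -
    obtain V V' where V: "V \<noteq> V'" "dominating {V, V'}"
      "\<forall>W\<in>{V, V'}. good W \<and> unif W 1 \<and> card (residue_classes W) = card (residue_classes A)"
      using split_case[OF g] by blast
    then have "Collect good = {V, V'}" using c[of "{V, V'}"] by blast
    then show ?thesis using V(1,3) unfolding split_set_def by metis
  qed
  show "ramified_set A (Collect good) \<or> split_set A (Collect good) \<or> inert_set A (Collect good)" using I R S by blast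
qed

end

definition eta :: "'a::field weierstrass \<Rightarrow> 'a poly fract set \<Rightarrow> 'a poly fract alg_closure" where
  "eta W x = (if x = place_inf then ycoord W / to_ac (var_fract ^ 2) else ycoord W)"

definition places_above :: "'a::field weierstrass \<Rightarrow> 'a poly fract set \<Rightarrow> 'a poly fract alg_closure set set" where
  "places_above W x = Collect (quadratic_extension.good x (eta W x))"

lemma quadratic_extension_place:
  assumes "elliptic W" "x \<in> places"
  shows "\<exists>p h1 h0. quadratic_extension x p h1 h0 (eta W x)"
proof (cases "x = place_inf")
  case True
  then show ?thesis using quadratic_extension_infinite[of W] by (auto simp: eta_def)
next
  case False
  then show ?thesis using quadratic_extension_finite[OF assms(1)] assms(2) by (auto simp: eta_def places_def)
qed

lemma places_above_trichotomy:
  assumes "elliptic W" "x \<in> places"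
  shows "ramified_set x (places_above W x) \<or> split_set x (places_above W x) \<or> inert_set x (places_above W x)"
  using quadratic_extension_place[OF assms] quadratic_extension.trichotomy(1) unfolding places_above_def by blast

section \<open>Closed points of a Weierstrass curve\<close>

definition embed :: "'a::field weierstrass \<Rightarrow> 'a poly fract poly \<Rightarrow> 'a poly fract alg_closure" where
  "embed W f = to_ac (coeff f 0) + to_ac (coeff f 1) * ycoord W"

lemma embed_pCons [simp]: "embed W [:a, b:] = to_ac a + to_ac b * ycoord W"
  by (simp add: embed_def)

lemma weierstrass_poly_eq: "weierstrass_poly W = [:c0 W, c1 W, 1:]"
  by (simp add: weierstrass_poly_def c0_def c1_def c0_poly_def c1_poly_def flip: to_fract_uminus)

lemma degree_weierstrass_poly: "degree (weierstrass_poly W) = 2"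
  by (simp add: weierstrass_poly_eq)

lemma weierstrass_curve_simps [simp]:
  "carrier (weierstrass_curve W) = {f. degree f < 2}"
  "f \<otimes>\<^bsub>weierstrass_curve W\<^esub> g = (f * g) mod weierstrass_poly W"
  "f \<oplus>\<^bsub>weierstrass_curve W\<^esub> g = f + g" "\<one>\<^bsub>weierstrass_curve W\<^esub> = 1" "\<zero>\<^bsub>weierstrass_curve W\<^esub> = 0"
  "scalars (weierstrass_curve W) = range (\<lambda>c. [:const_fract c:])"
  "coords (weierstrass_curve W) = {[:var_fract:], [:0, 1:], 1}"
  by (simp_all add: weierstrass_curve_def degree_weierstrass_poly)

lemma degree_less_2_cases:
  assumes "degree f < 2"
  obtains a b where "f = [:a, b:]"
proof -
  have "f = [:coeff f 0, coeff f 1:]"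
  proof (rule poly_eqI)
    fix n show "coeff f n = coeff [:coeff f 0, coeff f 1:] n"
      using assms by (cases n; cases "n - 1") (auto simp: coeff_eq_0 coeff_pCons split: nat.splits)
  qed
  then show ?thesis by (rule that)
qed

lemma degree_pCons_less_2: "degree [:a, b:] < 2"
  by simp

lemma weierstrass_mult:
  "([:a, b:] * [:c, d:]) mod weierstrass_poly W = [:a * c - c0 W * b * d, a * d + b * c - c1 W * b * d:]"
proof -
  let ?r = "[:a * c - c0 W * b * d, a * d + b * c - c1 W * b * d:]"
  have e: "[:a, b:] * [:c, d:] = ?r + [:b * d:] * weierstrass_poly W"
    by (simp add: weierstrass_poly_eq algebra_simps)
  have "?r mod weierstrass_poly W = ?r"
    by (rule mod_poly_less) (simp only: degree_weierstrass_poly degree_pCons_less_2)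
  then show ?thesis unfolding e mod_mult_self1 .
qed

definition field_image :: "'a::field weierstrass \<Rightarrow> 'a poly fract alg_closure set" where
  "field_image W = {to_ac a + to_ac b * ycoord W | a b. True}"

lemma embed_image: "embed W ` {f. degree f < 2} = field_image W"
proof
  show "embed W ` {f. degree f < 2} \<subseteq> field_image W"
    unfolding field_image_def using embed_pCons by (blast elim!: degree_less_2_cases)
  show "field_image W \<subseteq> embed W ` {f. degree f < 2}"
  proof
    fix f assume "f \<in> field_image W"
    then obtain a b where "f = embed W [:a, b:]" by (auto simp: field_image_def)
    then show "f \<in> embed W ` {f. degree f < 2}" using degree_pCons_less_2 by blast
  qed
qed

locale elliptic_curve =
  fixes W :: "'a::{field,finite} weierstrass"
  assumes elliptic: "elliptic W"
begin

abbreviation E where "E \<equiv> weierstrass_curve W"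
abbreviation P where "P \<equiv> (proj_line :: 'a poly fract curve)"
abbreviation Y where "Y \<equiv> ycoord W"
abbreviation h where "h \<equiv> embed W"
abbreviation K where "K \<equiv> field_image W"
abbreviation t where "t \<equiv> (var_fract :: 'a poly fract)"

text \<open>One instance at an arbitrarily chosen finite place gives access to the field arithmetic
  of \<open>1\<close> and \<open>Y\<close>, which is the same at all finite places.\<close>

lemmas quadratic_zero = quadratic_extension_finite[OF elliptic irreducible_X[of 0]]

lemma embed_mult:
  assumes "degree f < 2" "degree g < 2"
  shows "h ((f * g) mod weierstrass_poly W) = h f * h g"
proof -
  interpret Q: quadratic_extension "place [:0, 1:]" "to_fract [:0, 1:]" "c1 W" "c0 W" Y by (rule quadratic_zero)
  obtain a b c d where e: "f = [:a, b:]" "g = [:c, d:]" using assms by (meson degree_less_2_cases)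
  have "h [:a, b:] = Q.elt a b" for a b by (simp add: Q.elt_def)
  then show ?thesis unfolding e weierstrass_mult by (simp only: Q.elt_mult)
qed

lemma embed_eq_0: "degree f < 2 \<Longrightarrow> h f = 0 \<longleftrightarrow> f = 0"
proof -
  interpret Q: quadratic_extension "place [:0, 1:]" "to_fract [:0, 1:]" "c1 W" "c0 W" Y by (rule quadratic_zero)
  assume "degree f < 2"
  then obtain a b where e: "f = [:a, b:]" by (rule degree_less_2_cases)
  show ?thesis using Q.elt_eq_0[of a b] unfolding e by (simp add: Q.elt_def)
qed

lemma embed_diff: "h (f - g) = h f - h g"
  by (simp add: embed_def algebra_simps)

lemma embed_add: "h (f + g) = h f + h g"
  by (simp add: embed_def algebra_simps)

lemma embed_inj: "degree f < 2 \<Longrightarrow> degree g < 2 \<Longrightarrow> h f = h g \<Longrightarrow> f = g"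
  using embed_eq_0[of "f - g"] embed_diff[of f g] degree_diff_less[of f 2 g] by auto

lemma degree_mod_less_2: "degree (f mod weierstrass_poly W) < 2"
  using degree_mod_less[of "weierstrass_poly W" f] degree_weierstrass_poly[of W]
  by (metis degree_0 less_numeral_extra(3) zero_less_numeral)

lemma K_field:
  "is_subring K" "f \<in> K \<Longrightarrow> inverse f \<in> K"
proof -
  interpret Q: quadratic_extension "place [:0, 1:]" "to_fract [:0, 1:]" "c1 W" "c0 W" Y by (rule quadratic_zero)
  have "K = Q.L" by (simp add: field_image_def Q.L_def Q.elt_def)
  then show "is_subring K" "f \<in> K \<Longrightarrow> inverse f \<in> K" using Q.subring_L Q.inverse_L by auto
qed

lemma field_E: "field E"
proof (rule cring.cring_fieldI)
  show "cring E"
  proof (rule cringI)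
    show "abelian_group E"
    proof (rule abelian_groupI)
      show "x \<oplus>\<^bsub>E\<^esub> y \<in> carrier E" if "x \<in> carrier E" "y \<in> carrier E" for x y
        using that by (simp add: degree_add_less)
      show "\<exists>y\<in>carrier E. y \<oplus>\<^bsub>E\<^esub> x = \<zero>\<^bsub>E\<^esub>" if "x \<in> carrier E" for x
        using that by (intro bexI[of _ "- x"]) auto
    qed (auto simp: algebra_simps)
    show "comm_monoid E"
    proof (rule comm_monoidI)
      fix x y z assume xyz: "x \<in> carrier E" "y \<in> carrier E" "z \<in> carrier E"
      show "x \<otimes>\<^bsub>E\<^esub> y \<otimes>\<^bsub>E\<^esub> z = x \<otimes>\<^bsub>E\<^esub> (y \<otimes>\<^bsub>E\<^esub> z)"
        by (simp add: mod_mult_left_eq mod_mult_right_eq mult.assoc)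
      show "x \<otimes>\<^bsub>E\<^esub> y = y \<otimes>\<^bsub>E\<^esub> x" by (simp add: mult.commute)
      show "x \<otimes>\<^bsub>E\<^esub> y \<in> carrier E" by (simp add: degree_mod_less_2)
      show "\<one>\<^bsub>E\<^esub> \<otimes>\<^bsub>E\<^esub> x = x" using xyz by (simp add: mod_poly_less degree_weierstrass_poly)
    qed (auto)
    show "(x \<oplus>\<^bsub>E\<^esub> y) \<otimes>\<^bsub>E\<^esub> z = x \<otimes>\<^bsub>E\<^esub> z \<oplus>\<^bsub>E\<^esub> y \<otimes>\<^bsub>E\<^esub> z" for x y z
      by (simp add: distrib_right poly_mod_add_left)
  qed
  show "Units E = carrier E - {\<zero>\<^bsub>E\<^esub>}"
  proof
    show "Units E \<subseteq> carrier E - {\<zero>\<^bsub>E\<^esub>}" by (auto simp: Units_def)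
    show "carrier E - {\<zero>\<^bsub>E\<^esub>} \<subseteq> Units E"
    proof
      fix f assume f: "f \<in> carrier E - {\<zero>\<^bsub>E\<^esub>}"
      \<comment> \<open>Inverses are formed in the algebraic closure, where the norm formula shows
        that they stay in \<open>K\<close>, and are then pulled back.\<close>
      then have "h f \<in> K" "h f \<noteq> 0" using embed_image[of W] embed_eq_0[of f] by auto
      then have "inverse (h f) \<in> h ` {f. degree f < 2}" using K_field(2) embed_image[of W] by simp
      then obtain g where g: "degree g < 2" "h g = inverse (h f)" by auto
      have "h ((f * g) mod weierstrass_poly W) = h 1"
        using embed_mult[of f g] f g \<open>h f \<noteq> 0\<close> by (simp add: embed_def)
      then have "(f * g) mod weierstrass_poly W = 1"
        by (rule embed_inj[rotated 2]) (auto simp: degree_mod_less_2)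
      then have "f \<otimes>\<^bsub>E\<^esub> g = \<one>\<^bsub>E\<^esub>" "g \<otimes>\<^bsub>E\<^esub> f = \<one>\<^bsub>E\<^esub>" by (simp_all add: mult.commute)
      moreover have "f \<in> carrier E" "g \<in> carrier E" using f g by auto
      ultimately show "f \<in> Units E" unfolding Units_def by blast
    qed
  qed
qed

lemma curve_model_E: "curve_model E h"
proof (intro curve_model.intro curve_model_axioms.intro field_E)
  show "inj_on h (carrier E)" by (rule inj_onI) (auto intro: embed_inj)
  show "h (a \<otimes>\<^bsub>E\<^esub> b) = h a * h b" if "a \<in> carrier E" "b \<in> carrier E" for a b
    using that embed_mult by simp
  show "h (a \<oplus>\<^bsub>E\<^esub> b) = h a + h b" for a b by (simp add: embed_add)
  show "h \<one>\<^bsub>E\<^esub> = 1" by (simp add: embed_def)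
  show "coords E \<subseteq> carrier E" by auto
  interpret C: field E by (rule field_E)
  have m: "[:const_fract a:] \<otimes>\<^bsub>E\<^esub> [:const_fract b:] = [:const_fract (a * b):]" for a b
    by (simp add: mod_poly_less degree_weierstrass_poly)
  show "subfield (scalars E) E"
  proof (rule C.subfieldI')
    show "subring (scalars E) E"
    proof (rule C.subringI)
      show "\<one>\<^bsub>E\<^esub> \<in> scalars E" by (auto simp: one_pCons simp flip: const_fract_simps(2))
      show "\<ominus>\<^bsub>E\<^esub> f \<in> scalars E" if f: "f \<in> scalars E" for f
      proof -
        obtain a where a: "f = [:const_fract a:]" using f by auto
        have "[:const_fract (- a):] \<oplus>\<^bsub>E\<^esub> f = \<zero>\<^bsub>E\<^esub>" by (simp add: a)
        then have "\<ominus>\<^bsub>E\<^esub> f = [:const_fract (- a):]" using C.minus_equality[of _ f] by (simp add: a)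
        then show ?thesis using weierstrass_curve_simps(6)[of W] by (metis rangeI)
      qed
      show "f \<otimes>\<^bsub>E\<^esub> g \<in> scalars E" if fg: "f \<in> scalars E" "g \<in> scalars E" for f g
      proof -
        obtain a b where "f = [:const_fract a:]" "g = [:const_fract b:]" using fg by auto
        then show ?thesis using m[of a b] weierstrass_curve_simps(6)[of W] by (metis rangeI)
      qed
      show "f \<oplus>\<^bsub>E\<^esub> g \<in> scalars E" if "f \<in> scalars E" "g \<in> scalars E" for f g
        using that by (auto simp flip: const_fract_simps(3))
    qed auto
    show "inv\<^bsub>E\<^esub> f \<in> scalars E" if f: "f \<in> scalars E - {\<zero>\<^bsub>E\<^esub>}" for f
    proof -
      obtain a where a: "f = [:const_fract a:]" "a \<noteq> 0" using f by auto
      have "f \<otimes>\<^bsub>E\<^esub> [:const_fract (inverse a):] = \<one>\<^bsub>E\<^esub>"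
        using m[of a "inverse a"] a by (simp add: one_pCons)
      then have "inv\<^bsub>E\<^esub> f = [:const_fract (inverse a):]"
        using C.comm_inv_char[of f "[:const_fract (inverse a):]"] a by simp
      then show ?thesis by auto
    qed
  qed
qed

definition places_E where "places_E = (\<Union>x\<in>places. places_above W x)"

lemma places_aboveD:
  assumes "x \<in> places" "V \<in> places_above W x"
  shows "is_local V" "V \<subseteq> K" "V \<noteq> K" "to_ac ` x \<subseteq> V" "to_ac ` nonunits x \<subseteq> nonunits V" "eta W x \<in> V"
    "\<And>R. is_subring R \<Longrightarrow> V \<subseteq> R \<Longrightarrow> R \<subseteq> K \<Longrightarrow> R = V \<or> R = K"
    "finite (residue_classes V)"
proof -
  obtain p h1 h0 where Q: "quadratic_extension x p h1 h0 (eta W x)"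
    using quadratic_extension_place[OF elliptic assms(1)] by blast
  interpret Q: quadratic_extension x p h1 h0 "eta W x" by (rule Q)
  \<comment> \<open>At infinity the generator is rescaled by \<open>t ^ 2\<close>, which does not
    change the span over \<open>k(x)\<close>.\<close>
  have L: "Q.L = K"
  proof
    have T: "to_ac (t ^ 2) \<noteq> 0" by simp
    have "to_ac a + to_ac b * eta W x \<in> K" for a b
    proof (cases "x = place_inf")
      case True
      have "to_ac a + to_ac b * eta W x = to_ac a + to_ac (b / t ^ 2) * Y" by (simp add: eta_def True)
      then show ?thesis unfolding field_image_def by blast
    qed (auto simp: eta_def field_image_def)
    then show "Q.L \<subseteq> K" by (auto simp: Q.L_def Q.elt_def)
    have "to_ac a + to_ac b * Y \<in> Q.L" for a b
    proof (cases "x = place_inf")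
      case True
      have "Q.elt a (b * t ^ 2) = to_ac a + to_ac (b * t ^ 2) * eta W x" by (rule Q.elt_def)
      also have "\<dots> = to_ac a + to_ac b * Y" by (simp add: eta_def True)
      finally have "to_ac a + to_ac b * Y = Q.elt a (b * t ^ 2)" by simp
      then show ?thesis unfolding Q.L_def by blast
    next
      case False
      have "Q.elt a b = to_ac a + to_ac b * eta W x" by (rule Q.elt_def)
      then have "to_ac a + to_ac b * Y = Q.elt a b" using False by (simp add: eta_def)
      then show ?thesis unfolding Q.L_def by blast
    qed
    then show "K \<subseteq> Q.L" by (auto simp: field_image_def)
  qed
  have g: "Q.good V" using assms(2) by (simp add: places_above_def)
  then show "is_local V" "V \<subseteq> K" "V \<noteq> K" "to_ac ` nonunits x \<subseteq> nonunits V"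
    "\<And>R. is_subring R \<Longrightarrow> V \<subseteq> R \<Longrightarrow> R \<subseteq> K \<Longrightarrow> R = V \<or> R = K"
    unfolding Q.good_def L by auto
  have S: "Q.S \<subseteq> V" using g unfolding Q.good_def by blast
  then show "to_ac ` x \<subseteq> V" using Q.const_in_S by blast
  have "Q.elt 0 1 \<in> Q.S" using Q.S_eltI Q.A_closed(1,2) by blast
  then show "eta W x \<in> V" using S by (auto simp: Q.elt_def)
  have "finite (residue_classes x)" by (rule finite_residue_place[OF assms(1)])
  then have "card (residue_classes x) > 0"
    using is_subringD(1)[OF is_localD(1)[OF place_local(1)[OF assms(1)]]] by (auto simp: card_gt_0_iff residue_classes_def)
  then have "card (residue_classes V) > 0"
    using places_above_trichotomy[OF elliptic assms(1)] assms(2)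
    unfolding ramified_set_def split_set_def inert_set_def by auto
  then show "finite (residue_classes V)" by (rule card_ge_0_finite)
qed

lemma places_above_nonempty: "x \<in> places \<Longrightarrow> places_above W x \<noteq> {}"
  using places_above_trichotomy[OF elliptic] unfolding ramified_set_def split_set_def inert_set_def by blast

lemma places_above_dominated:
  assumes "x \<in> places" "is_local R" "to_ac ` x \<subseteq> R" "to_ac ` nonunits x \<subseteq> nonunits R" "eta W x \<in> R"
  shows "\<exists>V\<in>places_above W x. V \<subseteq> R"
proof -
  obtain p h1 h0 where Q: "quadratic_extension x p h1 h0 (eta W x)"
    using quadratic_extension_place[OF elliptic assms(1)] by blast
  interpret Q: quadratic_extension x p h1 h0 "eta W x" by (rule Q)
  note Rs = is_localD(1)[OF assms(2)]
  have "Q.S \<subseteq> R"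
  proof
    fix s assume "s \<in> Q.S"
    then obtain a b where "s = to_ac a + to_ac b * eta W x" "a \<in> x" "b \<in> x" by (auto simp: Q.S_def Q.elt_def)
    moreover from this have "to_ac a \<in> R" "to_ac b \<in> R" using assms(3) by auto
    ultimately show "s \<in> R" using is_subringD(4,6)[OF Rs] assms(5) by simp
  qed
  moreover have "to_ac p \<in> nonunits R" using assms(4) Q.p_nonunit by blast
  moreover have "\<exists>Vs. Q.dominating Vs \<and> (\<forall>V\<in>Vs. Q.good V)"
  proof (cases "\<exists>g\<in>x. Q.w g \<in> nonunits x")
    case False
    then obtain V where "Q.dominating {V}" "Q.good V" using Q.inert_case by blast
    then show ?thesis by (intro exI[of _ "{V}"]) simp
  next
    case True
    then obtain g where g: "g \<in> x" "Q.w g \<in> nonunits x" by blast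
    show ?thesis
    proof (cases "2 * g + h1 \<in> nonunits x")
      case True
      then obtain V where "Q.dominating {V}" "Q.good V" using Q.ramified_case g by blast
      then show ?thesis by (intro exI[of _ "{V}"]) simp
    next
      case False
      then obtain V V' where "Q.dominating {V, V'}" "\<forall>U\<in>{V, V'}. Q.good U" using Q.split_case g by meson
      then show ?thesis by blast
    qed
  qed
  ultimately show ?thesis using assms(2) unfolding Q.dominating_def places_above_def by blast
qed

end

text \<open>Places are valuation rings. This is what makes the place below a given point
  unique.\<close>

lemma place_valuation:
  assumes "x \<in> places" "u \<notin> x"
  shows "inverse u \<in> nonunits x"
proof -
  obtain S \<pi> where pp: "principal_prime S \<pi>" and S: "fractions S = UNIV" "x = loc S ((*) \<pi> ` S)"
    using places_cases[OF assms(1)] by metis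
  interpret principal_prime S \<pi> by fact
  have x: "x = V" by (rule S(2))
  have u0: "u \<noteq> 0" using assms(2) V_closed(2) x by auto
  then obtain n w where w: "w \<in> V" "inverse w \<in> V" "u = \<pi> ^ n * w \<or> \<pi> ^ n * u = w"
    using fractions_power[of u] S(1) by blast
  have piV: "\<pi> \<in> V" using pi_in S_subset by blast
  have "\<pi> ^ n * w \<in> V" using V_closed(4,7) piV w by blast
  then have e: "\<pi> ^ n * u = w" using w(3) assms(2) x by auto
  then have "w \<noteq> 0" using u0 pi_nz by auto
  then have "inverse u = \<pi> ^ n * inverse w" using e u0 by (auto simp: field_simps)
  then have "inverse u \<in> V" using V_closed(4,7) piV w by simp
  then show ?thesis using assms(2) x u0 unfolding nonunits_def by auto
qed

lemma var_in_place: "x \<in> places \<Longrightarrow> x \<noteq> place_inf \<Longrightarrow> var_fract \<in> x"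
  using place_poly_nonunits(2)[of _ "[:0, 1:]"] by (auto simp: places_def var_fract_def)

lemma local_vimage_to_ac:
  assumes "is_local R"
  shows "is_local {f. to_ac f \<in> R}" "nonunits {f. to_ac f \<in> R} = {f. to_ac f \<in> nonunits R}"
proof -
  note D = is_subringD[OF is_localD(1)[OF assms]]
  show n: "nonunits {f. to_ac f \<in> R} = {f. to_ac f \<in> nonunits R}" by (auto simp: nonunits_def)
  have "is_subring {f. to_ac f \<in> R}" by (rule is_subringI) (use D in auto)
  then show "is_local {f. to_ac f \<in> R}" unfolding is_local_def n using is_localD(2)[OF assms] by auto
qed

section \<open>Affine points, points at infinity and the three charts of the curve\<close>

context elliptic_curve
begin

abbreviation k where "k c \<equiv> to_ac (const_fract c)"
abbreviation T where "T \<equiv> to_ac t"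

lemma embed_simps [simp]: "h [:f:] = to_ac f" "h 1 = 1"
  by (simp_all add: embed_def)

lemma weierstrass_equation:
  "Y * Y + (k (a\<^sub>1 W) * T + k (a\<^sub>3 W)) * Y = T ^ 3 + k (a\<^sub>2 W) * T ^ 2 + k (a\<^sub>4 W) * T + k (a\<^sub>6 W)"
proof -
  have c1: "to_ac (c1 W) = k (a\<^sub>1 W) * T + k (a\<^sub>3 W)"
    by (simp add: c1_def c1_poly_def to_fract_pCons algebra_simps)
  have c0: "to_ac (c0 W) = - (T ^ 3 + k (a\<^sub>2 W) * T ^ 2 + k (a\<^sub>4 W) * T + k (a\<^sub>6 W))"
    unfolding c0_def c0_poly_def to_fract_uminus
    by (simp add: to_fract_pCons one_pCons[symmetric] power2_eq_square power3_eq_cube algebra_simps)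
  have "Y ^ 2 + to_ac (c1 W) * Y - (- to_ac (c0 W)) = 0" using ycoord_root[of W] by simp
  then show ?thesis unfolding c1 c0 by (simp only: minus_minus right_minus_eq power2_eq_square)
qed

lemma Y_nz: "Y \<noteq> 0" using embed_eq_0[of "[:0, 1:]"] by simp

lemma T_nz: "T \<noteq> 0" by simp

lemma places_E_affine:
  assumes "x \<in> places" "x \<noteq> place_inf" "V \<in> places_above W x"
  shows "T \<in> V" "Y \<in> V"
  using places_aboveD(4,6)[OF assms(1,3)] var_in_place[OF assms(1,2)] assms(2) by (auto simp: eta_def)

text \<open>With \<open>s = 1/x\<close> and \<open>e = y/x ^ 2\<close>, the equation divided by
  \<open>x ^ 4\<close> reads \<open>e * B = s * U\<close>, where \<open>U\<close> is 1 plus a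
  multiple of \<open>s\<close> and hence a unit. So \<open>x/y = s/e = B/U\<close> is regular, and
  so is \<open>1/y = s * (x/y)\<close>.\<close>

lemma places_E_infinite:
  assumes "V \<in> places_above W place_inf"
  shows "T / Y \<in> V" "inverse Y \<in> V"
proof -
  have x: "place_inf \<in> (places :: 'a poly fract set set)" by (simp add: places_def)
  note D = places_aboveD[OF x assms]
  note Vs = is_localD(1)[OF D(1)]
  note R = is_subringD[OF Vs]
  define e where "e = Y / T ^ 2"
  define s where "s = inverse T"
  have e: "e \<in> V" using D(6) by (simp add: eta_def e_def)
  have "to_ac (inverse t) \<in> nonunits V" using D(5) inverse_var_nonunit_place_inf by blast
  then have s: "s \<in> nonunits V" "s \<in> V" using nonunits_subset by (auto simp: s_def)
  have k: "k c \<in> V" for c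
  proof -
    have "const_fract c \<in> place_inf" using place_local(3)[OF x] by blast
    then show ?thesis using D(4) by blast
  qed
  define U where "U = 1 + s * (k (a\<^sub>2 W) + k (a\<^sub>4 W) * s + k (a\<^sub>6 W) * s ^ 2)"
  define B where "B = e + k (a\<^sub>1 W) * s + k (a\<^sub>3 W) * s ^ 2"
  have B: "B \<in> V" unfolding B_def by (intro R(4,6,7) e k s)
  have "s * (k (a\<^sub>2 W) + k (a\<^sub>4 W) * s + k (a\<^sub>6 W) * s ^ 2) \<in> nonunits V"
    by (intro nonunits_mult[OF Vs s(1)] R(4,6,7) k s(2))
  then have U: "U \<in> V" "U \<notin> nonunits V"
    unfolding U_def using unit_plus_nonunit[OF D(1) R(1) one_not_nonunit[OF Vs]] by auto
  then have U0: "U \<noteq> 0" "inverse U \<in> V" using zero_nonunit[OF Vs] by (auto simp: nonunits_def)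
  have "e * B * T ^ 4 = Y * Y + (k (a\<^sub>1 W) * T + k (a\<^sub>3 W)) * Y"
    using T_nz by (simp add: e_def B_def s_def field_simps power2_eq_square power4_eq_xxxx)
  also have "\<dots> = s * U * T ^ 4"
  proof -
    have sT: "s * T = 1" using T_nz by (simp add: s_def)
    have "s * U * T ^ 4 = (s * T) * T ^ 3 + k (a\<^sub>2 W) * (s * T) ^ 2 * T ^ 2 + k (a\<^sub>4 W) * (s * T) ^ 3 * T + k (a\<^sub>6 W) * (s * T) ^ 4"
      by (simp add: U_def algebra_simps power2_eq_square power3_eq_cube power4_eq_xxxx)
    then show ?thesis unfolding weierstrass_equation sT by simp
  qed
  finally have eB: "e * B = s * U" using T_nz by simp
  have e0: "e \<noteq> 0" using Y_nz by (simp add: e_def)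
  have "T / Y = s / e" using Y_nz T_nz by (simp add: s_def e_def field_simps power2_eq_square)
  also have "\<dots> = B * inverse U" using eB e0 U0(1) by (simp add: field_simps)
  finally show 1: "T / Y \<in> V" using R(4)[OF B U0(2)] by simp
  have "inverse Y = s * (T / Y)" using T_nz by (simp add: s_def field_simps)
  then show "inverse Y \<in> V" using R(4)[OF s(2) 1] by simp
qed

text \<open>By maximality of places the intersection of \<open>R\<close> with \<open>k(x)\<close> is
  \<open>x\<close> or everything. In the latter case \<open>R\<close> would contain \<open>Y\<close>
  as well and be the whole field, so \<open>R\<close> dominates \<open>x\<close>.\<close>

lemma dominated_by_place:
  assumes R: "is_local R" "R \<subseteq> K" "R \<noteq> K" and k: "range k \<subseteq> R"
    and x: "x \<in> places" "x \<subseteq> {f. to_ac f \<in> R}" "eta W x \<in> R"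
  shows "\<exists>V\<in>places_E. V \<subseteq> R"
proof -
  let ?R = "{f. to_ac f \<in> R}"
  note D = is_subringD[OF is_localD(1)[OF R(1)]]
  have "?R \<noteq> UNIV"
  proof
    assume U: "?R = UNIV"
    have a: "to_ac a \<in> R" for a using U by blast
    have "Y \<in> R"
    proof (cases "x = place_inf")
      case True
      then have "Y / T ^ 2 \<in> R" using x(3) by (simp add: eta_def)
      from D(4)[OF this a[of "t ^ 2"]] show ?thesis by simp
    qed (use x(3) in \<open>auto simp: eta_def\<close>)
    then have "K \<subseteq> R" using a D(4,6) unfolding field_image_def by auto
    then show False using R by blast
  qed
  then have eq: "?R = x"
    using place_maximal[OF x(1) is_localD(1)[OF local_vimage_to_ac(1)[OF R(1)]] x(2)] by simp
  have "to_ac ` x \<subseteq> R" using x(2) by blast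
  moreover have "to_ac ` nonunits x \<subseteq> nonunits R"
    using local_vimage_to_ac(2)[OF R(1)] unfolding eq by auto
  ultimately show ?thesis
    using places_above_dominated[OF x(1) R(1) _ _ x(3)] x(1) unfolding places_E_def by blast
qed

lemma dominated_affine:
  assumes R: "is_local R" "R \<subseteq> K" "R \<noteq> K" and k: "range k \<subseteq> R" and TY: "T \<in> R" "Y \<in> R"
  shows "\<exists>V\<in>places_E. V \<subseteq> R"
proof -
  let ?R = "{f. to_ac f \<in> R}"
  note D = is_subringD[OF is_localD(1)[OF R(1)]]
  have "?R \<noteq> UNIV"
  proof
    assume U: "?R = UNIV"
    have "to_ac a \<in> R" for a using U by blast
    then have "K \<subseteq> R" using TY D(4,6) unfolding field_image_def by auto
    then show False using R by blast
  qed
  then obtain x where x: "x \<in> places" "x \<subseteq> ?R"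
    using places_dominated[OF local_vimage_to_ac(1)[OF R(1)]] k TY(1) by auto
  then have "?R = x"
    using place_maximal[OF x(1) is_localD(1)[OF local_vimage_to_ac(1)[OF R(1)]] x(2)] \<open>?R \<noteq> UNIV\<close> by simp
  then have "t \<in> x" using TY(1) by blast
  then have "x \<noteq> place_inf" using var_notin_place_inf by auto
  then have "eta W x \<in> R" using TY(2) by (simp add: eta_def)
  then show ?thesis using dominated_by_place[OF R k x] by blast
qed

text \<open>Dividing the equation by \<open>x ^ 2\<close> expresses \<open>x\<close> as a polynomial
  in \<open>y/x\<close> and \<open>1/x\<close>. So the chart where \<open>x\<close> is nonzero lies
  in the affine chart, as it must: the only point at infinity is \<open>[0 : 1 : 0]\<close>.\<close>

lemma chart_x:
  assumes R: "is_subring R" "range k \<subseteq> R" and uv: "Y / T \<in> R" "inverse T \<in> R"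
  shows "T \<in> R" "Y \<in> R"
proof -
  note D = is_subringD[OF R(1)]
  have k: "k c \<in> R" for c using R(2) by blast
  let ?u = "Y / T" and ?v = "inverse T"
  let ?U = "?u * ?u + k (a\<^sub>1 W) * ?u + k (a\<^sub>3 W) * ?u * ?v - k (a\<^sub>2 W) - k (a\<^sub>4 W) * ?v - k (a\<^sub>6 W) * (?v * ?v)"
  have "?v * ?U * T ^ 3 = (Y * Y + (k (a\<^sub>1 W) * T + k (a\<^sub>3 W)) * Y) - k (a\<^sub>2 W) * T ^ 2 - k (a\<^sub>4 W) * T - k (a\<^sub>6 W)"
    using T_nz by (simp add: field_simps power2_eq_square power3_eq_cube)
  also have "\<dots> = 1 * T ^ 3" unfolding weierstrass_equation by simp
  finally have "?v * ?U = 1" using T_nz by simp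
  then have "inverse ?v = ?U" by (rule inverse_unique)
  then have "T = ?U" by (simp only: inverse_inverse_eq)
  moreover have "?U \<in> R" by (intro D(3,4,6) k uv)
  ultimately show T: "T \<in> R" by metis
  have "Y = Y / T * T" using T_nz by simp
  then show "Y \<in> R" using D(4)[OF uv(1) T] by simp
qed

text \<open>With \<open>z = x/y\<close> and \<open>m = 1/y\<close> the equation becomes
  \<open>m * U = z ^ 3\<close>. If \<open>m\<close> is a unit, the point is affine. Otherwise
  \<open>z\<close> is a nonunit too, \<open>U\<close> is a unit, and \<open>1/x = z ^ 2 / U\<close>
  and \<open>y/x ^ 2 = z / U\<close> lie in \<open>R\<close>, which puts the point above
  infinity.\<close>

lemma dominated_chart_y:
  assumes R: "is_local R" "R \<subseteq> K" "R \<noteq> K" and k: "range k \<subseteq> R" and zm: "T / Y \<in> R" "inverse Y \<in> R"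
  shows "\<exists>V\<in>places_E. V \<subseteq> R"
proof -
  note Rs = is_localD(1)[OF R(1)]
  note D = is_subringD[OF Rs]
  have kR: "k c \<in> R" for c using k by blast
  define z where "z = T / Y"
  define m where "m = inverse Y"
  have zmR: "z \<in> R" "m \<in> R" using zm by (auto simp: z_def m_def)
  show ?thesis
  proof (cases "m \<in> nonunits R")
    case False
    then have Y: "Y \<in> R" using zmR Y_nz by (auto simp: nonunits_def m_def)
    have "T = z * Y" using Y_nz by (simp add: z_def)
    then have "T \<in> R" using D(4)[OF zmR(1) Y] by simp
    then show ?thesis using dominated_affine[OF R k _ Y] by blast
  next
    case True
    define U where "U = 1 + (k (a\<^sub>1 W) * z + k (a\<^sub>3 W) * m - k (a\<^sub>2 W) * (z * z) - k (a\<^sub>4 W) * (z * m) - k (a\<^sub>6 W) * (m * m))"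
    have "m * U * Y ^ 3 = (Y * Y + (k (a\<^sub>1 W) * T + k (a\<^sub>3 W)) * Y) - k (a\<^sub>2 W) * T ^ 2 - k (a\<^sub>4 W) * T - k (a\<^sub>6 W)"
      using Y_nz by (simp add: U_def z_def m_def field_simps power2_eq_square power3_eq_cube)
    also have "\<dots> = T ^ 3" unfolding weierstrass_equation by simp
    also have "\<dots> = z * (z * z) * Y ^ 3" using Y_nz by (simp add: z_def power3_eq_cube)
    finally have mU: "m * U = z * (z * z)" using Y_nz by simp
    have UR: "U \<in> R" unfolding U_def by (intro D(1,3,4,6) kR zmR)
    have "z * (z * z) \<in> nonunits R" using nonunits_mult[OF Rs True UR] mU by simp
    then have z: "z \<in> nonunits R" using nonunits_mult_iff[OF Rs] zmR D(4) by blast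
    have 1: "z * k c \<in> nonunits R" "m * k c \<in> nonunits R" "z * z * k c \<in> nonunits R" "z * m * k c \<in> nonunits R"
      "m * m * k c \<in> nonunits R" for c
      using nonunits_mult[OF Rs] z True kR zmR by blast+
    have "k (a\<^sub>1 W) * z + k (a\<^sub>3 W) * m - k (a\<^sub>2 W) * (z * z) - k (a\<^sub>4 W) * (z * m) - k (a\<^sub>6 W) * (m * m) \<in> nonunits R"
      using 1 by (intro nonunits_diff[OF R(1)] is_localD(2)[OF R(1)]) (simp_all add: mult_ac)
    then have "U \<notin> nonunits R"
      unfolding U_def using unit_plus_nonunit(2)[OF R(1) D(1) one_not_nonunit[OF Rs]] by blast
    then have Ui: "U \<noteq> 0" "inverse U \<in> R" using UR by (auto simp: nonunits_def)
    have nz: "z \<noteq> 0" "m \<noteq> 0" using Y_nz T_nz by (auto simp: z_def m_def)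
    have m: "m = z * (z * z) / U" using mU Ui(1) by (simp add: field_simps)
    have "inverse T = m / z" using Y_nz by (simp add: z_def m_def field_simps)
    also have "\<dots> = z * (z * inverse U)" unfolding m using nz(1) by (simp add: field_simps)
    finally have s: "inverse T = z * (z * inverse U)" .
    have "Y / T ^ 2 = m / (z * z)" using Y_nz by (simp add: z_def m_def field_simps power2_eq_square)
    also have "\<dots> = z * inverse U" unfolding m using nz(1) by (simp add: field_simps)
    finally have e: "Y / T ^ 2 = z * inverse U" .
    have zU: "z * inverse U \<in> R" using D(4)[OF zmR(1) Ui(2)] .
    have sn: "inverse T \<in> nonunits R" unfolding s by (rule nonunits_mult[OF Rs z zU])
    let ?R = "{f. to_ac f \<in> R}"
    have "?R \<noteq> UNIV" using sn T_nz by (auto simp: nonunits_def)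
    moreover have "inverse t \<in> ?R" using sn nonunits_subset by auto
    ultimately obtain x where x: "x \<in> places" "x \<subseteq> ?R"
      using places_dominated[OF local_vimage_to_ac(1)[OF R(1)]] k by auto
    have "t \<notin> x" using x(2) sn T_nz by (auto simp: nonunits_def)
    then have "x = place_inf" using var_in_place[OF x(1)] by blast
    then have "eta W x \<in> R" using e zU by (simp add: eta_def)
    then show ?thesis using dominated_by_place[OF R k x] by blast
  qed
qed

theorem closed_points_E:
  "image h ` closed_points E = places_E" "\<And>y. y \<in> closed_points E \<Longrightarrow> y \<subseteq> carrier E"
proof -
  have K: "h ` carrier E = K" using embed_image[of W] by simp
  have sc: "h ` scalars E = range k" by (auto simp: image_iff)
  have inf: "place_inf \<in> (places :: 'a poly fract set set)" by (simp add: places_def)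
  have fin: "place [:c, 1:] \<in> places" "place [:c, 1:] \<noteq> place_inf" for c :: 'a
    unfolding places_def using irreducible_X[of c] place_inf_neq by auto
  have kV: "range k \<subseteq> V" if "x \<in> places" "V \<in> places_above W x" for x V
    using places_aboveD(4)[OF that] place_local(3)[OF that(1)] by auto
  have one: "1 \<in> V" if "x \<in> places" "V \<in> places_above W x" for x V
    using places_aboveD(1)[OF that] is_localD(1) is_subringD(1) by blast
  have VV: "is_local V \<and> V \<subseteq> h ` carrier E \<and> V \<noteq> h ` carrier E \<and> h ` scalars E \<subseteq> V \<and> finite (residue_classes V)"
    if V: "V \<in> places_E" for V
  proof -
    obtain x where x: "x \<in> places" "V \<in> places_above W x" using V unfolding places_E_def by blast
    show ?thesis unfolding K sc using places_aboveD(1,2,3,8)[OF x] kV[OF x] by simp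
  qed
  have max: "R = V \<or> R = h ` carrier E" if "V \<in> places_E" "is_subring R" "V \<subseteq> R" "R \<subseteq> h ` carrier E" for V R
    using that(2-4) places_aboveD(7) that(1)[unfolded places_E_def] unfolding K by blast
  have ch: "\<exists>c\<in>coords E. c \<noteq> \<zero>\<^bsub>E\<^esub> \<and> (\<forall>d\<in>coords E. h d / h c \<in> V)" if V: "V \<in> places_E" for V
  proof -
    obtain x where x: "x \<in> places" "V \<in> places_above W x" using V unfolding places_E_def by blast
    show ?thesis
    proof (cases "x = place_inf")
      case True
      then show ?thesis using places_E_infinite[of V] x one[OF x] Y_nz
        by (intro bexI[of _ "[:0, 1:]"]) (auto simp: divide_inverse)
    next
      case False
      then show ?thesis using places_E_affine[OF x(1) False x(2)] one[OF x]
        by (intro bexI[of _ 1]) auto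
    qed
  qed
  have ich: "\<exists>V\<in>places_E. \<forall>d\<in>coords E. h d / h c \<in> V" if c: "c \<in> coords E" "c \<noteq> \<zero>\<^bsub>E\<^esub>" for c
  proof -
    consider "c = [:t:]" | "c = [:0, 1:]" | "c = 1" using c by auto
    then show ?thesis
    proof cases
      case 1
      \<comment> \<open>A place at which both \<open>x\<close> and \<open>1/x\<close> are regular is
        required; \<open>x = 1\<close> is one.\<close>
      let ?x = "place [:-1, 1:] :: 'a poly fract set"
      obtain V where V: "V \<in> places_above W ?x" using places_above_nonempty[OF fin(1)] by blast
      note TY = places_E_affine[OF fin V]
      have "\<not> [:-1, 1:] dvd [:0, 1 :: 'a:]"
        using poly_eq_0_iff_dvd[of "[:0, 1 :: 'a:]" 1] by simp
      then have "inverse t \<in> ?x" using place_poly_nonunits(3)[OF irreducible_X] by blast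
      then have "inverse T \<in> V" using places_aboveD(4)[OF fin(1) V] by force
      then have "Y / T \<in> V" "1 / T \<in> V"
        using TY is_subringD(4)[OF is_localD(1)[OF places_aboveD(1)[OF fin(1) V]]] by (auto simp: divide_inverse)
      then show ?thesis using 1 one[OF fin(1) V] V fin(1) unfolding places_E_def by auto
    next
      case 2
      obtain V where V: "V \<in> places_above W place_inf" using places_above_nonempty[OF inf] by blast
      then show ?thesis using 2 places_E_infinite[OF V] one[OF inf V] inf Y_nz unfolding places_E_def
        by (auto simp: divide_inverse)
    next
      case 3
      obtain V where V: "V \<in> places_above W (place [:0, 1:])" using places_above_nonempty[OF fin(1)] by blast
      then show ?thesis using 3 places_E_affine[OF fin V] one[OF fin(1) V] fin(1) unfolding places_E_def by auto
    qed
  qed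
  have dom: "\<exists>V\<in>places_E. V \<subseteq> R"
    if R: "is_local R" "R \<subseteq> h ` carrier E" "R \<noteq> h ` carrier E" "h ` scalars E \<subseteq> R" "c \<in> coords E" "c \<noteq> \<zero>\<^bsub>E\<^esub>"
      "\<forall>d\<in>coords E. h d / h c \<in> R" for R c
  proof -
    note r = R(1-4)[unfolded K sc]
    consider "c = [:t:]" | "c = [:0, 1:]" | "c = 1" using R(5) by auto
    then show ?thesis
    proof cases
      case 1
      then have "Y / T \<in> R" "inverse T \<in> R" using R(7) by (auto simp: divide_inverse)
      then show ?thesis using chart_x[OF is_localD(1)[OF r(1)] r(4)] dominated_affine[OF r] by blast
    next
      case 2
      then have "T / Y \<in> R" "inverse Y \<in> R" using R(7) by (auto simp: divide_inverse)
      then show ?thesis using dominated_chart_y[OF r] by blast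
    next
      case 3
      then have "T \<in> R" "Y \<in> R" using R(7) by auto
      then show ?thesis using dominated_affine[OF r] by blast
    qed
  qed
  note eq = curve_model.closed_points_eq[OF curve_model_E, of places_E, OF VV max ch ich dom]
  show "image h ` closed_points E = places_E" by (rule eq(1))
  show "\<And>y. y \<in> closed_points E \<Longrightarrow> y \<subseteq> carrier E" by (rule eq(2))
qed

end

section \<open>Fibres of the x-coordinate map\<close>

lemma local_image_to_ac:
  assumes "is_local x"
  shows "is_local (to_ac ` x)" "nonunits (to_ac ` x) = to_ac ` nonunits x"
    "card (residue_classes (to_ac ` x)) = card (residue_classes x)"
proof -
  note D = is_subringD[OF is_localD(1)[OF assms]]
  have inv: "inverse (to_ac a) \<in> to_ac ` x \<longleftrightarrow> inverse a \<in> x" for a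
    by (auto simp: image_iff simp flip: to_ac_inverse)
  show n: "nonunits (to_ac ` x) = to_ac ` nonunits x"
    unfolding nonunits_def using inv by auto
  have "is_subring (to_ac ` x)"
  proof (rule is_subringI)
    show "1 \<in> to_ac ` x" using D(1) by (metis imageI to_ac_1)
    fix a b assume "a \<in> to_ac ` x" "b \<in> to_ac ` x"
    then obtain a' b' where ab: "a = to_ac a'" "b = to_ac b'" "a' \<in> x" "b' \<in> x" by blast
    then have "a - b = to_ac (a' - b')" "a * b = to_ac (a' * b')" by simp_all
    then show "a - b \<in> to_ac ` x" "a * b \<in> to_ac ` x" using D(3,4) ab by blast+
  qed
  moreover have "a + b \<in> to_ac ` nonunits x" if ab: "a \<in> to_ac ` nonunits x" "b \<in> to_ac ` nonunits x" for a b
  proof -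
    obtain a' b' where "a = to_ac a'" "b = to_ac b'" "a' \<in> nonunits x" "b' \<in> nonunits x" using ab by blast
    moreover from this have "a + b = to_ac (a' + b')" by simp
    ultimately show ?thesis using is_localD(2)[OF assms] by blast
  qed
  ultimately show l: "is_local (to_ac ` x)" unfolding is_local_def n by blast
  obtain R where R: "R \<subseteq> x" "\<And>a. a \<in> x \<Longrightarrow> \<exists>r\<in>R. a - r \<in> nonunits x"
    "\<And>r s. r \<in> R \<Longrightarrow> s \<in> R \<Longrightarrow> r - s \<in> nonunits x \<Longrightarrow> r = s" "card R = card (residue_classes x)"
    using residue_representatives[OF assms] by blast
  have mem: "to_ac a - to_ac b \<in> to_ac ` nonunits x \<longleftrightarrow> a - b \<in> nonunits x" for a b
    by (auto simp: image_iff simp flip: to_ac_diff)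
  have "card (residue_classes (to_ac ` x)) = card (to_ac ` R)"
  proof (rule card_residue_classes[OF l])
    show "to_ac ` R \<subseteq> to_ac ` x" using R(1) by blast
    show "\<exists>r\<in>to_ac ` R. a - r \<in> nonunits (to_ac ` x)" if a: "a \<in> to_ac ` x" for a
    proof -
      obtain a' where a': "a = to_ac a'" "a' \<in> x" using a by blast
      then obtain r where "r \<in> R" "a' - r \<in> nonunits x" using R(2) by blast
      then show ?thesis unfolding n a'(1) using mem by blast
    qed
    show "r = s" if rs: "r \<in> to_ac ` R" "s \<in> to_ac ` R" "r - s \<in> nonunits (to_ac ` x)" for r s
    proof -
      obtain r' s' where "r = to_ac r'" "s = to_ac s'" "r' \<in> R" "s' \<in> R" using rs by blast
      then show ?thesis using R(3)[of r' s'] mem[of r' s'] rs(3) unfolding n by simp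
    qed
  qed
  also have "\<dots> = card R" by (rule card_image) (auto simp: inj_on_def)
  finally show "card (residue_classes (to_ac ` x)) = card (residue_classes x)" using R(4) by simp
qed

context elliptic_curve
begin

abbreviation fib where "fib \<equiv> fiber E P x_pullback"

lemma embed_x_pullback: "h ` x_pullback ` Q = to_ac ` Q"
  by (simp add: x_pullback_def image_image)

lemma x_pullback_carrier: "x_pullback ` Q \<subseteq> carrier E"
  by (auto simp: x_pullback_def)

lemma max_ideal_P: "max_ideal P x = nonunits x"
  using curve_model.h_max_ideal[OF curve_model_proj_line, of x] by simp

lemma embed_subset_iff: "Q \<subseteq> carrier E \<Longrightarrow> Z \<subseteq> carrier E \<Longrightarrow> h ` Q \<subseteq> h ` Z \<longleftrightarrow> Q \<subseteq> Z"
  using embed_inj by (auto simp: subset_eq image_iff) metis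

lemma max_ideal_E: "y \<subseteq> carrier E \<Longrightarrow> h ` max_ideal E y = nonunits (h ` y)" "max_ideal E y \<subseteq> y"
  using curve_model.h_max_ideal[OF curve_model_E] curve_model.max_ideal_subset[OF curve_model_E] by auto

text \<open>If \<open>V\<close> lies above \<open>x'\<close> and dominates \<open>x\<close>, an
  element of \<open>x'\<close> outside \<open>x\<close> would have its inverse among the nonunits of
  \<open>V\<close>. Hence \<open>x'\<close> is contained in \<open>x\<close>, and maximality gives
  equality.\<close>

lemma places_above_iff:
  assumes x: "x \<in> places" and V: "V \<in> places_E"
  shows "V \<in> places_above W x \<longleftrightarrow> to_ac ` x \<subseteq> V \<and> to_ac ` nonunits x \<subseteq> nonunits V"
proof
  assume a: "to_ac ` x \<subseteq> V \<and> to_ac ` nonunits x \<subseteq> nonunits V"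
  obtain x' where x': "x' \<in> places" "V \<in> places_above W x'" using V unfolding places_E_def by blast
  have "x' \<subseteq> x"
  proof
    fix u assume u: "u \<in> x'"
    show "u \<in> x"
    proof (rule ccontr)
      assume "u \<notin> x"
      then have "inverse u \<in> nonunits x" by (rule place_valuation[OF x])
      then have n: "to_ac (inverse u) \<in> nonunits V" using a by blast
      have "u \<noteq> 0" using \<open>u \<notin> x\<close> is_subringD(2)[OF is_localD(1)[OF place_local(1)[OF x]]] by auto
      moreover have "to_ac u \<in> V" using places_aboveD(4)[OF x'] u by blast
      ultimately show False using n by (auto simp: nonunits_def)
    qed
  qed
  then have "x = x'"
    using place_maximal[OF x'(1) is_localD(1)[OF place_local(1)[OF x]]] place_local(2)[OF x] by blast
  then show "V \<in> places_above W x" using x' by simp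
next
  assume "V \<in> places_above W x"
  then show "to_ac ` x \<subseteq> V \<and> to_ac ` nonunits x \<subseteq> nonunits V" using places_aboveD(4,5)[OF x] by blast
qed

lemma fiber_iff:
  assumes x: "x \<in> places"
  shows "y \<in> fib x \<longleftrightarrow> y \<in> closed_points E \<and> h ` y \<in> places_above W x"
proof (cases "y \<in> closed_points E")
  case True
  then have y: "y \<subseteq> carrier E" "h ` y \<in> places_E" using closed_points_E by auto
  have m: "max_ideal E y \<subseteq> carrier E" using max_ideal_E(2) y(1) by blast
  have "y \<in> fib x \<longleftrightarrow> x_pullback ` x \<subseteq> y \<and> x_pullback ` nonunits x \<subseteq> max_ideal E y"
    using True by (simp add: fiber_def max_ideal_P)
  also have "\<dots> \<longleftrightarrow> to_ac ` x \<subseteq> h ` y \<and> to_ac ` nonunits x \<subseteq> nonunits (h ` y)"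
    using embed_subset_iff[OF x_pullback_carrier[of x] y(1)] embed_subset_iff[OF x_pullback_carrier[of "nonunits x"] m]
    unfolding embed_x_pullback max_ideal_E(1)[OF y(1)] by simp
  finally show ?thesis using places_above_iff[OF x y(2)] True by simp
qed (simp add: fiber_def)

lemma image_fiber:
  assumes x: "x \<in> places"
  shows "image h ` fib x = places_above W x"
proof
  show "image h ` fib x \<subseteq> places_above W x" using fiber_iff[OF x] by blast
  show "places_above W x \<subseteq> image h ` fib x"
  proof
    fix V assume V: "V \<in> places_above W x"
    then have "V \<in> image h ` closed_points E" unfolding closed_points_E places_E_def using x by blast
    then show "V \<in> image h ` fib x" using fiber_iff[OF x] V by blast
  qed
qed

lemma inj_on_closed_points: "inj_on (image h) (closed_points E)"
proof (rule inj_onI)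
  fix y z assume "y \<in> closed_points E" "z \<in> closed_points E" "h ` y = h ` z"
  then show "y = z"
    using embed_subset_iff[of y z] embed_subset_iff[of z y] closed_points_E(2)[of y] closed_points_E(2)[of z]
    by (metis order_refl subset_antisym)
qed

lemma inj_on_fiber: "x \<in> places \<Longrightarrow> inj_on (image h) (fib x)"
  using inj_on_closed_points by (rule inj_on_subset) (auto simp: fiber_def)

lemma in_fiber:
  assumes x: "x \<in> places" and y: "y \<in> fib x"
  shows "y \<subseteq> carrier E" "is_local (h ` y)" "h ` y \<in> places_above W x" "finite (residue_classes (h ` y))"
    "to_ac ` x \<subseteq> h ` y" "x_pullback ` x \<subseteq> y" "scalars E \<subseteq> y"
proof -
  have c: "y \<in> closed_points E" "h ` y \<in> places_above W x" using y fiber_iff[OF x] by auto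
  then show yc: "y \<subseteq> carrier E" "h ` y \<in> places_above W x" using closed_points_E(2) by auto
  show "is_local (h ` y)" "finite (residue_classes (h ` y))" "to_ac ` x \<subseteq> h ` y"
    using places_aboveD(1,4,8)[OF x c(2)] by auto
  show xy: "x_pullback ` x \<subseteq> y" using y by (simp add: fiber_def)
  have "[:const_fract a:] \<in> x_pullback ` x" for a
    using place_local(3)[OF x] by (auto simp: x_pullback_def)
  then show "scalars E \<subseteq> y" using xy by auto
qed

lemma ramification_index_fiber:
  assumes x: "x \<in> places" and y: "y \<in> fib x" and u: "uniformizes x (h ` y) e"
  shows "ramification_index E P x_pullback y x = e"
proof -
  note I = in_fiber[OF x y]
  obtain p h1 h0 where Q: "quadratic_extension x p h1 h0 (eta W x)"
    using quadratic_extension_place[OF elliptic x] by blast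
  obtain \<pi> w where w: "\<pi> \<in> h ` y" "\<pi> \<noteq> 0" "nonunits (h ` y) = (*) \<pi> ` h ` y"
    "to_ac ` nonunits x \<subseteq> (*) (\<pi> ^ e) ` h ` y" "\<pi> ^ e * w \<in> to_ac ` nonunits x" "w \<in> h ` y" "inverse w \<in> h ` y" "w \<noteq> 0"
    using u unfolding quadratic_extension.unif_def[OF Q] by metis
  show ?thesis
  proof (rule curve_model.ramification_index_eq[OF curve_model_E I(1,2) w(1-3)])
    show "h ` x_pullback ` max_ideal P x \<subseteq> (*) (\<pi> ^ e) ` h ` y"
      "\<pi> ^ e * w \<in> h ` x_pullback ` max_ideal P x"
      unfolding max_ideal_P embed_x_pullback by (rule w(4), rule w(5))
    show "x_pullback ` max_ideal P x \<subseteq> y"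
      unfolding max_ideal_P using I(6) nonunits_subset by blast
  qed (rule w)+
qed

lemma inertia_degree_fiber:
  assumes x: "x \<in> places" and y: "y \<in> fib x"
    and c: "card (residue_classes (h ` y)) = card (residue_classes x) ^ m"
  shows "inertia_degree E x_pullback y x = m"
proof -
  note I = in_fiber[OF x y]
  note L = local_image_to_ac[OF place_local(1)[OF x]]
  show ?thesis
    by (rule curve_model.inertia_degree_eq[OF curve_model_E I(1,2,6) _ _ I(4)])
      (use L c places_aboveD(5)[OF x I(3)] in \<open>auto simp: embed_x_pullback\<close>)
qed

text \<open>Multiplicativity of degrees in towers, read off from the exponents of
  \<open>q\<close>.\<close>

lemma point_degree_fiber:
  assumes x: "x \<in> places" and y: "y \<in> fib x"
    and c: "card (residue_classes (h ` y)) = card (residue_classes x) ^ m"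
  shows "point_degree E y = m * point_degree P x"
proof -
  note I = in_fiber[OF x y]
  have "card (scalars E) = card (UNIV :: 'a set)"
    by (simp add: card_image inj_on_def)
  then have "card (residue_classes (h ` y)) = card (scalars E) ^ (m * point_degree P x)"
    unfolding c card_residue_classes_places(1)[OF x] by (simp add: mult.commute flip: power_mult)
  then show ?thesis by (rule curve_model.point_degree_eq[OF curve_model_E I(1,2,7,4)])
qed

lemma fiber_of_image:
  assumes x: "x \<in> places" and V: "places_above W x = {V}"
  obtains y where "fib x = {y}" "h ` y = V"
proof -
  have "V \<in> image h ` fib x" using image_fiber[OF x] V by simp
  then obtain y where y: "y \<in> fib x" "h ` y = V" by (metis imageE)
  have "z = y" if "z \<in> fib x" for z
  proof -
    have "h ` z = h ` y" using in_fiber(3)[OF x that] V y(2) by simp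
    then show ?thesis by (rule inj_onD[OF inj_on_fiber[OF x] _ that y(1)])
  qed
  then have "fib x = {y}" using y(1) by blast
  then show ?thesis using y(2) by (rule that)
qed

section \<open>The three fibre types and their values of the character\<close>

abbreviation char where "char \<equiv> point_char E P x_pullback"
abbreviation split where "split \<equiv> is_split E P x_pullback"
abbreviation inert where "inert \<equiv> is_inert E P x_pullback"

lemma ramified_fiber:
  assumes x: "x \<in> places" and r: "ramified_set x (places_above W x)"
  shows "\<exists>y. fib x = {y} \<and> point_degree E y = point_degree P x" "char x = 0" "\<not> split x" "\<not> inert x"
proof -
  obtain V where V: "places_above W x = {V}" "uniformizes x V 2" "card (residue_classes V) = card (residue_classes x)"
    using r unfolding ramified_set_def by blast
  obtain y where y: "fib x = {y}" "h ` y = V" using fiber_of_image[OF x V(1)] .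
  then have yf: "y \<in> fib x" by simp
  have e: "ramification_index E P x_pullback y x = 2" using ramification_index_fiber[OF x yf] V(2) y(2) by simp
  have "point_degree E y = point_degree P x" using point_degree_fiber[OF x yf, of 1] V(3) y(2) by simp
  then show "\<exists>y. fib x = {y} \<and> point_degree E y = point_degree P x" using y by blast
  show "char x = 0" "\<not> split x" "\<not> inert x"
    using e y(1) by (auto simp: point_char_def is_ramified_def is_split_def is_inert_def)
qed

lemma inert_fiber:
  assumes x: "x \<in> places" and r: "inert_set x (places_above W x)"
  shows "\<exists>y. fib x = {y} \<and> point_degree E y = 2 * point_degree P x" "char x = -1" "\<not> split x" "inert x"
proof -
  obtain V where V: "places_above W x = {V}" "uniformizes x V 1" "card (residue_classes V) = card (residue_classes x) ^ 2"
    using r unfolding inert_set_def by blast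
  obtain y where y: "fib x = {y}" "h ` y = V" using fiber_of_image[OF x V(1)] .
  then have yf: "y \<in> fib x" by simp
  have e: "ramification_index E P x_pullback y x = 1" using ramification_index_fiber[OF x yf] V(2) y(2) by simp
  have f: "inertia_degree E x_pullback y x = 2" using inertia_degree_fiber[OF x yf] V(3) y(2) by simp
  have "point_degree E y = 2 * point_degree P x" using point_degree_fiber[OF x yf, of 2] V(3) y(2) by simp
  then show "\<exists>y. fib x = {y} \<and> point_degree E y = 2 * point_degree P x" using y by blast
  show "char x = -1" "\<not> split x" "inert x"
    using e f y(1) by (auto simp: point_char_def is_ramified_def is_split_def is_inert_def)
qed

lemma split_fiber:
  assumes x: "x \<in> places" and r: "split_set x (places_above W x)"
  shows "\<exists>y y'. y \<noteq> y' \<and> fib x = {y, y'} \<and> point_degree E y = point_degree P x \<and> point_degree E y' = point_degree P x"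
    "char x = 1" "split x" "\<not> inert x"
proof -
  obtain V V' where V: "V \<noteq> V'" "places_above W x = {V, V'}"
    "\<forall>U\<in>places_above W x. uniformizes x U 1 \<and> card (residue_classes U) = card (residue_classes x)"
    using r unfolding split_set_def by (elim exE conjE)
  have e: "ramification_index E P x_pullback y x = 1" "inertia_degree E x_pullback y x = 1"
    "point_degree E y = point_degree P x" if y: "y \<in> fib x" for y
  proof -
    have "h ` y \<in> places_above W x" using in_fiber(3)[OF x y] .
    then have u: "uniformizes x (h ` y) 1" "card (residue_classes (h ` y)) = card (residue_classes x) ^ 1"
      using V(3) by auto
    show "ramification_index E P x_pullback y x = 1" "inertia_degree E x_pullback y x = 1"
      "point_degree E y = point_degree P x"
      using ramification_index_fiber[OF x y u(1)] inertia_degree_fiber[OF x y u(2)] point_degree_fiber[OF x y u(2)] by auto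
  qed
  have VI: "V \<in> image h ` fib x" "V' \<in> image h ` fib x" unfolding image_fiber[OF x] V(2) by simp_all
  from VI(1) obtain y where y: "V = h ` y" "y \<in> fib x" by (rule imageE)
  from VI(2) obtain y' where y': "V' = h ` y'" "y' \<in> fib x" by (rule imageE)
  note y = y(2) y(1)[symmetric] y'(2) y'(1)[symmetric]
  have "z = y \<or> z = y'" if z: "z \<in> fib x" for z
  proof -
    have "h ` z = h ` y \<or> h ` z = h ` y'" using in_fiber(3)[OF x z] unfolding V(2) y(2,4) by simp
    then show ?thesis using inj_onD[OF inj_on_fiber[OF x] _ z y(1)] inj_onD[OF inj_on_fiber[OF x] _ z y(3)] by blast
  qed
  then have F: "fib x = {y, y'}" using y by blast
  moreover have ne: "y \<noteq> y'" using y(2,4) V(1) by metis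
  ultimately show "\<exists>y y'. y \<noteq> y' \<and> fib x = {y, y'} \<and> point_degree E y = point_degree P x \<and> point_degree E y' = point_degree P x"
    using e(3)[OF y(1)] e(3)[OF y(3)] by blast
  show "char x = 1" "split x" "\<not> inert x"
    using e F ne by (auto simp: point_char_def is_ramified_def is_split_def is_inert_def)
qed

lemma closed_points_fibers: "closed_points E = (\<Union>x\<in>places. fib x)"
proof
  show "closed_points E \<subseteq> (\<Union>x\<in>places. fib x)"
  proof
    fix y assume y: "y \<in> closed_points E"
    then have "h ` y \<in> places_E" using closed_points_E(1) by blast
    then show "y \<in> (\<Union>x\<in>places. fib x)" using fiber_iff y unfolding places_E_def by blast
  qed
qed (auto simp: fiber_def)

lemma fibers_disjoint:
  assumes "x \<in> places" "x' \<in> places" "y \<in> fib x" "y \<in> fib x'"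
  shows "x = x'"
proof -
  have "x \<subseteq> x'" if x: "x \<in> places" "x' \<in> places" "y \<in> fib x" "y \<in> fib x'" for x x'
  proof
    fix u assume u: "u \<in> x"
    show "u \<in> x'"
    proof (rule ccontr)
      assume "u \<notin> x'"
      then have "inverse u \<in> nonunits x'" by (rule place_valuation[OF x(2)])
      then have n: "to_ac (inverse u) \<in> nonunits (h ` y)"
        using places_aboveD(5)[OF x(2) in_fiber(3)[OF x(2,4)]] by blast
      have "u \<noteq> 0" using \<open>u \<notin> x'\<close> is_subringD(2)[OF is_localD(1)[OF place_local(1)[OF x(2)]]] by auto
      moreover have "to_ac u \<in> h ` y" using in_fiber(5)[OF x(1,3)] u by blast
      ultimately show False using n by (auto simp: nonunits_def)
    qed
  qed
  from this[OF assms] this[OF assms(2,1,4,3)] show ?thesis by blast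
qed

end

section \<open>Generating functions of effective cycles\<close>

text \<open>\<open>Sym\<close> with the point set and the degree function left free, so that one
  count serves the curve, the line and the factorizations of monic polynomials.\<close>

definition cycles :: "'x set \<Rightarrow> ('x \<Rightarrow> nat) \<Rightarrow> nat \<Rightarrow> 'x multiset set" where
  "cycles B d n = {\<alpha>. set_mset \<alpha> \<subseteq> B \<and> (\<Sum>x\<in>set_mset \<alpha>. count \<alpha> x * d x) = n}"

lemma sum_count_superset:
  assumes "finite B" "set_mset \<alpha> \<subseteq> B"
  shows "(\<Sum>x\<in>set_mset \<alpha>. count \<alpha> x * d x) = (\<Sum>x\<in>B. count \<alpha> x * d x)"
  using assms by (intro sum.mono_neutral_left) (auto simp: not_in_iff)

lemma prod_count_superset:
  assumes "finite B" "set_mset \<alpha> \<subseteq> B"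
  shows "(\<Prod>x\<in>set_mset \<alpha>. c x ^ count \<alpha> x) = (\<Prod>x\<in>B. c x ^ count \<alpha> x :: 'r::comm_semiring_1)"
  using assms by (intro prod.mono_neutral_left) (auto simp: not_in_iff)

text \<open>A point occurring in a cycle has degree at most that of the cycle. This is what makes
  finite Euler products sufficient.\<close>

lemma cycles_bounded:
  assumes "n \<le> N"
  shows "cycles B d n = cycles {x \<in> B. d x \<le> N} d n"
proof -
  have "d x \<le> N" if a: "\<alpha> \<in> cycles B d n" "x \<in># \<alpha>" for \<alpha> x
  proof -
    have "1 * d x \<le> count \<alpha> x * d x" using a(2) by (intro mult_right_mono) (auto simp: Suc_le_eq)
    also have "\<dots> \<le> (\<Sum>x\<in>set_mset \<alpha>. count \<alpha> x * d x)"
      by (rule member_le_sum[OF a(2), of "\<lambda>x. count \<alpha> x * d x"]) auto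
    also have "\<dots> = n" using a(1) by (simp add: cycles_def)
    finally show ?thesis using assms by simp
  qed
  then show ?thesis unfolding cycles_def by blast
qed

text \<open>For \<open>d > 0\<close> this is the series \<open>1 / (1 - c T ^ d)\<close>, the Euler
  factor of a point of degree \<open>d\<close>.\<close>

definition geometric :: "int \<Rightarrow> nat \<Rightarrow> int fps" where
  "geometric c d = Abs_fps (\<lambda>n. if d dvd n then c ^ (n div d) else 0)"

lemma geometric_inverse:
  assumes "d > 0"
  shows "(1 - fps_const c * fps_X ^ d) * geometric c d = 1"
proof (rule fps_ext)
  fix n
  have "fps_nth (fps_X ^ d * geometric c d) n = (if n < d then 0 else fps_nth (geometric c d) (n - d))"
    by (rule fps_X_power_mult_nth)
  then have e: "fps_nth ((1 - fps_const c * fps_X ^ d) * geometric c d) n =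
      fps_nth (geometric c d) n - c * (if n < d then 0 else fps_nth (geometric c d) (n - d))"
    by (simp add: left_diff_distrib mult.assoc)
  show "fps_nth ((1 - fps_const c * fps_X ^ d) * geometric c d) n = fps_nth 1 n"
  proof (cases "n < d")
    case True
    then have "d dvd n \<longleftrightarrow> n = 0" using dvd_imp_le by fastforce
    then show ?thesis unfolding e using True by (auto simp: geometric_def)
  next
    case False
    then have "n = (n - d) + d" by simp
    then obtain m where m: "n = m + d" by blast
    have "d dvd m + d \<longleftrightarrow> d dvd m" by simp
    moreover have "(m + d) div d = Suc (m div d)" using assms by simp
    ultimately have "fps_nth (geometric c d) n = c * fps_nth (geometric c d) (n - d)"
      by (simp add: geometric_def m)
    then show ?thesis unfolding e using False assms by simp
  qed
qed

text \<open>From \<open>(1 - T ^ d) (1 + T ^ d) = 1 - T ^ (2 d)\<close>. It is the Euler factor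
  above an inert point, where the degree doubles.\<close>

lemma geometric_mult_neg:
  assumes "d > 0"
  shows "geometric 1 d * geometric (-1) d = geometric 1 (2 * d)"
proof -
  let ?a = "1 - fps_const 1 * fps_X ^ d :: int fps" and ?b = "1 - fps_const (-1) * fps_X ^ d :: int fps"
  let ?c = "1 - fps_const 1 * fps_X ^ (2 * d) :: int fps"
  have "?a * ?b = ?c"
  proof -
    define x where "x = (fps_X :: int fps) ^ d"
    have x2: "fps_X ^ (2 * d) = x * x" unfolding x_def mult_2 by (rule power_add)
    show ?thesis unfolding x2 x_def[symmetric] by (simp add: algebra_simps flip: fps_const_neg)
  qed
  then have "geometric 1 d * geometric (-1) d * ?c = (?a * geometric 1 d) * (?b * geometric (-1) d)"
    by (simp only: mult_ac flip: \<open>?a * ?b = ?c\<close>)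
  also have "\<dots> = 1" unfolding geometric_inverse[OF assms] by simp
  finally have AC: "geometric 1 d * geometric (-1) d * ?c = 1" .
  have CG: "?c * geometric 1 (2 * d) = 1" using geometric_inverse[of "2 * d" 1] assms by simp
  have "geometric 1 d * geometric (-1) d = geometric 1 d * geometric (-1) d * (?c * geometric 1 (2 * d))"
    unfolding CG by simp
  also have "\<dots> = geometric 1 d * geometric (-1) d * ?c * geometric 1 (2 * d)" by (simp only: mult.assoc)
  also have "\<dots> = geometric 1 (2 * d)" unfolding AC by simp
  finally show ?thesis .
qed

lemma geometric_0: "d > 0 \<Longrightarrow> geometric 0 d = 1"
  using geometric_inverse[of d 0] by simp

text \<open>Induction on the set of points: separating the multiplicity of one point from a cycle
  matches the convolution of coefficients.\<close>

lemma euler_product: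
  assumes "finite B" "\<And>x. x \<in> B \<Longrightarrow> d x > 0"
  shows "finite (cycles B d n)"
    "fps_nth (\<Prod>x\<in>B. geometric (c x) (d x)) n = (\<Sum>\<alpha>\<in>cycles B d n. \<Prod>x\<in>set_mset \<alpha>. c x ^ count \<alpha> x)"
proof -
  have "finite (cycles B d n) \<and>
    fps_nth (\<Prod>x\<in>B. geometric (c x) (d x)) n = (\<Sum>\<alpha>\<in>cycles B d n. \<Prod>x\<in>set_mset \<alpha>. c x ^ count \<alpha> x)"
    using assms
  proof (induction B arbitrary: n rule: finite_induct)
    case empty
    have "cycles {} d n = (if n = 0 then {{#}} else {})" by (auto simp: cycles_def)
    then show ?case by simp
  next
    case (insert a B)
    let ?w = "\<lambda>\<alpha>. \<Prod>x\<in>set_mset \<alpha>. c x ^ count \<alpha> x"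
    let ?D = "{i \<in> {0..n}. d a dvd i}"
    \<comment> \<open>The index \<open>i\<close> is the degree contributed by \<open>a\<close>, not
      its multiplicity; hence the restriction to multiples of \<open>d a\<close>, outside which the
      coefficient of the factor vanishes.\<close>
    let ?S = "SIGMA i:?D. cycles B d (n - i)"
    let ?f = "\<lambda>(i, \<beta>). \<beta> + replicate_mset (i div d a) a"
    let ?g = "\<lambda>\<alpha>. (count \<alpha> a * d a, filter_mset (\<lambda>x. x \<noteq> a) \<alpha>)"
    have da: "d a > 0" using insert.prems by simp
    have aX: "count \<beta> a = 0" if "\<beta> \<in> cycles B d m" for \<beta> m
      using that insert.hyps(2) by (auto simp: cycles_def count_eq_zero_iff)
    have deg: "(\<Sum>x\<in>set_mset \<alpha>. count \<alpha> x * d x) = count \<alpha> a * d a + (\<Sum>x\<in>set_mset (filter_mset (\<lambda>x. x \<noteq> a) \<alpha>). count (filter_mset (\<lambda>x. x \<noteq> a) \<alpha>) x * d x)"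
      if "set_mset \<alpha> \<subseteq> insert a B" for \<alpha>
    proof -
      let ?\<beta> = "filter_mset (\<lambda>x. x \<noteq> a) \<alpha>"
      have "(\<Sum>x\<in>set_mset \<alpha>. count \<alpha> x * d x) = (\<Sum>x\<in>insert a B. count \<alpha> x * d x)"
        using that insert.hyps by (intro sum_count_superset) auto
      also have "\<dots> = count \<alpha> a * d a + (\<Sum>x\<in>B. count \<alpha> x * d x)" using insert.hyps by simp
      also have "(\<Sum>x\<in>B. count \<alpha> x * d x) = (\<Sum>x\<in>B. count ?\<beta> x * d x)"
        using insert.hyps by (intro sum.cong) auto
      also have "\<dots> = (\<Sum>x\<in>set_mset ?\<beta>. count ?\<beta> x * d x)"
        using that insert.hyps by (intro sum_count_superset[symmetric]) auto
      finally show ?thesis .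
    qed
    have wt: "?w (\<beta> + replicate_mset m a) = c a ^ m * ?w \<beta>" if "\<beta> \<in> cycles B d k" for \<beta> m k
    proof -
      have "set_mset \<beta> \<subseteq> B" using that by (simp add: cycles_def)
      then have "?w (\<beta> + replicate_mset m a) = (\<Prod>x\<in>insert a B. c x ^ count (\<beta> + replicate_mset m a) x)"
        using insert.hyps by (intro prod_count_superset) auto
      also have "\<dots> = c a ^ m * (\<Prod>x\<in>B. c x ^ count \<beta> x)"
        using insert.hyps aX[OF that] by (auto intro!: arg_cong2[of _ _ _ _ "(*)"] prod.cong)
      also have "(\<Prod>x\<in>B. c x ^ count \<beta> x) = ?w \<beta>"
        using insert.hyps \<open>set_mset \<beta> \<subseteq> B\<close> by (intro prod_count_superset[symmetric]) auto
      finally show ?thesis .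
    qed
    have gf: "?g (?f p) = p" if p: "p \<in> ?S" for p
    proof -
      obtain i \<beta> where e: "p = (i, \<beta>)" "i \<in> ?D" "\<beta> \<in> cycles B d (n - i)" using p by blast
      have "filter_mset (\<lambda>x. x \<noteq> a) \<beta> = \<beta>" using aX[OF e(3)] by (auto simp: filter_mset_eq_conv count_eq_zero_iff)
      moreover have "filter_mset (\<lambda>x. x \<noteq> a) (replicate_mset m a) = {#}" for m by (auto simp: filter_mset_eq_conv)
      ultimately show ?thesis using e aX[OF e(3)] by simp
    qed
    have fS: "?f p \<in> cycles (insert a B) d n" if p: "p \<in> ?S" for p
    proof -
      obtain i \<beta> where e: "p = (i, \<beta>)" "i \<in> ?D" "\<beta> \<in> cycles B d (n - i)" using p by blast
      have s: "set_mset (?f p) \<subseteq> insert a B" using e by (auto simp: cycles_def)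
      have g: "count (?f p) a * d a = i" "filter_mset (\<lambda>x. x \<noteq> a) (?f p) = \<beta>" using gf[OF p] unfolding e by auto
      have "(\<Sum>x\<in>set_mset (?f p). count (?f p) x * d x) = i + (n - i)"
        unfolding deg[OF s] g using e by (simp add: cycles_def)
      then show ?thesis using s e(2) by (simp add: cycles_def)
    qed
    have gS: "?g \<alpha> \<in> ?S" "?f (?g \<alpha>) = \<alpha>" if "\<alpha> \<in> cycles (insert a B) d n" for \<alpha>
    proof -
      have s: "set_mset \<alpha> \<subseteq> insert a B" "(\<Sum>x\<in>set_mset \<alpha>. count \<alpha> x * d x) = n"
        using that by (auto simp: cycles_def)
      show "?g \<alpha> \<in> ?S" using s(1) deg[OF s(1)] s(2) by (auto simp: cycles_def)
      show "?f (?g \<alpha>) = \<alpha>" using da by (auto simp: multiset_eq_iff)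
    qed
    have bij: "bij_betw ?f ?S (cycles (insert a B) d n)"
      by (rule bij_betw_byWitness[where f' = ?g]) (use gf fS gS in auto)
    have IH: "finite (cycles B d m)"
      "fps_nth (\<Prod>x\<in>B. geometric (c x) (d x)) m = (\<Sum>\<alpha>\<in>cycles B d m. ?w \<alpha>)" for m
      using insert.IH[of m] insert.prems by auto
    have finS: "finite ?S" using IH(1) by auto
    have "fps_nth (\<Prod>x\<in>insert a B. geometric (c x) (d x)) n =
        (\<Sum>i=0..n. fps_nth (geometric (c a) (d a)) i * (\<Sum>\<beta>\<in>cycles B d (n - i). ?w \<beta>))"
      using insert.hyps by (simp add: fps_mult_nth IH(2))
    also have "\<dots> = (\<Sum>i\<in>?D. c a ^ (i div d a) * (\<Sum>\<beta>\<in>cycles B d (n - i). ?w \<beta>))"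
      by (rule sum.mono_neutral_cong_right) (auto simp: geometric_def)
    also have "\<dots> = (\<Sum>i\<in>?D. \<Sum>\<beta>\<in>cycles B d (n - i). ?w (?f (i, \<beta>)))"
    proof (rule sum.cong[OF refl])
      fix i
      have "?w (?f (i, \<beta>)) = c a ^ (i div d a) * ?w \<beta>" if "\<beta> \<in> cycles B d (n - i)" for \<beta>
        unfolding prod.case by (rule wt[OF that])
      then show "c a ^ (i div d a) * (\<Sum>\<beta>\<in>cycles B d (n - i). ?w \<beta>) = (\<Sum>\<beta>\<in>cycles B d (n - i). ?w (?f (i, \<beta>)))"
        unfolding sum_distrib_left by (intro sum.cong) simp_all
    qed
    also have "\<dots> = (\<Sum>p\<in>?S. ?w (?f p))"
      using IH(1) by (subst sum.Sigma) (auto simp: case_prod_unfold)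
    also have "\<dots> = (\<Sum>\<alpha>\<in>cycles (insert a B) d n. ?w \<alpha>)"
      by (rule sum.reindex_bij_betw[OF bij])
    finally show ?case using bij_betw_finite[OF bij] finS by simp
  qed
  then show "finite (cycles B d n)"
    "fps_nth (\<Prod>x\<in>B. geometric (c x) (d x)) n = (\<Sum>\<alpha>\<in>cycles B d n. \<Prod>x\<in>set_mset \<alpha>. c x ^ count \<alpha> x)" by auto
qed

section \<open>Effective cycles on the projective line\<close>

definition monic_irreducibles :: "'a::field poly set" where
  "monic_irreducibles = {p. irreducible p \<and> lead_coeff p = 1}"

text \<open>A nonconstant divisor of least degree, made monic, is irreducible.\<close>

lemma monic_irreducible_divisor:
  fixes f :: "'a::field poly"
  assumes "degree f > 0"
  shows "\<exists>p\<in>monic_irreducibles. p dvd f"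
proof -
  obtain g where g: "degree g > 0 \<and> g dvd f" and min: "\<And>g'. degree g' > 0 \<and> g' dvd f \<Longrightarrow> degree g \<le> degree g'"
    using ex_has_least_nat[of "\<lambda>g. degree g > 0 \<and> g dvd f" f degree, OF conjI[OF assms dvd_refl]] by blast
  have g0: "g \<noteq> 0" using g by auto
  define p where "p = smult (inverse (lead_coeff g)) g"
  have p: "degree p = degree g" "lead_coeff p = 1" "p dvd f" "p \<noteq> 0"
    using g0 g by (auto simp: p_def smult_dvd_iff)
  have "irreducible p"
  proof (rule Factorial_Ring.irreducibleI[OF p(4)])
    show "\<not> p dvd 1" using is_unit_iff_degree[OF p(4)] p(1) g by simp
    fix a b assume ab: "p = a * b"
    then have nz: "a \<noteq> 0" "b \<noteq> 0" using p(4) by auto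
    have "a dvd f" "b dvd f" using p(3) ab dvd_trans by (metis dvd_triv_left, metis dvd_triv_right)
    then have "degree a = 0 \<or> degree p \<le> degree a" "degree b = 0 \<or> degree p \<le> degree b"
      using min[of a] min[of b] p(1) by auto
    moreover have "degree p = degree a + degree b" using nz by (simp add: ab degree_mult_eq)
    ultimately have "degree a = 0 \<or> degree b = 0" by auto
    then show "a dvd 1 \<or> b dvd 1" using nz is_unit_iff_degree by blast
  qed
  then show ?thesis using p by (auto simp: monic_irreducibles_def)
qed

lemma monic_irreducible_dvd_eq:
  assumes "p \<in> monic_irreducibles" "r \<in> monic_irreducibles" "p dvd r"
  shows "p = r"
proof -
  have pr: "irreducible p" "irreducible r" "lead_coeff p = 1" "lead_coeff r = 1"
    using assms by (auto simp: monic_irreducibles_def)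
  have "\<not> p dvd 1" using pr(1) by (simp add: irreducible_def)
  then have "r dvd p" using irreducibleD'[OF pr(2) assms(3)] by blast
  obtain c where c: "r = p * c" using assms(3) by blast
  have nz: "p \<noteq> 0" "r \<noteq> 0" using pr by auto
  then have "degree c = 0" using c dvd_imp_degree_le[OF \<open>r dvd p\<close>] by (auto simp: degree_mult_eq)
  then obtain e where e: "c = [:e:]" by (rule degree_eq_zeroE)
  then have "e = 1" using c pr(3,4) nz by (cases "e = 0") auto
  then show ?thesis using c e by simp
qed

lemma prod_mset_monic:
  assumes "set_mset \<alpha> \<subseteq> monic_irreducibles"
  shows "lead_coeff (prod_mset \<alpha>) = 1" "degree (prod_mset \<alpha>) = (\<Sum>x\<in>set_mset \<alpha>. count \<alpha> x * degree x)"
proof -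
  show "lead_coeff (prod_mset \<alpha>) = 1"
    using assms by (induction \<alpha>) (auto simp: lead_coeff_mult monic_irreducibles_def)
  have nz: "x \<noteq> 0" if "x \<in># \<alpha>" for x using assms that by (auto simp: monic_irreducibles_def)
  have "degree (prod_mset \<alpha>) = (\<Sum>x\<in>set_mset \<alpha>. degree (x ^ count \<alpha> x))"
    unfolding prod_mset_multiplicity using nz by (intro degree_prod_sum_eq) auto
  also have "\<dots> = (\<Sum>x\<in>set_mset \<alpha>. count \<alpha> x * degree x)"
    using nz by (intro sum.cong refl) (simp add: degree_power_eq)
  finally show "degree (prod_mset \<alpha>) = (\<Sum>x\<in>set_mset \<alpha>. count \<alpha> x * degree x)" .
qed

text \<open>Uniqueness of factorization: a prime factor of one product divides a factor of the
  other, both are monic irreducible, so they agree and can be cancelled.\<close>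

lemma prod_mset_monic_inj:
  assumes "set_mset \<alpha> \<subseteq> monic_irreducibles" "set_mset \<beta> \<subseteq> monic_irreducibles" "prod_mset \<alpha> = prod_mset \<beta>"
  shows "\<alpha> = \<beta>"
  using assms
proof (induction \<alpha> arbitrary: \<beta>)
  case empty
  have "\<beta> = {#}"
  proof (rule ccontr)
    assume "\<beta> \<noteq> {#}"
    then obtain x where x: "x \<in># \<beta>" by blast
    then have "x dvd 1" using dvd_prod_mset[OF x] empty by simp
    then show False using x empty by (auto simp: monic_irreducibles_def irreducible_def)
  qed
  then show ?case by simp
next
  case (add x \<alpha>)
  have x: "x \<in> monic_irreducibles" using add.prems by simp
  then have pr: "prime_elem x" "x \<noteq> 0" using field_poly_irreducible_imp_prime by (auto simp: monic_irreducibles_def)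
  have "x dvd prod_mset \<beta>" using add.prems(3) by (metis dvd_triv_left prod_mset.add_mset)
  then obtain y where y: "y \<in># \<beta>" "x dvd y" using prime_elem_dvd_prod_msetE[OF pr(1)] by blast
  then have "x = y" using monic_irreducible_dvd_eq[OF x] add.prems(2) by blast
  then obtain \<beta>' where b: "\<beta> = add_mset x \<beta>'" using y(1) mset_add by metis
  then have "prod_mset \<alpha> = prod_mset \<beta>'" using add.prems(3) pr(2) by simp
  then show ?case using add.IH[of \<beta>'] add.prems b by simp
qed

lemma prod_mset_monic_surj:
  fixes f :: "'a::field poly"
  assumes "lead_coeff f = 1"
  shows "\<exists>\<alpha>. set_mset \<alpha> \<subseteq> monic_irreducibles \<and> prod_mset \<alpha> = f"
  using assms
proof (induction "degree f" arbitrary: f rule: less_induct)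
  case less
  show ?case
  proof (cases "degree f = 0")
    case True
    then obtain c where "f = [:c:]" by (rule degree_eq_zeroE)
    then have "f = 1" using less.prems by (simp add: one_pCons)
    then show ?thesis by (intro exI[of _ "{#}"]) simp
  next
    case False
    then obtain p where p: "p \<in> monic_irreducibles" "p dvd f" using monic_irreducible_divisor by blast
    then obtain g where g: "f = p * g" by blast
    have "f \<noteq> 0" using less.prems by auto
    then have nz: "p \<noteq> 0" "g \<noteq> 0" using g by auto
    have "lead_coeff g = 1" using less.prems p(1) by (simp add: g lead_coeff_mult monic_irreducibles_def)
    moreover have "degree g < degree f"
      using nz irreducible_degree_pos[of p] p(1) by (simp add: g degree_mult_eq monic_irreducibles_def)
    ultimately obtain \<alpha> where "set_mset \<alpha> \<subseteq> monic_irreducibles" "prod_mset \<alpha> = g" using less.hyps by blast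
    then show ?thesis using p(1) g by (intro exI[of _ "add_mset p \<alpha>"]) auto
  qed
qed

text \<open>Unique factorization identifies these cycles with the monic polynomials of degree
  \<open>m\<close>, and subtracting the leading monomial leaves \<open>m\<close> free
  coefficients.\<close>

lemma card_cycles_monic_irreducibles:
  "card (cycles (monic_irreducibles :: 'a::{field,finite} poly set) degree m) = card (UNIV :: 'a set) ^ m"
proof -
  let ?M = "{f :: 'a poly. lead_coeff f = 1 \<and> degree f = m}"
  have "bij_betw prod_mset (cycles (monic_irreducibles :: 'a poly set) degree m) ?M"
    unfolding bij_betw_def
  proof
    show "inj_on prod_mset (cycles (monic_irreducibles :: 'a poly set) degree m)"
      by (rule inj_onI) (auto simp: cycles_def intro: prod_mset_monic_inj)
    show "prod_mset ` cycles (monic_irreducibles :: 'a poly set) degree m = ?M"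
    proof
      show "prod_mset ` cycles (monic_irreducibles :: 'a poly set) degree m \<subseteq> ?M"
        using prod_mset_monic by (auto simp: cycles_def)
      show "?M \<subseteq> prod_mset ` cycles (monic_irreducibles :: 'a poly set) degree m"
      proof
        fix f :: "'a poly" assume f: "f \<in> ?M"
        then obtain \<alpha> where "set_mset \<alpha> \<subseteq> monic_irreducibles" "prod_mset \<alpha> = f"
          using prod_mset_monic_surj[of f] by blast
        then show "f \<in> prod_mset ` cycles monic_irreducibles degree m"
          using prod_mset_monic[of \<alpha>] f by (intro image_eqI[of _ _ \<alpha>]) (auto simp: cycles_def)
      qed
    qed
  qed
  then have "card (cycles (monic_irreducibles :: 'a poly set) degree m) = card ?M" by (rule bij_betw_same_card)
  also have "?M = (\<lambda>r. monom 1 m + r) ` polys_below m"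
  proof
    show "?M \<subseteq> (\<lambda>r. monom 1 m + r) ` polys_below m"
    proof
      fix f :: "'a poly" assume f: "f \<in> ?M"
      have "coeff (f - monom 1 m) i = 0" if "i \<ge> m" for i
        using f that by (cases "i = m") (auto simp: coeff_eq_0)
      then have "f - monom 1 m \<in> polys_below m" unfolding polys_below_def by blast
      then show "f \<in> (\<lambda>r. monom 1 m + r) ` polys_below m"
        by (intro image_eqI[of _ _ "f - monom 1 m"]) auto
    qed
    show "(\<lambda>r. monom 1 m + r) ` polys_below m \<subseteq> ?M"
    proof clarify
      fix r :: "'a poly" assume r: "r \<in> polys_below m"
      have c: "coeff (monom 1 m + r) i = (if i = m then 1 else 0)" if "i \<ge> m" for i
        using r that by (simp add: polys_below_def)
      have "degree (monom 1 m + r) \<le> m" 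
      proof (rule degree_le, intro allI impI)
        fix i assume "m < i"
        then show "coeff (monom 1 m + r) i = 0" using c[of i] by simp
      qed
      moreover have "degree (monom 1 m + r) \<ge> m" by (rule le_degree) (use c[of m] in simp)
      ultimately show "lead_coeff (monom 1 m + r) = 1 \<and> degree (monom 1 m + r) = m" using c[of m] by simp
    qed
  qed
  also have "card \<dots> = card (UNIV :: 'a set) ^ m"
    by (subst card_image) (auto simp: inj_on_def card_polys_below)
  finally show ?thesis .
qed

lemma finite_places_bounded:
  "finite {p \<in> (monic_irreducibles :: 'a::{field,finite} poly set). degree p \<le> n}"
proof (rule finite_subset)
  show "{p \<in> (monic_irreducibles :: 'a poly set). degree p \<le> n} \<subseteq> polys_below (Suc n)"
  proof
    fix p :: "'a poly" assume "p \<in> {p \<in> monic_irreducibles. degree p \<le> n}"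
    then show "p \<in> polys_below (Suc n)" using polys_below_iff_degree[of "Suc n" p] by simp
  qed
qed (rule card_polys_below)

lemma places_eq: "places = insert place_inf (place ` monic_irreducibles)"
  by (simp add: places_def monic_irreducibles_def)

text \<open>The zeta function of the projective line is \<open>1 / ((1 - T) (1 - q T))\<close>.\<close>

theorem card_Sym_proj_line:
  "int (card (Sym n (proj_line :: 'a::{field,finite} poly fract curve))) = (\<Sum>m\<le>n. int (card (UNIV :: 'a set)) ^ m)"
proof -
  let ?P = "proj_line :: 'a poly fract curve"
  let ?d = "point_degree ?P"
  let ?M = "{p \<in> (monic_irreducibles :: 'a poly set). degree p \<le> n}"
  have dM: "?d (place p) = degree p" if "p \<in> monic_irreducibles" for p :: "'a poly"
    using point_degree_place(1)[of p] that by (auto simp: monic_irreducibles_def)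
  have dpos: "degree p > 0" if "p \<in> monic_irreducibles" for p :: "'a poly"
    using irreducible_degree_pos that by (auto simp: monic_irreducibles_def)
  have inf: "place_inf \<notin> place ` ?M" using place_inf_neq by (auto simp: monic_irreducibles_def)
  have inj: "inj_on place ?M" by (rule inj_onI) (auto simp: monic_irreducibles_def intro: place_inj)
  show ?thesis
  proof (cases "n = 0")
    \<comment> \<open>Treated separately because the place at infinity has degree 1 and so is not
      among the points of degree at most 0.\<close>
    case True
    have "Sym 0 ?P = {{#}}"
    proof -
      have "\<alpha> = {#}" if \<alpha>: "\<alpha> \<in> Sym 0 ?P" for \<alpha>
      proof (rule ccontr)
        assume "\<alpha> \<noteq> {#}"
        then obtain x where x: "x \<in># \<alpha>" by blast
        then have "x \<in> places" "count \<alpha> x * ?d x = 0"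
          using \<alpha> by (auto simp: Sym_def closed_points_proj_line)
        moreover have "count \<alpha> x > 0" using x by simp
        ultimately show False using card_residue_classes_places(2)[of x] by simp
      qed
      moreover have "{#} \<in> Sym 0 ?P" by (simp add: Sym_def)
      ultimately show ?thesis by blast
    qed
    then show ?thesis using True by simp
  next
    case False
    have "{x \<in> places. ?d x \<le> n} = insert place_inf (place ` ?M)"
      using False dM point_degree_place(2)[where 'a='a] unfolding places_eq by auto
    then have "Sym n ?P = cycles (insert place_inf (place ` ?M)) ?d n"
      using cycles_bounded[of n n places ?d] by (simp add: Sym_def cycles_def closed_points_proj_line)
    moreover have fin: "finite (insert place_inf (place ` ?M))" using finite_places_bounded by auto
    moreover have pos: "?d x > 0" if "x \<in> insert place_inf (place ` ?M)" for x
      using that dM dpos point_degree_place(2)[where 'a='a] by auto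
    ultimately have "int (card (Sym n ?P)) = fps_nth (\<Prod>x\<in>insert place_inf (place ` ?M). geometric 1 (?d x)) n"
      using euler_product(2)[OF fin pos, where c = "\<lambda>_. 1" and n = n] by simp
    also have "(\<Prod>x\<in>insert place_inf (place ` ?M). geometric 1 (?d x)) = geometric 1 1 * (\<Prod>p\<in>?M. geometric 1 (degree p))"
    proof -
      have "(\<Prod>x\<in>place ` ?M. geometric 1 (?d x)) = (\<Prod>p\<in>?M. geometric 1 (?d (place p)))"
        by (simp add: prod.reindex[OF inj])
      also have "\<dots> = (\<Prod>p\<in>?M. geometric 1 (degree p))" by (rule prod.cong[OF refl]) (simp add: dM)
      finally show ?thesis
        using inf finite_places_bounded[where 'a='a, of n] point_degree_place(2)[where 'a='a] by simp
    qed
    \<comment> \<open>The factor of the place at infinity is \<open>1 / (1 - T)\<close>, all of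
      whose coefficients are 1; multiplying by it forms partial sums.\<close>
    also have "fps_nth \<dots> n = (\<Sum>i=0..n. fps_nth (\<Prod>p\<in>?M. geometric 1 (degree p)) (n - i))"
      by (simp add: fps_mult_nth geometric_def)
    also have "\<dots> = (\<Sum>i=0..n. int (card (UNIV :: 'a set)) ^ (n - i))"
    proof (rule sum.cong[OF refl])
      fix i
      have "fps_nth (\<Prod>p\<in>?M. geometric 1 (degree p)) (n - i) = int (card (cycles ?M degree (n - i)))"
        using euler_product(2)[OF finite_places_bounded[where 'a='a, of n], of degree, where c = "\<lambda>_. 1" and n = "n - i"] dpos by simp
      also have "cycles ?M degree (n - i) = cycles monic_irreducibles degree (n - i)"
        using cycles_bounded[of "n - i" n "monic_irreducibles :: 'a poly set" degree] by simp
      finally show "fps_nth (\<Prod>p\<in>?M. geometric 1 (degree p)) (n - i) = int (card (UNIV :: 'a set)) ^ (n - i)"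
        by (simp add: card_cycles_monic_irreducibles)
    qed
    also have "\<dots> = (\<Sum>m\<le>n. int (card (UNIV :: 'a set)) ^ m)"
      by (rule sum.reindex_bij_witness[of _ "\<lambda>i. n - i" "\<lambda>i. n - i"]) auto
    finally show ?thesis .
  qed
qed

section \<open>Counting\<close>

context elliptic_curve
begin

definition roots_at :: "'a \<Rightarrow> 'a set" where
  "roots_at c = {y. y ^ 2 + a\<^sub>1 W * c * y + a\<^sub>3 W * y = c ^ 3 + a\<^sub>2 W * c ^ 2 + a\<^sub>4 W * c + a\<^sub>6 W}"

abbreviation point :: "'a \<Rightarrow> 'a poly fract set" where "point c \<equiv> place [:- c, 1:]"

lemma fiber_type_cases:
  assumes "x \<in> places"
  obtains (ram) "ramified_set x (places_above W x)" | (split) "split_set x (places_above W x)"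
    | (inert) "inert_set x (places_above W x)"
  using places_above_trichotomy[OF elliptic assms] by blast

lemma point_in_places: "point c \<in> places" "point c \<noteq> place_inf" "point_degree P (point c) = 1"
proof -
  have m: "[:- c, 1:] \<in> monic_irreducibles" using irreducible_X[of "- c"] by (simp add: monic_irreducibles_def)
  then show "point c \<in> places" "point c \<noteq> place_inf" "point_degree P (point c) = 1"
    using place_inf_neq point_degree_place(1)[of "[:- c, 1:]"] by (auto simp: places_eq monic_irreducibles_def)
qed

lemma rational_places: "{x \<in> places. point_degree P x = 1} = insert place_inf (range point)"
proof
  show "insert place_inf (range point) \<subseteq> {x \<in> places. point_degree P x = 1}"
    using point_in_places point_degree_place(2)[where 'a='a] by (auto simp: places_eq)
  show "{x \<in> places. point_degree P x = 1} \<subseteq> insert place_inf (range point)"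
  proof
    fix x assume x: "x \<in> {x \<in> places. point_degree P x = 1}"
    show "x \<in> insert place_inf (range point)"
    proof (cases "x = place_inf")
      case False
      then obtain p where p: "p \<in> monic_irreducibles" "x = place p" using x by (auto simp: places_eq)
      then have d: "degree p = 1" "lead_coeff p = 1"
        using x point_degree_place(1)[of p] by (auto simp: monic_irreducibles_def)
      have "degree p < 2" using d by simp
      then obtain a b where "p = [:a, b:]" by (rule degree_less_2_cases)
      then have "p = [:- (- a), 1:]" using d by (auto split: if_splits)
      then show ?thesis using p(2) by blast
    qed simp
  qed
qed

lemma inj_point: "inj point"
proof (rule injI)
  fix c d :: 'a assume "point c = point d"
  then have "[:- c, 1:] = [:- d, 1 :: 'a:]" using irreducible_X by (intro place_inj) auto
  then show "c = d" by simp
qed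

text \<open>Both coefficients of the equation at infinity vanish there, so 0 is a double root modulo
  the uniformizer.\<close>

lemma char_place_inf: "char place_inf = 0"
proof -
  have x: "place_inf \<in> (places :: 'a poly fract set set)" by (simp add: places_def)
  interpret Q: quadratic_extension place_inf "inverse t" "c1 W / t ^ 2" "c0 W / t ^ 4" "Y / to_ac (t ^ 2)"
    by (rule quadratic_extension_infinite)
  have "ramified_set place_inf (Collect Q.good)"
    using Q.trichotomy(3)[OF Q.A_closed(2)] coeffs_nonunit_inf[of W] by (simp add: Q.w_def)
  then have "ramified_set place_inf (places_above W place_inf)" by (simp add: places_above_def eta_def)
  then show ?thesis by (rule ramified_fiber(2)[OF x])
qed

text \<open>The solutions above \<open>c\<close> are the roots of \<open>w\<close> in the residue
  field, which consists of the constants. No root, a double root and two distinct roots give the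
  inert, ramified and split cases, with 0, 1 and 2 solutions.\<close>

lemma card_roots_at: "int (card (roots_at c)) = 1 + char (point c)"
proof -
  note x = point_in_places(1,2)[of c]
  let ?p = "[:- c, 1:] :: 'a poly"
  have p: "irreducible ?p" by (rule irreducible_X)
  interpret Q: quadratic_extension "point c" "to_fract ?p" "c1 W" "c0 W" Y
    by (rule quadratic_extension_finite[OF elliptic p])
  have good: "places_above W (point c) = Collect Q.good" using x(2) by (simp add: places_above_def eta_def)
  have pdvd: "to_fract f \<in> nonunits (point c) \<longleftrightarrow> poly f c = 0" for f
    using place_poly_nonunits(1)[OF p, of f] poly_eq_0_iff_dvd[of f c] by simp
  have const_in: "const_fract g \<in> point c" for g using place_local(3)[OF x(1)] by blast
  have w: "Q.w (const_fract g) \<in> nonunits (point c) \<longleftrightarrow> g \<in> roots_at c" for g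
  proof -
    have "Q.w (const_fract g) = to_fract ([:g:] ^ 2 + c1_poly W * [:g:] + c0_poly W)"
      unfolding Q.w_def by (simp add: const_fract_def c1_def c0_def power2_eq_square flip: to_fract_mult)
    then have "Q.w (const_fract g) \<in> nonunits (point c) \<longleftrightarrow> poly ([:g:] ^ 2 + c1_poly W * [:g:] + c0_poly W) c = 0"
      using pdvd by metis
    also have "\<dots> \<longleftrightarrow> g \<in> roots_at c"
      by (simp add: roots_at_def c1_poly_def c0_poly_def power2_eq_square power3_eq_cube algebra_simps)
    finally show ?thesis .
  qed
  let ?h = "a\<^sub>3 W + c * a\<^sub>1 W"
  have der: "2 * const_fract g + c1 W \<in> nonunits (point c) \<longleftrightarrow> g + g + ?h = 0" for g
  proof -
    have "2 * const_fract g + c1 W = to_fract ([:g:] + [:g:] + c1_poly W)"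
      unfolding mult_2 to_fract_add by (simp add: const_fract_def c1_def)
    then have "2 * const_fract g + c1 W \<in> nonunits (point c) \<longleftrightarrow> poly ([:g:] + [:g:] + c1_poly W) c = 0"
      using pdvd by metis
    then show ?thesis by (simp add: c1_poly_def add.assoc)
  qed
  \<comment> \<open>The difference of the equations for \<open>g'\<close> and \<open>g\<close>
    factors, the second root being the conjugate \<open>- ?h - g\<close>.\<close>
  have other: "g' \<in> roots_at c \<longleftrightarrow> g' = g \<or> g' = - ?h - g" if g: "g \<in> roots_at c" for g g'
  proof -
    have "g' \<in> roots_at c \<longleftrightarrow> g' ^ 2 + a\<^sub>1 W * c * g' + a\<^sub>3 W * g' = g ^ 2 + a\<^sub>1 W * c * g + a\<^sub>3 W * g"
      using g by (simp add: roots_at_def)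
    also have "\<dots> \<longleftrightarrow> (g' - g) * (g' - (- ?h - g)) = 0"
      by (simp add: algebra_simps power2_eq_square)
    finally show ?thesis by auto
  qed
  show ?thesis
  proof (cases "roots_at c = {}")
    case True
    \<comment> \<open>Inertness concerns all of the local ring, whereas the assumption concerns
      constants. Any \<open>g\<close> is congruent to a constant \<open>b\<close>, and
      \<open>g - b\<close> divides \<open>w g - w b\<close>.\<close>
    have "Q.w g \<notin> nonunits (point c)" if g: "g \<in> point c" for g
    proof
      assume wg: "Q.w g \<in> nonunits (point c)"
      interpret pp: principal_prime poly_fracts "to_fract ?p" by (rule principal_prime_poly[OF p])
      obtain f where f: "g - to_fract f \<in> nonunits (point c)"
        using pp.residue_in_S[of g] g unfolding place_def poly_fracts_def by blast
      define b where "b = const_fract (poly f c)"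
      have "to_fract (f - [:poly f c:]) \<in> nonunits (point c)" unfolding pdvd by simp
      then have fb: "to_fract f - b \<in> nonunits (point c)" by (simp add: b_def const_fract_def)
      have gb: "g - b \<in> nonunits (point c)" using is_localD(2)[OF Q.local_A f fb] by simp
      have "g + b + c1 W \<in> point c" unfolding b_def by (intro Q.A_closed(6) g const_in Q.h1_in)
      then have "(g - b) * (g + b + c1 W) \<in> nonunits (point c)"
        using nonunits_mult[OF is_localD(1)[OF Q.local_A] gb] by blast
      moreover have "Q.w b = Q.w g - (g - b) * (g + b + c1 W)"
        by (simp add: Q.w_def power2_eq_square algebra_simps)
      ultimately have "Q.w b \<in> nonunits (point c)" using nonunits_diff[OF Q.local_A wg] by simp
      then show False using w True unfolding b_def by blast
    qed
    then have "inert_set (point c) (places_above W (point c))" unfolding good by (rule Q.trichotomy(2))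
    then show ?thesis using inert_fiber(2)[OF x(1)] True by simp
  next
    case False
    then obtain g where g: "g \<in> roots_at c" by blast
    note wg = w[of g, THEN iffD2, OF g]
    show ?thesis
    proof (cases "g + g + ?h = 0")
      case True
      then have "- ?h - g = g" by (simp add: algebra_simps add_eq_0_iff)
      then have "roots_at c = {g}" using other[OF g] by auto
      moreover have "ramified_set (point c) (places_above W (point c))"
        unfolding good using Q.trichotomy(3)[OF const_in wg] der True by blast
      ultimately show ?thesis using ramified_fiber(2)[OF x(1)] by simp
    next
      case False
      then have "- ?h - g \<noteq> g" by (auto simp: algebra_simps add_eq_0_iff)
      moreover have "roots_at c = {g, - ?h - g}" using other[OF g] by auto
      moreover have "split_set (point c) (places_above W (point c))"
        unfolding good using Q.trichotomy(4)[OF const_in wg] der False by blast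
      ultimately show ?thesis using split_fiber(2)[OF x(1)] by simp
    qed
  qed
qed

lemma char_eq: "x \<in> places \<Longrightarrow> char x = of_bool (split x) - of_bool (inert x)"
proof -
  assume x: "x \<in> places"
  show ?thesis
    using fiber_type_cases[OF x]
    by cases (use ramified_fiber(2-4)[OF x] split_fiber(2-4)[OF x] inert_fiber(2-4)[OF x] in auto)
qed

text \<open>The sum of the character over the rational places is evaluated twice: by type it is the
  number of split minus inert places; by \<open>card_roots_at\<close> it is the number of affine
  solutions minus \<open>q\<close>. Infinity has character 0 and carries one point.\<close>

theorem frobenius_trace_eq: "frobenius_trace W = int (inert_count W) - int (split_count W)"
proof -
  let ?R = "{x \<in> places. point_degree P x = 1}"
  have fin: "finite ?R" unfolding rational_places by simp
  have "(\<Sum>x\<in>?R. char x) = (\<Sum>x\<in>?R. of_bool (split x)) - (\<Sum>x\<in>?R. of_bool (inert x))"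
    by (simp add: sum_subtractf[symmetric] char_eq)
  also have "(\<Sum>x\<in>?R. of_bool (split x)) = int (split_count W)"
    using fin by (simp add: split_count_def closed_points_proj_line sum.If_cases of_bool_def Collect_conj_eq[symmetric] Int_def conj_assoc)
  also have "(\<Sum>x\<in>?R. of_bool (inert x)) = int (inert_count W)"
    using fin by (simp add: inert_count_def closed_points_proj_line sum.If_cases of_bool_def Collect_conj_eq[symmetric] Int_def conj_assoc)
  finally have 1: "(\<Sum>x\<in>?R. char x) = int (split_count W) - int (inert_count W)" .
  have "place_inf \<notin> range point" using point_in_places(2) by auto
  then have "(\<Sum>x\<in>?R. char x) = (\<Sum>c\<in>UNIV. char (point c))"
    unfolding rational_places by (simp add: char_place_inf sum.reindex[OF inj_point])
  also have "\<dots> = (\<Sum>c\<in>UNIV. int (card (roots_at c)) - 1)" by (simp add: card_roots_at)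
  finally have 2: "(\<Sum>x\<in>?R. char x) = (\<Sum>c\<in>UNIV. int (card (roots_at c))) - int (card (UNIV :: 'a set))"
    by (simp add: sum_subtractf)
  have "rational_points W = insert None (Some ` (SIGMA c:UNIV. roots_at c))"
    by (auto simp: rational_points_def roots_at_def Sigma_def)
  then have "card (rational_points W) = Suc (card (SIGMA c:UNIV. roots_at c))"
    by (simp add: card_image)
  then have "card (rational_points W) = Suc (\<Sum>c\<in>UNIV. card (roots_at c))" by simp
  then show ?thesis using 1 2 by (simp add: frobenius_trace_def)
qed

text \<open>Ramified: the factor with character 0 is 1. Split: two points of the same degree give
  equal factors. Inert: \<open>geometric_mult_neg\<close>. The degree inequality allows truncation
  on the line to control truncation on the curve.\<close>

lemma fiber_euler_factor:
  assumes x: "x \<in> places"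
  shows "finite (fib x)" "(\<Prod>y\<in>fib x. geometric 1 (point_degree E y)) =
    geometric 1 (point_degree P x) * geometric (char x) (point_degree P x)"
    "y \<in> fib x \<Longrightarrow> point_degree P x \<le> point_degree E y"
proof -
  have d: "point_degree P x > 0" by (rule card_residue_classes_places(2)[OF x])
  have "finite (fib x) \<and> (\<Prod>y\<in>fib x. geometric 1 (point_degree E y)) =
    geometric 1 (point_degree P x) * geometric (char x) (point_degree P x) \<and>
    (\<forall>y\<in>fib x. point_degree P x \<le> point_degree E y)"
  proof (rule fiber_type_cases[OF x])
    assume r: "ramified_set x (places_above W x)"
    then show ?thesis using ramified_fiber(1,2)[OF x r] geometric_0[OF d] by auto
  next
    assume r: "split_set x (places_above W x)"
    obtain y y' where "y \<noteq> y'" "fib x = {y, y'}" "point_degree E y = point_degree P x" "point_degree E y' = point_degree P x"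
      using split_fiber(1)[OF x r] by (elim exE conjE)
    then show ?thesis using split_fiber(2)[OF x r] by simp
  next
    assume r: "inert_set x (places_above W x)"
    then show ?thesis using inert_fiber(1,2)[OF x r] geometric_mult_neg[OF d] by auto
  qed
  then show "finite (fib x)" "(\<Prod>y\<in>fib x. geometric 1 (point_degree E y)) =
    geometric 1 (point_degree P x) * geometric (char x) (point_degree P x)"
    "y \<in> fib x \<Longrightarrow> point_degree P x \<le> point_degree E y" by auto
qed

lemma finite_places_degree: "finite {x \<in> places. point_degree P x \<le> n}"
proof (rule finite_subset)
  show "{x \<in> places. point_degree P x \<le> n} \<subseteq> insert place_inf (place ` {p \<in> monic_irreducibles. degree p \<le> n})"
  proof
    fix x assume x: "x \<in> {x \<in> places. point_degree P x \<le> n}"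
    show "x \<in> insert place_inf (place ` {p \<in> monic_irreducibles. degree p \<le> n})"
    proof (cases "x = place_inf")
      case False
      then obtain p where p: "p \<in> monic_irreducibles" "x = place p" using x by (auto simp: places_eq)
      then have "degree p \<le> n" using x point_degree_place(1)[of p] by (auto simp: monic_irreducibles_def)
      then show ?thesis using p by blast
    qed simp
  qed
qed (use finite_places_bounded in auto)

theorem card_Sym_E:
  "int (card (Sym n E)) =
    (\<Sum>(i, j)\<in>{(i, j). i + j = n}. int (card (Sym i P)) * (\<Sum>\<alpha>\<in>Sym j P. weierstrass_char W \<alpha>))"
proof -
  let ?d = "point_degree P" and ?e = "point_degree E"
  let ?B = "{x \<in> places. ?d x \<le> n}"
  have finB: "finite ?B" by (rule finite_places_degree)
  have dpos: "?d x > 0" if "x \<in> ?B" for x using card_residue_classes_places(2) that by blast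
  \<comment> \<open>This set contains all points of \<open>E\<close> of degree at most
    \<open>n\<close>, but possibly also points of degree up to \<open>2 n\<close> above inert ones.
    They occur in no cycle of degree \<open>n\<close>, and keeping whole fibres lets the product
    factor over the line.\<close>
  let ?F = "\<Union>x\<in>?B. fib x"
  have finF: "finite ?F" using finB fiber_euler_factor(1) by auto
  have epos: "?e y > 0" if "y \<in> ?F" for y
  proof -
    obtain x where x: "x \<in> ?B" "y \<in> fib x" using \<open>y \<in> ?F\<close> by blast
    then show ?thesis using dpos[OF x(1)] fiber_euler_factor(3)[of x y] by simp
  qed
  have "Sym n E = cycles (closed_points E) ?e n" by (simp add: Sym_def cycles_def)
  also have "\<dots> = cycles {y \<in> closed_points E. ?e y \<le> n} ?e n" by (rule cycles_bounded) simp
  also have "{y \<in> closed_points E. ?e y \<le> n} = {y \<in> ?F. ?e y \<le> n}"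
    unfolding closed_points_fibers using fiber_euler_factor(3) by (auto intro: le_trans)
  also have "cycles {y \<in> ?F. ?e y \<le> n} ?e n = cycles ?F ?e n" by (rule cycles_bounded[symmetric]) simp
  finally have "int (card (Sym n E)) = fps_nth (\<Prod>y\<in>?F. geometric 1 (?e y)) n"
    using euler_product(2)[OF finF epos, where c = "\<lambda>_. 1" and n = n] by simp
  also have "(\<Prod>y\<in>?F. geometric 1 (?e y)) = (\<Prod>x\<in>?B. \<Prod>y\<in>fib x. geometric 1 (?e y))"
    using finB fiber_euler_factor(1) fibers_disjoint by (intro prod.UNION_disjoint) auto
  also have "\<dots> = (\<Prod>x\<in>?B. geometric 1 (?d x)) * (\<Prod>x\<in>?B. geometric (char x) (?d x))"
    unfolding prod.distrib[symmetric] by (rule prod.cong[OF refl]) (use fiber_euler_factor(2) in auto)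
  also have "fps_nth \<dots> n = (\<Sum>i=0..n. fps_nth (\<Prod>x\<in>?B. geometric 1 (?d x)) i * fps_nth (\<Prod>x\<in>?B. geometric (char x) (?d x)) (n - i))"
    by (rule fps_mult_nth)
  also have "\<dots> = (\<Sum>i=0..n. int (card (Sym i P)) * (\<Sum>\<alpha>\<in>Sym (n - i) P. weierstrass_char W \<alpha>))"
  proof (rule sum.cong[OF refl])
    fix i assume i: "i \<in> {0..n}"
    have S: "Sym m P = cycles ?B ?d m" if "m \<le> n" for m
      using cycles_bounded[OF that, of places ?d] by (simp add: Sym_def cycles_def closed_points_proj_line)
    have "fps_nth (\<Prod>x\<in>?B. geometric 1 (?d x)) i = int (card (Sym i P))"
      using euler_product(2)[OF finB dpos, where c = "\<lambda>_. 1" and n = i] S[of i] i by simp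
    moreover have "fps_nth (\<Prod>x\<in>?B. geometric (char x) (?d x)) (n - i) = (\<Sum>\<alpha>\<in>Sym (n - i) P. weierstrass_char W \<alpha>)"
      using euler_product(2)[OF finB dpos, where c = char and n = "n - i"] S[of "n - i"]
      by (simp add: weierstrass_char_def cycle_char_def)
    ultimately show "fps_nth (\<Prod>x\<in>?B. geometric 1 (?d x)) i * fps_nth (\<Prod>x\<in>?B. geometric (char x) (?d x)) (n - i) =
        int (card (Sym i P)) * (\<Sum>\<alpha>\<in>Sym (n - i) P. weierstrass_char W \<alpha>)" by simp
  qed
  also have "\<dots> = (\<Sum>(i, j)\<in>{(i, j). i + j = n}. int (card (Sym i P)) * (\<Sum>\<alpha>\<in>Sym j P. weierstrass_char W \<alpha>))"
    by (rule sum.reindex_bij_witness[of _ fst "\<lambda>i. (i, n - i)"]) auto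
  finally show ?thesis .
qed

end

theorem mainTheorem3:
  fixes W :: "'a::{field, finite} weierstrass"
  assumes "elliptic W"
  defines "q \<equiv> card (UNIV :: 'a set)"
  shows "frobenius_trace W = int (inert_count W) - int (split_count W) \<and>
    (\<forall>n. int (card (Sym n (weierstrass_curve W))) =
      (\<Sum>(i, j)\<in>{(i, j). i + j = n}.
        (\<Sum>m\<le>i. int q ^ m) * (\<Sum>\<alpha>\<in>Sym j (proj_line :: 'a poly fract curve). weierstrass_char W \<alpha>)))"
proof -
  interpret elliptic_curve W by unfold_locales (rule assms(1))
  show ?thesis
    using frobenius_trace_eq card_Sym_E card_Sym_proj_line[where 'a='a] by (simp add: q_def)
qed

end
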